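(* Let $X$ be a topological space and let $d$ be an odd positive integer. Suppose $\alpha_1,\ldots,\alpha_n\in H^d(X;\mathbb{R})$ are cohomology classes with real coefficients such that \[ \alpha_1 \smile \alpha_2 \smile \cdots \smile \alpha_n \neq 0. \] Then any simplicial cell complex homeomorphic to $X$ has at least $\operatorname{rank}_{\mathbb{R}}(\det_n)\geq \frac{n^{n-1}}{(n-1)!}$ simplices of dimension $nd$.
   Context: A simplicial cell complex is a CW-complex glued out of simplices in which every attaching map is a simplicial embedding: each simplex's characteristic map is injective and restricts on each face to a simplicial isomorphism onto a simplex of the complex (two simplices may share more than one face). For a vector space $V$ over a field $\mathbb{K}$ and a tensor $T\in V^{\otimes n}$, the rank $\operatorname{rank}_{\mathbb{K}}(T)$ is the minimal $r$ such that $T=\sum_{i=1}^r v_{i,1}\otimes\cdots\otimes v_{i,n}$ with all $v_{i,j}\in V$. The $n$th determinant tensor $\det_n\in(\mathbb{R}^n)^{\otimes n}$ is the determinant of $n\times n$ real matrices viewed as a tensor, i.e. $\det_n=\sum_{\pi\in S_n}\operatorname{sgn}(\pi)\, e_{\pi(1)}\otimes\cdots\otimes e_{\pi(n)}$ for the standard basis $e_1,\dots,e_n$. *)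

theory Defs
  imports "HOL-Homology.Homology" "HOL-Combinatorics.Permutations"
begin

section \<open>Singular cohomology and the cup product\<close>

text \<open>
  A \<open>p\<close>-cochain of \<open>X\<close> is a homomorphism from the free abelian group on the singular
  \<open>p\<close>-simplices of \<open>X\<close> to the coefficients, that is, a function on these simplices.
  It is normalised to be \<open>0\<close> off the singular \<open>p\<close>-simplices of \<open>X\<close>.
\<close>

type_synonym ('a, 'k) cochain = "((nat \<Rightarrow> real) \<Rightarrow> 'a) \<Rightarrow> 'k"

definition singular_cochain :: "nat \<Rightarrow> 'a topology \<Rightarrow> ('a, 'k::comm_ring_1) cochain \<Rightarrow> bool" where
  "singular_cochain p X c \<longleftrightarrow> (\<forall>\<sigma>. \<not> singular_simplex p X \<sigma> \<longrightarrow> c \<sigma> = 0)"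

definition cochain_coboundary ::
    "nat \<Rightarrow> 'a topology \<Rightarrow> ('a, 'k::comm_ring_1) cochain \<Rightarrow> ('a, 'k) cochain" where
  "cochain_coboundary p X c = (\<lambda>\<tau>. if singular_simplex (Suc p) X \<tau>
     then \<Sum>k\<le>Suc p. (-1) ^ k * c (singular_face (Suc p) k \<tau>) else 0)"

definition singular_cocycles :: "nat \<Rightarrow> 'a topology \<Rightarrow> ('a, 'k::comm_ring_1) cochain set" where
  "singular_cocycles p X = {c. singular_cochain p X c \<and> cochain_coboundary p X c = (\<lambda>_. 0)}"

definition singular_coboundaries :: "nat \<Rightarrow> 'a topology \<Rightarrow> ('a, 'k::comm_ring_1) cochain set" where
  "singular_coboundaries p X = (case p of 0 \<Rightarrow> {\<lambda>_. 0}
     | Suc q \<Rightarrow> cochain_coboundary q X ` Collect (singular_cochain q X))"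

definition cocycle_group :: "nat \<Rightarrow> 'a topology \<Rightarrow> ('a, 'k::comm_ring_1) cochain monoid" where
  "cocycle_group p X =
     \<lparr>carrier = singular_cocycles p X, monoid.mult = (\<lambda>f g \<sigma>. f \<sigma> + g \<sigma>), one = (\<lambda>_. 0)\<rparr>"

definition cohomology_group :: "nat \<Rightarrow> 'a topology \<Rightarrow> ('a, 'k::comm_ring_1) cochain set monoid" where
  "cohomology_group p X = cocycle_group p X Mod singular_coboundaries p X"

definition cohomology_class ::
    "nat \<Rightarrow> 'a topology \<Rightarrow> ('a, 'k::comm_ring_1) cochain \<Rightarrow> ('a, 'k) cochain set" where
  "cohomology_class p X f = singular_coboundaries p X #>\<^bsub>cocycle_group p X\<^esub> f"

text \<open>
  The front \<open>p\<close>-face of a singular simplex is its restriction to \<open>standard_simplex p\<close>, which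
  the library embeds in every higher-dimensional standard simplex; the back \<open>q\<close>-face of a
  singular \<open>(p + q)\<close>-simplex is spanned by the vertices \<open>p, \<dots>, p + q\<close>.
\<close>

definition front_face :: "nat \<Rightarrow> ((nat \<Rightarrow> real) \<Rightarrow> 'a) \<Rightarrow> (nat \<Rightarrow> real) \<Rightarrow> 'a" where
  "front_face p \<sigma> = restrict \<sigma> (standard_simplex p)"

definition back_face :: "nat \<Rightarrow> nat \<Rightarrow> ((nat \<Rightarrow> real) \<Rightarrow> 'a) \<Rightarrow> (nat \<Rightarrow> real) \<Rightarrow> 'a" where
  "back_face p q \<sigma> =
     restrict (\<lambda>x. \<sigma> (\<lambda>i. if i < p then 0 else x (i - p))) (standard_simplex q)"

definition cochain_cup :: "nat \<Rightarrow> nat \<Rightarrow> 'a topology \<Rightarrow>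
    ('a, 'k::comm_ring_1) cochain \<Rightarrow> ('a, 'k) cochain \<Rightarrow> ('a, 'k) cochain" where
  "cochain_cup p q X f g = (\<lambda>\<sigma>. if singular_simplex (p + q) X \<sigma>
     then f (front_face p \<sigma>) * g (back_face p q \<sigma>) else 0)"

text \<open>
  The cup product of cohomology classes is computed on representatives; all members of the
  union coincide (lemma \<open>cup_cohomology_class\<close> below).
\<close>

definition cup :: "nat \<Rightarrow> nat \<Rightarrow> 'a topology \<Rightarrow>
    ('a, 'k::comm_ring_1) cochain set \<Rightarrow> ('a, 'k) cochain set \<Rightarrow> ('a, 'k) cochain set" where
  "cup p q X a b = (\<Union>f\<in>a. \<Union>g\<in>b. cohomology_class (p + q) X (cochain_cup p q X f g))"

definition cohomology_unit :: "'a topology \<Rightarrow> ('a, 'k::comm_ring_1) cochain set" where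
  "cohomology_unit X = cohomology_class 0 X (\<lambda>\<sigma>. if singular_simplex 0 X \<sigma> then 1 else 0)"

text \<open>
  \<open>cup_prod d X \<alpha> n\<close> is \<open>\<alpha> 0 \<smile> \<dots> \<smile> \<alpha> (n - 1)\<close>, for classes \<open>\<alpha> i\<close> of
  degree \<open>d\<close>; the initial unit class is absorbed by \<open>\<alpha> 0\<close> (lemma \<open>cup_cohomology_unit\<close>).
\<close>

primrec cup_prod :: "nat \<Rightarrow> 'a topology \<Rightarrow>
    (nat \<Rightarrow> ('a, 'k::comm_ring_1) cochain set) \<Rightarrow> nat \<Rightarrow> ('a, 'k) cochain set" where
  "cup_prod d X \<alpha> 0 = cohomology_unit X"
| "cup_prod d X \<alpha> (Suc n) = cup (n * d) d X (cup_prod d X \<alpha> n) (\<alpha> n)"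

subsection \<open>The cup product is well defined on cohomology classes\<close>

lemma singular_cochainI: "(\<And>\<sigma>. \<not> singular_simplex p X \<sigma> \<Longrightarrow> c \<sigma> = 0) \<Longrightarrow> singular_cochain p X c"
  by (simp add: singular_cochain_def)

lemma singular_cochain_coboundary: "singular_cochain (Suc p) X (cochain_coboundary p X c)"
  by (simp add: singular_cochain_def cochain_coboundary_def)

lemma singular_cochain_cup: "singular_cochain (p + q) X (cochain_cup p q X f g)"
  by (simp add: singular_cochain_def cochain_cup_def)

lemma singular_cochain_zero: "singular_cochain p X (\<lambda>_. 0)"
  by (simp add: singular_cochain_def)

lemma singular_cochain_lincomb:
  "singular_cochain p X f \<Longrightarrow> singular_cochain p X g \<Longrightarrow>
     singular_cochain p X (\<lambda>\<sigma>. a * f \<sigma> + b * g \<sigma>)"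
  by (simp add: singular_cochain_def)

lemma cochain_coboundary_lincomb:
  "cochain_coboundary p X (\<lambda>\<sigma>. a * f \<sigma> + b * g \<sigma>) =
     (\<lambda>\<tau>. a * cochain_coboundary p X f \<tau> + b * cochain_coboundary p X g \<tau>)"
  by (rule ext)
     (simp add: cochain_coboundary_def sum_distrib_left algebra_simps flip: sum.distrib)

lemma cochain_coboundary_zero: "cochain_coboundary p X (\<lambda>_. 0) = (\<lambda>_. 0)"
  by (simp add: cochain_coboundary_def fun_eq_iff)

definition chain_eval :: "('a, 'k::comm_ring_1) cochain \<Rightarrow> 'a chain \<Rightarrow> 'k" where
  "chain_eval c z = (\<Sum>\<sigma>\<in>Poly_Mapping.keys z. of_int (Poly_Mapping.lookup z \<sigma>) * c \<sigma>)"

lemma chain_eval_superset: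
  assumes "finite S" "Poly_Mapping.keys z \<subseteq> S"
  shows "chain_eval c z = (\<Sum>\<sigma>\<in>S. of_int (Poly_Mapping.lookup z \<sigma>) * c \<sigma>)"
  unfolding chain_eval_def
  by (rule sum.mono_neutral_left) (use assms in \<open>auto simp: in_keys_iff\<close>)

lemma chain_eval_0 [simp]: "chain_eval c 0 = 0"
  by (simp add: chain_eval_def)

lemma chain_eval_add: "chain_eval c (y + z) = chain_eval c y + chain_eval c z"
proof -
  let ?S = "Poly_Mapping.keys y \<union> Poly_Mapping.keys z"
  have *: "finite ?S" "Poly_Mapping.keys (y + z) \<subseteq> ?S"
    using keys_add[of y z] by auto
  show ?thesis
    by (simp add: chain_eval_superset[OF *(1)] *(2) lookup_add algebra_simps flip: sum.distrib)
qed

lemma chain_eval_cmul: "chain_eval c (frag_cmul a z) = of_int a * chain_eval c z"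
  using chain_eval_superset[of "Poly_Mapping.keys z" "frag_cmul a z" c] keys_cmul[of a z]
  by (simp add: chain_eval_def sum_distrib_left mult.assoc)

lemma chain_eval_of: "chain_eval c (frag_of \<sigma>) = c \<sigma>"
  by (simp add: chain_eval_def)

lemma chain_eval_sum: "chain_eval c (sum h I) = (\<Sum>i\<in>I. chain_eval c (h i))"
  by (induction I rule: infinite_finite_induct) (simp_all add: chain_eval_add)

lemma chain_eval_coboundary_of:
  "singular_simplex (Suc p) X \<tau> \<Longrightarrow>
     cochain_coboundary p X c \<tau> = chain_eval c (chain_boundary (Suc p) (frag_of \<tau>))"
  by (simp add: cochain_coboundary_def chain_boundary_of chain_eval_sum chain_eval_cmul
      chain_eval_of del: sum.atMost_Suc)

lemma chain_eval_frag_extend: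
  "chain_eval c (frag_extend h z) =
     (\<Sum>\<sigma>\<in>Poly_Mapping.keys z. of_int (Poly_Mapping.lookup z \<sigma>) * chain_eval c (h \<sigma>))"
  by (simp add: frag_extend_def chain_eval_sum chain_eval_cmul)

lemma chain_eval_coboundary:
  assumes "singular_chain (Suc p) X z"
  shows "chain_eval (cochain_coboundary p X c) z = chain_eval c (chain_boundary (Suc p) z)"
proof -
  have "cochain_coboundary p X c \<sigma> =
      chain_eval c (\<Sum>k\<le>Suc p. frag_cmul ((- 1) ^ k) (frag_of (singular_face (Suc p) k \<sigma>)))"
    if "\<sigma> \<in> Poly_Mapping.keys z" for \<sigma>
    using chain_eval_coboundary_of[of p X \<sigma> c] assms that
    by (auto simp: singular_chain_def chain_boundary_of)
  then show ?thesis
    by (simp add: chain_eval_def[of "cochain_coboundary p X c"] chain_boundary_def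
        chain_eval_frag_extend)
qed

lemma cochain_coboundary_coboundary:
  "cochain_coboundary (Suc p) X (cochain_coboundary p X c) = (\<lambda>_. 0)"
proof
  fix \<tau> :: "(nat \<Rightarrow> real) \<Rightarrow> 'a"
  show "cochain_coboundary (Suc p) X (cochain_coboundary p X c) \<tau> = 0"
  proof (cases "singular_simplex (Suc (Suc p)) X \<tau>")
    case True
    then have \<tau>: "singular_chain (Suc (Suc p)) X (frag_of \<tau>)"
      by (simp add: singular_chain_of)
    have "chain_boundary (Suc p) (chain_boundary (Suc (Suc p)) (frag_of \<tau>)) = 0"
      using chain_boundary_boundary_alt[OF \<tau>] by simp
    then show ?thesis
      using True singular_chain_boundary_alt[OF \<tau>]
      by (simp add: chain_eval_coboundary_of chain_eval_coboundary)
  qed (simp add: cochain_coboundary_def)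
qed

lemma singular_coboundaries_lincomb:
  assumes "f \<in> singular_coboundaries p X" "g \<in> singular_coboundaries p X"
  shows "(\<lambda>\<sigma>. a * f \<sigma> + b * g \<sigma>) \<in> singular_coboundaries p X"
proof (cases p)
  case 0
  then show ?thesis
    using assms by (simp add: singular_coboundaries_def)
next
  case (Suc q)
  then obtain f' g' where "singular_cochain q X f'" "f = cochain_coboundary q X f'"
      "singular_cochain q X g'" "g = cochain_coboundary q X g'"
    using assms by (auto simp: singular_coboundaries_def)
  then show ?thesis
    using singular_cochain_lincomb[of q X f' g' a b] cochain_coboundary_lincomb[of q X a f' b g']
    by (auto simp: singular_coboundaries_def Suc
        intro!: image_eqI[where x="\<lambda>\<sigma>. a * f' \<sigma> + b * g' \<sigma>"])
qed

lemma zero_in_singular_coboundaries: "(\<lambda>_. 0) \<in> singular_coboundaries p X"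
  by (cases p) (auto simp: singular_coboundaries_def cochain_coboundary_zero singular_cochain_zero
      intro!: rev_image_eqI[where x="\<lambda>_. 0"])

lemma singular_coboundaries_subset: "singular_coboundaries p X \<subseteq> singular_cocycles p X"
  by (auto simp: singular_coboundaries_def singular_cocycles_def singular_cochain_coboundary
      cochain_coboundary_coboundary cochain_coboundary_zero singular_cochain_zero split: nat.splits)

lemma singular_cocycles_lincomb:
  "f \<in> singular_cocycles p X \<Longrightarrow> g \<in> singular_cocycles p X \<Longrightarrow>
     (\<lambda>\<sigma>. a * f \<sigma> + b * g \<sigma>) \<in> singular_cocycles p X"
  by (auto simp: singular_cocycles_def singular_cochain_lincomb cochain_coboundary_lincomb)

lemma cocycle_group_simps [simp]:
  "carrier (cocycle_group p X) = singular_cocycles p X"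
  "f \<otimes>\<^bsub>cocycle_group p X\<^esub> g = (\<lambda>\<sigma>. f \<sigma> + g \<sigma>)"
  "\<one>\<^bsub>cocycle_group p X\<^esub> = (\<lambda>_. 0)"
  by (simp_all add: cocycle_group_def)

lemma comm_group_cocycle_group:
  "comm_group (cocycle_group p X :: ('a, 'k::comm_ring_1) cochain monoid)"
proof (rule comm_groupI)
  fix f g :: "('a, 'k) cochain"
  assume "f \<in> carrier (cocycle_group p X)" "g \<in> carrier (cocycle_group p X)"
  then show "f \<otimes>\<^bsub>cocycle_group p X\<^esub> g \<in> carrier (cocycle_group p X)"
    using singular_cocycles_lincomb[of f p X g 1 1] by simp
next
  show "\<one>\<^bsub>cocycle_group p X\<^esub> \<in> carrier (cocycle_group p X :: ('a, 'k) cochain monoid)"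
    by (simp add: singular_cocycles_def singular_cochain_zero cochain_coboundary_zero)
next
  fix f :: "('a, 'k) cochain"
  assume "f \<in> carrier (cocycle_group p X)"
  then show "\<exists>g\<in>carrier (cocycle_group p X). g \<otimes>\<^bsub>cocycle_group p X\<^esub> f = \<one>\<^bsub>cocycle_group p X\<^esub>"
    using singular_cocycles_lincomb[of f p X f "-1" 0]
    by (intro bexI[where x="\<lambda>\<sigma>. - f \<sigma>"]) auto
qed (auto simp: add_ac)

lemma normal_singular_coboundaries:
  "singular_coboundaries p X \<lhd> (cocycle_group p X :: ('a, 'k::comm_ring_1) cochain monoid)"
proof -
  interpret comm_group "cocycle_group p X :: ('a, 'k) cochain monoid"
    by (rule comm_group_cocycle_group)
  have "subgroup (singular_coboundaries p X) (cocycle_group p X :: ('a, 'k) cochain monoid)"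
  proof (rule subgroupI)
    fix f :: "('a, 'k) cochain"
    assume f: "f \<in> singular_coboundaries p X"
    then have "f \<in> singular_cocycles p X"
      using singular_coboundaries_subset by blast
    then have "(\<lambda>\<sigma>. - f \<sigma>) \<in> singular_cocycles p X"
      using singular_cocycles_lincomb[of f p X f "-1" 0] by simp
    then have "inv\<^bsub>cocycle_group p X\<^esub> f = (\<lambda>\<sigma>. - f \<sigma>)"
      using \<open>f \<in> singular_cocycles p X\<close> by (intro inv_equality) auto
    then show "inv\<^bsub>cocycle_group p X\<^esub> f \<in> singular_coboundaries p X"
      using singular_coboundaries_lincomb[OF f f, of "-1" 0] by simp
  next
    fix f g :: "('a, 'k) cochain"
    assume "f \<in> singular_coboundaries p X" "g \<in> singular_coboundaries p X"
    then show "f \<otimes>\<^bsub>cocycle_group p X\<^esub> g \<in> singular_coboundaries p X"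
      using singular_coboundaries_lincomb[of f p X g 1 1] by simp
  next
    show "singular_coboundaries p X \<noteq> ({} :: ('a, 'k) cochain set)"
      using zero_in_singular_coboundaries by blast
  qed (use singular_coboundaries_subset in auto)
  then show ?thesis
    by (simp add: normal_iff_subgroup)
qed

lemma carrier_cohomology_group:
  "carrier (cohomology_group p X) = cohomology_class p X ` singular_cocycles p X"
  by (auto simp: cohomology_group_def FactGroup_def RCOSETS_def cohomology_class_def)

lemma cohomology_class_alt:
  "cohomology_class p X f = (\<lambda>b \<sigma>. b \<sigma> + f \<sigma>) ` singular_coboundaries p X"
  by (auto simp: cohomology_class_def r_coset_def)

lemma cohomology_class_eqI:
  fixes f g :: "('a, 'k::comm_ring_1) cochain"
  assumes "(\<lambda>\<sigma>. f \<sigma> - g \<sigma>) \<in> singular_coboundaries p X"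
  shows "cohomology_class p X f = cohomology_class p X g"
proof -
  have *: "cohomology_class p X f \<subseteq> cohomology_class p X g"
    if d: "(\<lambda>\<sigma>. f \<sigma> - g \<sigma>) \<in> singular_coboundaries p X" for f g :: "('a, 'k) cochain"
  proof
    fix h assume "h \<in> cohomology_class p X f"
    then obtain b where b: "b \<in> singular_coboundaries p X" "h = (\<lambda>\<sigma>. b \<sigma> + f \<sigma>)"
      by (auto simp: cohomology_class_alt)
    then show "h \<in> cohomology_class p X g"
      unfolding cohomology_class_alt
      using singular_coboundaries_lincomb[OF b(1) d, of 1 1]
      by (intro image_eqI[where x="\<lambda>\<sigma>. b \<sigma> + (f \<sigma> - g \<sigma>)"]) auto
  qed
  show ?thesis
    using *[OF assms] *[of g f] singular_coboundaries_lincomb[OF assms assms, of "-1" 0] by auto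
qed

lemma mem_cohomology_class: "f \<in> cohomology_class p X f"
  unfolding cohomology_class_alt
  by (rule image_eqI[OF _ zero_in_singular_coboundaries]) simp

lemma one_cohomology_group:
  "\<one>\<^bsub>cohomology_group p X\<^esub> = cohomology_class p X (\<lambda>_. 0)"
  by (simp add: cohomology_group_def FactGroup_def cohomology_class_alt)

lemma shift_in_standard_simplex:
  assumes "x \<in> standard_simplex q"
  shows "(\<lambda>i. if i < p then 0 else x (i - p)) \<in> standard_simplex (p + q)"
proof -
  have "(\<Sum>i\<le>p + q. if i < p then 0 else x (i - p)) = (\<Sum>i\<in>{p..p + q}. x (i - p))"
    by (rule sum.mono_neutral_cong_right) auto
  also have "\<dots> = (\<Sum>i\<le>q. x i)"
    by (rule sum.reindex_bij_witness[where i="\<lambda>i. i + p" and j="\<lambda>i. i - p"]) auto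
  finally show ?thesis
    using assms by (auto simp: standard_simplex_def)
qed

lemma singular_simplex_front_face:
  assumes "singular_simplex (p + q) X \<sigma>"
  shows "singular_simplex p X (front_face p \<sigma>)"
  using assms continuous_map_from_subtopology_mono[OF _ standard_simplex_mono[of p "p + q"]]
  by (auto simp: singular_simplex_def front_face_def)

lemma singular_simplex_back_face:
  assumes "singular_simplex (p + q) X \<sigma>"
  shows "singular_simplex q X (back_face p q \<sigma>)"
proof -
  let ?P = "powertop_real UNIV"
  have c: "continuous_map (subtopology ?P (standard_simplex q)) euclideanreal
          (\<lambda>x. if i < p then 0 else x (i - p))" for i
    by (cases "i < p") (auto intro: continuous_map_from_subtopology continuous_map_product_projection)
  have "continuous_map (subtopology ?P (standard_simplex q))
          (subtopology ?P (standard_simplex (p + q))) (\<lambda>x i. if i < p then 0 else x (i - p))"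
    using c shift_in_standard_simplex[of _ q p]
    by (auto simp: continuous_map_in_subtopology continuous_map_componentwise)
  then show ?thesis
    using assms continuous_map_compose
    by (fastforce simp: singular_simplex_def back_face_def o_def)
qed

lemma front_face_singular_face_le:
  assumes "k \<le> Suc p"
  shows "front_face p (singular_face (Suc (p + q)) k \<sigma>) =
           singular_face (Suc p) k (front_face (Suc p) \<sigma>)"
proof
  fix x
  show "front_face p (singular_face (Suc (p + q)) k \<sigma>) x =
          singular_face (Suc p) k (front_face (Suc p) \<sigma>) x"
    using assms standard_simplex_mono[of p "p + q"]
      simplical_face_in_standard_simplex[of "Suc p" k x]
    by (auto simp: front_face_def singular_face_def restrict_def)
qed

lemma front_face_singular_face_gt:
  assumes "p < k"
  shows "front_face p (singular_face (Suc (p + q)) k \<sigma>) = front_face p \<sigma>"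
proof
  fix x :: "nat \<Rightarrow> real"
  have "simplical_face k x = x" if "x \<in> standard_simplex p"
    using that assms by (auto simp: simplical_face_def standard_simplex_def fun_eq_iff)
  then show "front_face p (singular_face (Suc (p + q)) k \<sigma>) x = front_face p \<sigma> x"
    using standard_simplex_mono[of p "p + q"]
    by (auto simp: front_face_def singular_face_def restrict_def)
qed

lemma back_face_singular_face_le:
  assumes "k \<le> p"
  shows "back_face p q (singular_face (Suc (p + q)) k \<sigma>) = back_face (Suc p) q \<sigma>"
proof
  fix x :: "nat \<Rightarrow> real"
  have "simplical_face k (\<lambda>i. if i < p then 0 else x (i - p)) =
          (\<lambda>i. if i < Suc p then 0 else x (i - Suc p))"
    using assms by (auto simp: simplical_face_def fun_eq_iff less_Suc_eq)
  then show "back_face p q (singular_face (Suc (p + q)) k \<sigma>) x = back_face (Suc p) q \<sigma> x"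
    using shift_in_standard_simplex[of x q p]
    by (auto simp: back_face_def singular_face_def restrict_def)
qed

lemma back_face_singular_face_ge:
  assumes "p \<le> k" "k \<le> Suc (p + q)"
  shows "back_face p q (singular_face (Suc (p + q)) k \<sigma>) =
           singular_face (Suc q) (k - p) (back_face p (Suc q) \<sigma>)"
proof
  fix x :: "nat \<Rightarrow> real"
  have "simplical_face k (\<lambda>i. if i < p then 0 else x (i - p)) =
          (\<lambda>i. if i < p then 0 else simplical_face (k - p) x (i - p))"
    using assms by (auto simp: simplical_face_def fun_eq_iff)
  then show "back_face p q (singular_face (Suc (p + q)) k \<sigma>) x =
               singular_face (Suc q) (k - p) (back_face p (Suc q) \<sigma>) x"
    using shift_in_standard_simplex[of x q p] assms
      simplical_face_in_standard_simplex[of "Suc q" "k - p" x]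
    by (auto simp: back_face_def singular_face_def restrict_def)
qed

lemma cochain_coboundary_cup:
  "cochain_coboundary (p + q) X (cochain_cup p q X f g) =
     (\<lambda>\<tau>. cochain_cup (Suc p) q X (cochain_coboundary p X f) g \<tau> +
        (-1) ^ p * cochain_cup p (Suc q) X f (cochain_coboundary q X g) \<tau>)"
proof
  fix \<tau> :: "(nat \<Rightarrow> real) \<Rightarrow> 'a"
  show "cochain_coboundary (p + q) X (cochain_cup p q X f g) \<tau> =
     cochain_cup (Suc p) q X (cochain_coboundary p X f) g \<tau> +
        (-1) ^ p * cochain_cup p (Suc q) X f (cochain_coboundary q X g) \<tau>"
  proof (cases "singular_simplex (Suc (p + q)) X \<tau>")
    case True
    define T where "T k = (-1) ^ k * (f (front_face p (singular_face (Suc (p + q)) k \<tau>))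
      * g (back_face p q (singular_face (Suc (p + q)) k \<tau>)))" for k
    define U where "U = f (front_face p \<tau>) * g (back_face (Suc p) q \<tau>)"
    have front: "singular_simplex (Suc p) X (front_face (Suc p) \<tau>)"
      using singular_simplex_front_face[of "Suc p" q X \<tau>] True by simp
    have back': "singular_simplex (Suc q) X (back_face p (Suc q) \<tau>)"
      using singular_simplex_back_face[of p "Suc q" X \<tau>] True by simp
    have "cochain_coboundary (p + q) X (cochain_cup p q X f g) \<tau> = (\<Sum>k\<le>Suc (p + q). T k)"
      unfolding cochain_coboundary_def T_def
      using True singular_simplex_singular_face[OF True]
      by (auto simp: cochain_cup_def simp del: sum.atMost_Suc intro!: sum.cong)
    also have "{..Suc (p + q)} = {..p} \<union> {Suc p..Suc (p + q)}"
      by auto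
    also have "(\<Sum>k\<in>{..p} \<union> {Suc p..Suc (p + q)}. T k) =
        (\<Sum>k\<le>p. T k) + (\<Sum>k\<in>{Suc p..Suc (p + q)}. T k)"
      by (rule sum.union_disjoint) auto
    finally have lhs: "cochain_coboundary (p + q) X (cochain_cup p q X f g) \<tau> =
        (\<Sum>k\<le>p. T k) + (\<Sum>k\<in>{Suc p..Suc (p + q)}. T k)" .
    have "cochain_cup (Suc p) q X (cochain_coboundary p X f) g \<tau> =
        (\<Sum>k\<le>Suc p. (-1) ^ k * f (singular_face (Suc p) k (front_face (Suc p) \<tau>)))
          * g (back_face (Suc p) q \<tau>)"
      using True front by (simp add: cochain_cup_def cochain_coboundary_def)
    also have "\<dots> = (\<Sum>k\<le>p. T k) +
        (-1) ^ Suc p * f (singular_face (Suc p) (Suc p) (front_face (Suc p) \<tau>))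
          * g (back_face (Suc p) q \<tau>)"
      by (simp add: T_def sum_distrib_right ring_distribs mult.assoc
          front_face_singular_face_le back_face_singular_face_le cong: sum.cong_simp)
    also have "singular_face (Suc p) (Suc p) (front_face (Suc p) \<tau>) = front_face p \<tau>"
      using front_face_singular_face_le[of "Suc p" p q \<tau>]
        front_face_singular_face_gt[of p "Suc p" q \<tau>] by simp
    finally have rhs1: "cochain_cup (Suc p) q X (cochain_coboundary p X f) g \<tau> =
        (\<Sum>k\<le>p. T k) - (-1) ^ p * U"
      by (simp add: U_def mult.assoc)
    have "(-1) ^ p * cochain_cup p (Suc q) X f (cochain_coboundary q X g) \<tau> =
        (\<Sum>k\<le>Suc q. (-1) ^ (p + k) * (f (front_face p \<tau>)
          * g (singular_face (Suc q) k (back_face p (Suc q) \<tau>))))"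
      using True back'
      by (simp add: cochain_cup_def cochain_coboundary_def sum_distrib_left power_add mult_ac
          del: sum.atMost_Suc)
    also have "\<dots> = (-1) ^ p * (f (front_face p \<tau>)
          * g (singular_face (Suc q) 0 (back_face p (Suc q) \<tau>))) +
        (\<Sum>k\<le>q. (-1) ^ (p + Suc k) * (f (front_face p \<tau>)
          * g (singular_face (Suc q) (Suc k) (back_face p (Suc q) \<tau>))))"
      by (subst sum.atMost_Suc_shift) simp
    also have "singular_face (Suc q) 0 (back_face p (Suc q) \<tau>) = back_face (Suc p) q \<tau>"
      using back_face_singular_face_le[of p p q \<tau>] back_face_singular_face_ge[of p p q \<tau>]
      by simp
    also have "(\<Sum>k\<le>q. (-1) ^ (p + Suc k) * (f (front_face p \<tau>)
          * g (singular_face (Suc q) (Suc k) (back_face p (Suc q) \<tau>)))) =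
        (\<Sum>k\<in>{Suc p..Suc (p + q)}. T k)"
    proof (rule sum.reindex_bij_witness[where i="\<lambda>k. k - Suc p" and j="\<lambda>k. k + Suc p"])
      fix k assume k: "k \<in> {..q}"
      then show "T (k + Suc p) = (-1) ^ (p + Suc k) * (f (front_face p \<tau>)
          * g (singular_face (Suc q) (Suc k) (back_face p (Suc q) \<tau>)))"
        using front_face_singular_face_gt[of p "k + Suc p" q \<tau>]
          back_face_singular_face_ge[of p "k + Suc p" q \<tau>]
        by (simp add: T_def add_ac Suc_diff_le)
    qed auto
    finally have rhs2: "(-1) ^ p * cochain_cup p (Suc q) X f (cochain_coboundary q X g) \<tau> =
        (-1) ^ p * U + (\<Sum>k\<in>{Suc p..Suc (p + q)}. T k)"
      by (simp add: U_def)
    show ?thesis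
      using lhs rhs1 rhs2 by simp
  qed (simp add: cochain_coboundary_def cochain_cup_def)
qed

lemma cochain_cup_zero [simp]:
  "cochain_cup p q X (\<lambda>_. 0) g = (\<lambda>_. 0)" "cochain_cup p q X f (\<lambda>_. 0) = (\<lambda>_. 0)"
  by (auto simp: cochain_cup_def)

lemma cochain_cup_cocycle:
  "f \<in> singular_cocycles p X \<Longrightarrow> g \<in> singular_cocycles q X \<Longrightarrow>
     cochain_cup p q X f g \<in> singular_cocycles (p + q) X"
  by (simp add: singular_cocycles_def singular_cochain_cup cochain_coboundary_cup)

lemma cochain_cup_coboundary_left:
  assumes "b \<in> singular_coboundaries p X" "g \<in> singular_cocycles q X"
  shows "cochain_cup p q X b g \<in> singular_coboundaries (p + q) X"
proof (cases p)
  case 0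
  then show ?thesis
    using assms zero_in_singular_coboundaries[of q X]
    by (simp add: singular_coboundaries_def[of 0])
next
  case (Suc p')
  then obtain c where "b = cochain_coboundary p' X c"
    using assms by (auto simp: singular_coboundaries_def)
  then have "cochain_cup p q X b g = cochain_coboundary (p' + q) X (cochain_cup p' q X c g)"
    using assms(2) Suc by (simp add: cochain_coboundary_cup singular_cocycles_def)
  then show ?thesis
    using Suc by (simp add: singular_coboundaries_def singular_cochain_cup)
qed

lemma cochain_cup_coboundary_right:
  assumes "f \<in> singular_cocycles p X" "b \<in> singular_coboundaries q X"
  shows "cochain_cup p q X f b \<in> singular_coboundaries (p + q) X"
proof (cases q)
  case 0
  then show ?thesis
    using assms zero_in_singular_coboundaries[of p X]
    by (simp add: singular_coboundaries_def[of 0])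
next
  case (Suc q')
  then obtain c where "b = cochain_coboundary q' X c"
    using assms by (auto simp: singular_coboundaries_def)
  then have eq: "cochain_coboundary (p + q') X (cochain_cup p q' X f c) =
      (\<lambda>\<tau>. (-1) ^ p * cochain_cup p q X f b \<tau>)"
    using assms(1) Suc by (simp add: cochain_coboundary_cup singular_cocycles_def)
  have *: "(\<lambda>\<tau>. (-1) ^ p * cochain_cup p q X f b \<tau>) \<in> singular_coboundaries (p + q) X"
    using Suc singular_cochain_cup[of p q' X f c] eq
    by (auto simp: singular_coboundaries_def intro!: rev_image_eqI)
  show ?thesis
    using singular_coboundaries_lincomb[OF * *, of "(-1) ^ p" 0]
    by (simp flip: mult.assoc power_add)
qed

lemma cup_cohomology_class:
  assumes f: "f \<in> singular_cocycles p X" and g: "g \<in> singular_cocycles q X"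
  shows "cup p q X (cohomology_class p X f) (cohomology_class q X g) =
           cohomology_class (p + q) X (cochain_cup p q X f g)"
proof -
  have "cohomology_class (p + q) X (cochain_cup p q X f' g') =
        cohomology_class (p + q) X (cochain_cup p q X f g)"
    if "f' \<in> cohomology_class p X f" "g' \<in> cohomology_class q X g" for f' g'
  proof (rule cohomology_class_eqI)
    obtain b c where b: "b \<in> singular_coboundaries p X" "f' = (\<lambda>\<sigma>. b \<sigma> + f \<sigma>)"
      and c: "c \<in> singular_coboundaries q X" "g' = (\<lambda>\<sigma>. c \<sigma> + g \<sigma>)"
      using \<open>f' \<in> cohomology_class p X f\<close> \<open>g' \<in> cohomology_class q X g\<close>
      unfolding cohomology_class_alt by (auto simp del: cocycle_group_simps)
    have g': "g' \<in> singular_cocycles q X"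
      using singular_cocycles_lincomb[of c q X g 1 1] c g singular_coboundaries_subset by auto
    have "(\<lambda>\<sigma>. cochain_cup p q X f' g' \<sigma> - cochain_cup p q X f g \<sigma>) =
        (\<lambda>\<sigma>. 1 * cochain_cup p q X b g' \<sigma> + 1 * cochain_cup p q X f c \<sigma>)"
      by (auto simp: b c cochain_cup_def algebra_simps)
    then show "(\<lambda>\<sigma>. cochain_cup p q X f' g' \<sigma> - cochain_cup p q X f g \<sigma>)
        \<in> singular_coboundaries (p + q) X"
      using singular_coboundaries_lincomb[OF cochain_cup_coboundary_left[OF b(1) g']
          cochain_cup_coboundary_right[OF f c(1)]] by metis
  qed
  then have "cup p q X (cohomology_class p X f) (cohomology_class q X g) =
      (\<Union>f'\<in>cohomology_class p X f. \<Union>g'\<in>cohomology_class q X g.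
         cohomology_class (p + q) X (cochain_cup p q X f g))"
    by (simp add: cup_def)
  then show ?thesis
    using mem_cohomology_class[of f p X] mem_cohomology_class[of g q X] by blast
qed

lemma cohomology_unit_cocycle:
  "(\<lambda>\<sigma>. if singular_simplex 0 X \<sigma> then 1 else 0) \<in> singular_cocycles 0 X"
  by (auto simp: singular_cocycles_def singular_cochain_def cochain_coboundary_def fun_eq_iff
      dest: singular_simplex_singular_face[where p="Suc 0" and k=0]
        singular_simplex_singular_face[where p="Suc 0" and k="Suc 0"])

lemma cup_cohomology_unit:
  assumes g: "g \<in> singular_cocycles q X"
  shows "cup 0 q X (cohomology_unit X) (cohomology_class q X g) = cohomology_class q X g"
proof -
  let ?u = "\<lambda>\<sigma>. if singular_simplex 0 X \<sigma> then 1 else 0"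
  have "cochain_cup 0 q X ?u g \<sigma> = g \<sigma>" for \<sigma>
  proof (cases "singular_simplex q X \<sigma>")
    case True
    then have "back_face 0 q \<sigma> = \<sigma>"
      by (auto simp: back_face_def singular_simplex_def extensional_restrict)
    then show ?thesis
      using True singular_simplex_front_face[of 0 q X \<sigma>] by (simp add: cochain_cup_def)
  next
    case False
    then show ?thesis
      using g by (simp add: cochain_cup_def singular_cocycles_def singular_cochain_def)
  qed
  then have "cochain_cup 0 q X ?u g = g"
    by blast
  then show ?thesis
    using cup_cohomology_class[OF cohomology_unit_cocycle[of X] g]
    by (simp add: cohomology_unit_def)
qed

section \<open>Simplicial cell complexes\<close>

definition open_simplex :: "nat \<Rightarrow> (nat \<Rightarrow> real) set" where
  "open_simplex p = {x \<in> standard_simplex p. \<forall>i\<le>p. 0 < x i}"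

text \<open>
  The affine map on \<open>standard_simplex p\<close> sending the \<open>i\<close>-th vertex to the \<open>\<pi> i\<close>-th vertex. If
  \<open>\<pi>\<close> maps \<open>{..p}\<close> bijectively onto \<open>V\<close>, it is a simplicial isomorphism onto the face of a
  larger standard simplex with vertex set \<open>V\<close>.
\<close>

definition vertex_map :: "nat \<Rightarrow> (nat \<Rightarrow> nat) \<Rightarrow> (nat \<Rightarrow> real) \<Rightarrow> nat \<Rightarrow> real" where
  "vertex_map p \<pi> x = (\<lambda>j. \<Sum>i | i \<le> p \<and> \<pi> i = j. x i)"

text \<open>
  \<open>K\<close> is an index set for the simplices of the complex; \<open>sdim c\<close> is the dimension and \<open>\<phi> c\<close>
  the characteristic map of the simplex \<open>c\<close>. Closure-finiteness of the CW structure is part of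
  the axiom \<open>faces\<close>, since a simplex has finitely many faces.
\<close>

locale simplicial_cell_complex =
  fixes Y :: "'b topology"
    and K :: "'c set"
    and sdim :: "'c \<Rightarrow> nat"
    and \<phi> :: "'c \<Rightarrow> (nat \<Rightarrow> real) \<Rightarrow> 'b"
  assumes Hausdorff: "Hausdorff_space Y"
    and continuous: "\<And>c. c \<in> K \<Longrightarrow>
          continuous_map (subtopology (powertop_real UNIV) (standard_simplex (sdim c))) Y (\<phi> c)"
    and injective: "\<And>c. c \<in> K \<Longrightarrow> inj_on (\<phi> c) (standard_simplex (sdim c))"
    and open_cells_disjoint: "disjoint_family_on (\<lambda>c. \<phi> c ` open_simplex (sdim c)) K"
    and open_cells_cover: "(\<Union>c\<in>K. \<phi> c ` open_simplex (sdim c)) = topspace Y"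
    and faces: "\<And>c V. \<lbrakk>c \<in> K; V \<subseteq> {..sdim c}; V \<noteq> {}\<rbrakk> \<Longrightarrow>
          \<exists>c'\<in>K. \<exists>\<pi>. bij_betw \<pi> {..sdim c'} V \<and>
            (\<forall>x\<in>standard_simplex (sdim c'). \<phi> c (vertex_map (sdim c') \<pi> x) = \<phi> c' x)"
    and weak_topology: "\<And>A. \<lbrakk>A \<subseteq> topspace Y;
          \<And>c. c \<in> K \<Longrightarrow> closedin Y (A \<inter> \<phi> c ` standard_simplex (sdim c))\<rbrakk> \<Longrightarrow> closedin Y A"

section \<open>Tensor rank and the determinant tensor\<close>

text \<open>
  Over the field \<open>'k\<close>, the standard \<open>m\<close>-dimensional space consists of the functions
  \<open>nat \<Rightarrow> 'k\<close> vanishing at all arguments \<open>\<ge> m\<close>. A tensor in its \<open>n\<close>-th tensor power is given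
  by its coordinates with respect to the basis of the tensors
  \<open>e\<^bsub>\<iota> 0\<^esub> \<otimes> \<dots> \<otimes> e\<^bsub>\<iota> (n - 1)\<^esub>\<close>, with \<open>\<iota>\<close> ranging over \<open>multi_indices m n\<close>; coordinates
  and factors are numbered from \<open>0\<close>. For \<open>n \<ge> 1\<close> the set of admissible \<open>r\<close> in the definition
  of \<open>tensor_rank\<close> is nonempty (lemma \<open>tensor_rank_attained\<close>).
\<close>

definition coordinate_space :: "nat \<Rightarrow> (nat \<Rightarrow> 'k::field) set" where
  "coordinate_space m = {v. \<forall>i\<ge>m. v i = 0}"

definition multi_indices :: "nat \<Rightarrow> nat \<Rightarrow> (nat \<Rightarrow> nat) set" where
  "multi_indices m n = ({..<n} \<rightarrow>\<^sub>E {..<m})"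

definition tensor_power :: "nat \<Rightarrow> nat \<Rightarrow> ((nat \<Rightarrow> nat) \<Rightarrow> 'k::field) set" where
  "tensor_power m n = {T. \<forall>\<iota>. \<iota> \<notin> multi_indices m n \<longrightarrow> T \<iota> = 0}"

definition pure_tensor :: "nat \<Rightarrow> nat \<Rightarrow> (nat \<Rightarrow> nat \<Rightarrow> 'k::field) \<Rightarrow> (nat \<Rightarrow> nat) \<Rightarrow> 'k" where
  "pure_tensor m n v = (\<lambda>\<iota>. if \<iota> \<in> multi_indices m n then \<Prod>j<n. v j (\<iota> j) else 0)"

definition tensor_rank :: "nat \<Rightarrow> nat \<Rightarrow> ((nat \<Rightarrow> nat) \<Rightarrow> 'k::field) \<Rightarrow> nat" where
  "tensor_rank m n T = (LEAST r. \<exists>v. (\<forall>i<r. \<forall>j<n. v i j \<in> coordinate_space m) \<and>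
     T = (\<lambda>\<iota>. \<Sum>i<r. pure_tensor m n (v i) \<iota>))"

definition unit_vector :: "nat \<Rightarrow> nat \<Rightarrow> 'k::field" where
  "unit_vector k = (\<lambda>i. if i = k then 1 else 0)"

definition det_tensor :: "nat \<Rightarrow> (nat \<Rightarrow> nat) \<Rightarrow> 'k::field" where
  "det_tensor n = (\<lambda>\<iota>. \<Sum>\<pi> | \<pi> permutes {..<n}.
     of_int (sign \<pi>) * pure_tensor n n (\<lambda>j. unit_vector (\<pi> j)) \<iota>)"

lemma det_tensor_in_tensor_power: "det_tensor n \<in> tensor_power n n"
  by (simp add: tensor_power_def det_tensor_def pure_tensor_def)

lemma tensor_rank_attained:
  fixes T :: "(nat \<Rightarrow> nat) \<Rightarrow> 'k::field"
  assumes T: "T \<in> tensor_power m n" and n: "n \<ge> 1"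
  shows "\<exists>v. (\<forall>i<tensor_rank m n T. \<forall>j<n. v i j \<in> coordinate_space m) \<and>
     T = (\<lambda>\<iota>. \<Sum>i<tensor_rank m n T. pure_tensor m n (v i) \<iota>)"
proof -
  let ?M = "multi_indices m n"
  define w :: "(nat \<Rightarrow> nat) \<Rightarrow> nat \<Rightarrow> nat \<Rightarrow> 'k" where
    "w \<kappa> j = (\<lambda>i. (if j = 0 then T \<kappa> else 1) * unit_vector (\<kappa> j) i)" for \<kappa> j
  have fin: "finite ?M"
    by (simp add: multi_indices_def finite_PiE)
  then obtain h where h: "bij_betw h {..<card ?M} ?M"
    using ex_bij_betw_nat_finite[OF fin] by (auto simp: atLeast0LessThan)
  have pure: "pure_tensor m n (w \<kappa>) \<iota> = (if \<kappa> = \<iota> then T \<iota> else 0)"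
    if \<kappa>: "\<kappa> \<in> ?M" and \<iota>: "\<iota> \<in> ?M" for \<kappa> \<iota>
  proof (cases "\<kappa> = \<iota>")
    case True
    have "(\<Prod>j<n. w \<kappa> j (\<iota> j)) = (\<Prod>j<n. if j = 0 then T \<iota> else 1)"
      by (simp add: True w_def unit_vector_def cong: if_cong)
    also have "\<dots> = T \<iota>"
      using n by simp
    finally show ?thesis
      using True \<iota> by (simp add: pure_tensor_def)
  next
    case False
    then obtain j where "j < n" "\<kappa> j \<noteq> \<iota> j"
      using \<kappa> \<iota> PiE_ext[of \<kappa> "{..<n}" "\<lambda>_. {..<m}" \<iota>]
      by (auto simp: multi_indices_def)
    then have "(\<Prod>j<n. w \<kappa> j (\<iota> j)) = 0"
      by (intro prod_zero) (auto simp: w_def unit_vector_def intro!: bexI[of _ j])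
    then show ?thesis
      using False by (simp add: pure_tensor_def)
  qed
  have "(\<Sum>i<card ?M. pure_tensor m n (w (h i)) \<iota>) = T \<iota>" for \<iota>
  proof (cases "\<iota> \<in> ?M")
    case True
    have "(\<Sum>i<card ?M. pure_tensor m n (w (h i)) \<iota>) = (\<Sum>\<kappa>\<in>?M. pure_tensor m n (w \<kappa>) \<iota>)"
      by (rule sum.reindex_bij_betw[OF h])
    then show ?thesis
      using True fin by (simp add: pure)
  next
    case False
    then show ?thesis
      using T by (simp add: pure_tensor_def tensor_power_def)
  qed
  moreover have "w (h i) j \<in> coordinate_space m" if "i < card ?M" "j < n" for i j
  proof -
    have "h i \<in> ?M"
      using bij_betwE[OF h] that by blast
    then have "h i j < m"
      using that PiE_mem[of "h i" "{..<n}" "\<lambda>_. {..<m}" j] by (simp add: multi_indices_def)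
    then show ?thesis
      by (simp add: w_def coordinate_space_def unit_vector_def)
  qed
  ultimately have "\<exists>v. (\<forall>i<card ?M. \<forall>j<n. v i j \<in> coordinate_space m) \<and>
     T = (\<lambda>\<iota>. \<Sum>i<card ?M. pure_tensor m n (v i) \<iota>)"
    by (intro exI[of _ "\<lambda>i. w (h i)"]) auto
  then show ?thesis
    unfolding tensor_rank_def
    by (rule LeastI[where P="\<lambda>r. \<exists>v. (\<forall>i<r. \<forall>j<n. v i j \<in> coordinate_space m) \<and>
     T = (\<lambda>\<iota>. \<Sum>i<r. pure_tensor m n (v i) \<iota>)"])
qed

end

theory Submission
  imports Defs "HOL-Library.Product_Lexorder"
begin

text \<open>
  First bound. A singular cocycle that is no coboundary is nonzero on some integral cycle, and every
  singular cycle of \<open>Y\<close> is homologous to a cycle \<open>s\<close> of simplices of the complex, with vertices ordered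
  by a global order on points. Evaluating the products of representatives \<open>f\<^bsub>\<iota> 0\<^esub> \<smile> \<dots> \<smile> f\<^bsub>\<iota> (n - 1)\<^esub>\<close> on
  \<open>s\<close> gives a tensor in \<open>\<iota>\<close> which is a sum of one pure tensor for each simplex of \<open>s\<close>. As \<open>d\<close> is odd,
  \<open>f \<smile> f\<close> is a coboundary for every \<open>d\<close>-cocycle \<open>f\<close>, so this tensor is alternating, hence a nonzero
  multiple of \<open>det_tensor n\<close>.

  Second bound. A pure tensor \<open>v\<^sub>0 \<otimes> \<dots> \<otimes> v\<^bsub>n-1\<^esub>\<close> induces the linear map
  \<open>\<Otimes>\<^sub>k \<Lambda>\<^sup>k V \<rightarrow> \<Otimes>\<^sub>k \<Lambda>\<^bsup>k+1\<^esup> V\<close>, \<open>0 \<le> k < n\<close>, given by \<open>v\<^sub>k \<and> _\<close> in the factor \<open>k\<close>. Its rank is at most the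
  product of the \<open>(n - 1) choose k\<close>, while \<open>det_tensor n\<close> induces an isomorphism between spaces of
  dimension the product of the \<open>n choose k\<close>; the quotient is \<open>n ^ n / n!\<close>. The isomorphism is a
  composition of the operators \<open>\<Lambda>\<^sup>k \<otimes> \<Lambda>\<^bsup>k+1\<^esup> \<rightarrow> \<Lambda>\<^bsup>k+1\<^esup> \<otimes> \<Lambda>\<^sup>k\<close> moving one vector, each of which is
  the raising operator of an \<open>sl\<^sub>2\<close>-action from weight \<open>-1\<close> to weight \<open>1\<close>.
\<close>

section \<open>Alternating functions and the determinant tensor\<close>

text \<open>On one simplex a cup product takes the value of a product over consecutive
  \<open>d\<close>-faces, which is why a simplex contributes a single pure tensor. Cochains
  anticommute only up to coboundaries, so antisymmetry appears only after evaluation on a cycle. The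
  chain groups are integral while the classes are real, so integral cycles must be shown to detect
  real classes. Front and back faces depend on the order of the vertices, and the bijections in the
  axiom \<open>faces\<close> need not be monotone; a global order turns every face of a simplex into
  a simplex of the complex on the nose. In the second bound, with \<open>m = n - 1\<close>, the last
  row hands one vector to row \<open>m - 1\<close>, then one to row \<open>m - 2\<close>, down to
  row \<open>0\<close>. At each move the donor holds exactly one vector more than the recipient. The
  row degrees change from \<open>0, 1, ..., m\<close> to \<open>1, ..., m, 0\<close>. The constant
  is the product of the ratios
  \<open>(n choose k) / ((n - 1) choose k) = n / (n - k)\<close>.\<close>

lemma det_tensor_permutes:
  assumes "\<pi> permutes {..<n}" "\<And>j. j < n \<Longrightarrow> \<iota> j = \<pi> j" "\<iota> \<in> multi_indices n n"
  shows "det_tensor n \<iota> = (of_int (sign \<pi>) :: 'k::field)"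
proof -
  have *: "(\<Prod>j<n. unit_vector (\<sigma> j) (\<iota> j)) = (if \<sigma> = \<pi> then 1 else 0 :: 'k)"
    if "\<sigma> permutes {..<n}" for \<sigma>
  proof (cases "\<sigma> = \<pi>")
    case False
    then obtain j where "\<sigma> j \<noteq> \<pi> j"
      by auto
    moreover from this have "j < n"
      using permutes_not_in[OF that, of j] permutes_not_in[OF assms(1), of j] by (cases "j < n") auto
    ultimately show ?thesis
      using False assms(2) by (auto simp: unit_vector_def intro!: prod_zero bexI[of _ j])
  qed (simp add: unit_vector_def assms(2))
  have "det_tensor n \<iota> = (\<Sum>\<sigma> | \<sigma> permutes {..<n}. if \<sigma> = \<pi> then of_int (sign \<pi>) else 0 :: 'k)"
    unfolding det_tensor_def using assms(3) by (intro sum.cong) (auto simp: pure_tensor_def *)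
  then show ?thesis
    using assms(1) by (simp add: finite_permutations)
qed

lemma det_tensor_not_inj_on:
  assumes "\<not> inj_on \<iota> {..<n}"
  shows "det_tensor n \<iota> = (0 :: 'k::field)"
proof -
  have "pure_tensor n n (\<lambda>j. unit_vector (\<sigma> j)) \<iota> = (0 :: 'k)" if "\<sigma> permutes {..<n}" for \<sigma>
  proof -
    have "\<exists>j<n. \<iota> j \<noteq> \<sigma> j"
      using that assms by (metis inj_on_cong lessThan_iff permutes_inj_on)
    then show ?thesis
      by (auto simp: pure_tensor_def unit_vector_def intro!: prod_zero)
  qed
  then show ?thesis
    by (simp add: det_tensor_def)
qed

text \<open>The conjugation \<open>(a, b + 1) = (b, b + 1) (a, b) (b, b + 1)\<close> turns a
  transposition into three sign changes, the middle one by induction on \<open>b\<close>.\<close>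

lemma alternating_transpose:
  fixes T :: "(nat \<Rightarrow> nat) \<Rightarrow> 'k::ab_group_add"
  assumes swap: "\<And>\<iota> j. \<lbrakk>Suc j < n; \<And>i. i < n \<Longrightarrow> \<iota> i < m\<rbrakk> \<Longrightarrow> T (\<iota> \<circ> Transposition.transpose j (Suc j)) =
      - T \<iota>"
    and "a < b" "b < n" "\<And>i. i < n \<Longrightarrow> \<iota> i < m"
  shows "T (\<iota> \<circ> Transposition.transpose a b) = - T \<iota>"
  using assms(2-)
proof (induction b arbitrary: \<iota>)
  case (Suc b)
  show ?case
  proof (cases "a = b")
    case True
    then show ?thesis
      using swap Suc.prems by blast
  next
    case False
    let ?t = "Transposition.transpose b (Suc b)"
    have t: "?t i < n" if "i < n" for i
      using that Suc.prems by (auto simp: Transposition.transpose_def)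
    have s: "Transposition.transpose a b i < n" if "i < n" for i
      using that Suc.prems by (auto simp: Transposition.transpose_def)
    have eq: "\<iota> \<circ> Transposition.transpose a (Suc b) = \<iota> \<circ> ?t \<circ> Transposition.transpose a b \<circ> ?t"
      using False Suc.prems by (auto simp: fun_eq_iff Transposition.transpose_def)
    have "T (\<iota> \<circ> ?t \<circ> Transposition.transpose a b \<circ> ?t) = - T (\<iota> \<circ> ?t \<circ> Transposition.transpose a b)"
      using Suc.prems s t by (intro swap) auto
    also have "T (\<iota> \<circ> ?t \<circ> Transposition.transpose a b) = - T (\<iota> \<circ> ?t)"
      using Suc.prems False t by (intro Suc.IH) auto
    also have "T (\<iota> \<circ> ?t) = - T \<iota>"
      using Suc.prems by (intro swap) auto
    finally show ?thesis
      by (simp add: eq)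
  qed
qed simp

text \<open>A tuple with a repeated entry is fixed by a transposition, so \<open>T\<close> equals
  its own negative there. An injective tuple is a permutation, and induction over transpositions
  gives its sign times \<open>T id\<close>.\<close>

lemma alternating_eq_det_tensor:
  fixes T :: "(nat \<Rightarrow> nat) \<Rightarrow> real"
  assumes swap: "\<And>\<iota> j. \<lbrakk>Suc j < n; \<And>i. i < n \<Longrightarrow> \<iota> i < n\<rbrakk> \<Longrightarrow> T (\<iota> \<circ> Transposition.transpose j (Suc j)) =
      - T \<iota>"
    and cong: "\<And>\<iota> \<kappa>. (\<And>j. j < n \<Longrightarrow> \<iota> j = \<kappa> j) \<Longrightarrow> T \<iota> = T \<kappa>"
    and \<iota>: "\<iota> \<in> multi_indices n n"
  shows "T \<iota> = T id * det_tensor n \<iota>"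
proof -
  have tr: "T (\<kappa> \<circ> Transposition.transpose a b) = - T \<kappa>"
    if "a < b" "b < n" "\<And>i. i < n \<Longrightarrow> \<kappa> i < n" for \<kappa> a b
    by (rule alternating_transpose[where n = n and m = n]) (use swap that in blast)+
  show ?thesis
  proof (cases "inj_on \<iota> {..<n}")
    case False
    then obtain a b where ab: "a < b" "b < n" "\<iota> a = \<iota> b"
      by (metis inj_onI lessThan_iff linorder_neqE_nat)
    then have "\<iota> \<circ> Transposition.transpose a b = \<iota>"
      by (auto simp: fun_eq_iff Transposition.transpose_def)
    then have "T \<iota> = - T \<iota>"
      using tr[OF ab(1,2), of \<iota>] \<iota> by (fastforce simp: multi_indices_def)
    then show ?thesis
      using False by (simp add: det_tensor_not_inj_on)
  next
    case True
    \<comment> \<open>Members of \<open>multi_indices\<close> are \<open>undefined\<close> from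
      \<open>n\<close> on, whereas a permutation must be the identity there; \<open>cong\<close>
      bridges the difference.\<close>
    define \<pi> where "\<pi> = (\<lambda>j. if j < n then \<iota> j else j)"
    have "inj_on \<pi> {..<n}" "\<pi> ` {..<n} \<subseteq> {..<n}"
      using True \<iota> by (auto simp: \<pi>_def multi_indices_def inj_on_def)
    then have "bij_betw \<pi> {..<n} {..<n}"
      by (simp add: bij_betw_def endo_inj_surj)
    then have \<pi>: "\<pi> permutes {..<n}"
      by (rule bij_imp_permutes) (simp add: \<pi>_def)
    have "T \<pi> = of_int (sign \<pi>) * T id"
      using finite_lessThan \<pi>
    proof (induction rule: permutes_rev_induct)
      case (swap a b p)
      have p: "p i < n" if "i < n" for i
        using permutes_in_image[OF swap(4)] that by auto
      have "T (p \<circ> Transposition.transpose a b) = (if a = b then 1 else -1) * T p"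
      proof (cases a b rule: linorder_cases)
        case less
        then show ?thesis
          using tr[OF _ _ p] swap by auto
      next
        case greater
        then show ?thesis
          using tr[OF _ _ p, of b a] swap by (auto simp: transpose_commute)
      qed simp
      moreover have "permutation p"
        by (rule permutes_imp_permutation[OF finite_lessThan swap.hyps(4)])
      then have "sign (p \<circ> Transposition.transpose a b) = sign p * (if a = b then 1 else -1)"
        by (simp only: sign_compose permutation_swap_id sign_swap_id)
      ultimately show ?case
        using swap.hyps(3) swap.IH by (simp only:) simp
    qed simp
    moreover have "T \<pi> = T \<iota>"
      by (rule cong) (simp add: \<pi>_def)
    moreover have "det_tensor n \<iota> = real_of_int (sign \<pi>)"
      by (rule det_tensor_permutes[OF \<pi> _ \<iota>]) (simp add: \<pi>_def)
    ultimately show ?thesis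
      by simp
  qed
qed

section \<open>Rank of the determinant tensor\<close>

lemma sum_PiE_Suc:
  fixes g :: "(nat \<Rightarrow> 'a) \<Rightarrow> 'b::comm_monoid_add"
  shows "(\<Sum>f\<in>{..<Suc k} \<rightarrow>\<^sub>E S. g f) = (\<Sum>f\<in>{..<k} \<rightarrow>\<^sub>E S. \<Sum>j\<in>S. g (f(k := j)))"
proof -
  have eq: "{..<Suc k} \<rightarrow>\<^sub>E S = (\<lambda>(y, f). f(k := y)) ` (S \<times> ({..<k} \<rightarrow>\<^sub>E S))"
    by (simp add: lessThan_Suc PiE_insert_eq)
  have inj: "inj_on (\<lambda>(y, f). f(k := y)) (S \<times> ({..<k} \<rightarrow>\<^sub>E S))"
    using inj_combinator[of k "{..<k}" "\<lambda>_. S"] by simp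
  have "(\<Sum>f\<in>{..<Suc k} \<rightarrow>\<^sub>E S. g f) = (\<Sum>(j, f)\<in>S \<times> ({..<k} \<rightarrow>\<^sub>E S). g (f(k := j)))"
    unfolding eq sum.reindex[OF inj] by (simp add: case_prod_unfold)
  then show ?thesis
    by (simp add: sum.cartesian_product[symmetric] sum.swap[of _ S])
qed

text \<open>Gaussian elimination, one equation at a time. It takes the place of matrix rank in the
  second bound: too few linear conditions leave a nonzero solution.\<close>

lemma homogeneous_system_nontrivial_solution:
  fixes a :: "'e \<Rightarrow> 'i \<Rightarrow> 'k::field"
  assumes "finite E" "finite I" "card E < card I"
  shows "\<exists>c. (\<exists>i\<in>I. c i \<noteq> 0) \<and> (\<forall>e\<in>E. (\<Sum>i\<in>I. c i * a e i) = 0)"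
  using assms
proof (induction E arbitrary: I a rule: finite_induct)
  case empty
  then obtain i where "i \<in> I"
    by fastforce
  then show ?case
    by (intro exI[of _ "\<lambda>_. 1"]) auto
next
  case (insert e E)
  show ?case
  proof (cases "\<forall>i\<in>I. a e i = 0")
    case True
    obtain c where "\<exists>i\<in>I. c i \<noteq> 0" "\<forall>e\<in>E. (\<Sum>i\<in>I. c i * a e i) = 0"
      using insert.IH[of I a] insert.prems insert.hyps by auto
    then show ?thesis
      using True by (intro exI[of _ c]) auto
  next
    case False
    then obtain j where j: "j \<in> I" "a e j \<noteq> 0"
      by blast
    \<comment> \<open>The coefficients of equation \<open>e'\<close> after the unknown
      \<open>j\<close> has been eliminated with the pivot equation \<open>e\<close>.\<close>
    define b where "b e' i = a e' i - a e' j * a e i / a e j" for e' i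
    have "card E < card (I - {j})"
      using insert j by auto
    then obtain c where c: "\<exists>i\<in>I - {j}. c i \<noteq> 0" "\<And>e'. e' \<in> E \<Longrightarrow> (\<Sum>i\<in>I - {j}. c i * b e' i) = 0"
      using insert.IH[of "I - {j}" b] insert.prems by blast
    define s where "s = (\<Sum>i\<in>I - {j}. c i * a e i)"
    \<comment> \<open>Back substitution: this value of the unknown \<open>j\<close> makes equation
      \<open>e\<close> hold.\<close>
    define c' where "c' = c(j := - s / a e j)"
    have *: "(\<Sum>i\<in>I. c' i * a e' i) = - s / a e j * a e' j + (\<Sum>i\<in>I - {j}. c i * a e' i)" for e'
    proof -
      have "(\<Sum>i\<in>I. c' i * a e' i) = c' j * a e' j + (\<Sum>i\<in>I - {j}. c' i * a e' i)"
        using insert.prems j by (simp add: sum.remove)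
      also have "(\<Sum>i\<in>I - {j}. c' i * a e' i) = (\<Sum>i\<in>I - {j}. c i * a e' i)"
        by (intro sum.cong) (auto simp: c'_def)
      finally show ?thesis
        by (simp add: c'_def)
    qed
    have "(\<Sum>i\<in>I. c' i * a e' i) = 0" if "e' \<in> E" for e'
    proof -
      have "(\<Sum>i\<in>I - {j}. c i * b e' i) = (\<Sum>i\<in>I - {j}. c i * a e' i) - s / a e j * a e' j"
        by (simp add: b_def s_def sum_subtractf sum_distrib_left sum_distrib_right sum_divide_distrib
            algebra_simps)
      then show ?thesis
        using c(2)[OF that] by (simp add: *)
    qed
    moreover have "(\<Sum>i\<in>I. c' i * a e i) = 0"
      using j by (simp add: * s_def)
    moreover have "\<exists>i\<in>I. c' i \<noteq> 0"
      using c(1) by (auto simp: c'_def)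
    ultimately show ?thesis
      by blast
  qed
qed

text \<open>A definition cannot quantify over the type of the index set \<open>I\<close>; lemma \<open>linear_operator_sum\<close>
  carries the condition over to arbitrary finite families.\<close>

definition linear_operator :: "(('a \<Rightarrow> real) \<Rightarrow> 'b \<Rightarrow> real) \<Rightarrow> bool" where
  "linear_operator L \<longleftrightarrow> (\<forall>(I :: nat set) c f. finite I \<longrightarrow>
     L (\<lambda>A. \<Sum>i\<in>I. c i * f i A) = (\<lambda>A. \<Sum>i\<in>I. c i * L (f i) A))"

lemma linear_operator_sum:
  fixes I :: "'i set"
  assumes "linear_operator L" "finite I"
  shows "L (\<lambda>A. \<Sum>i\<in>I. c i * f i A) = (\<lambda>A. \<Sum>i\<in>I. c i * L (f i) A)"
proof -
  obtain h where h: "bij_betw h {..<card I} I"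
    using ex_bij_betw_nat_finite[OF assms(2)] by (auto simp: atLeast0LessThan)
  have "L (\<lambda>A. \<Sum>i<card I. c (h i) * f (h i) A) = (\<lambda>A. \<Sum>i<card I. c (h i) * L (f (h i)) A)"
    using assms(1)[unfolded linear_operator_def, rule_format, OF finite_lessThan,
        of "\<lambda>i. c (h i)" "\<lambda>i. f (h i)" "card I"] .
  then show ?thesis
    using sum.reindex_bij_betw[OF h, of "\<lambda>i. c i * f i _"]
      sum.reindex_bij_betw[OF h, of "\<lambda>i. c i * L (f i) _"] by simp
qed

lemma linear_operator_zero: "linear_operator L \<Longrightarrow> L (\<lambda>_. 0) = (\<lambda>_. 0)"
  using linear_operator_sum[of L "{} :: nat set"] by simp

lemma linear_operator_scale: "linear_operator L \<Longrightarrow> L (\<lambda>A. c * f A) = (\<lambda>A. c * L f A)"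
  using linear_operator_sum[of L "{0::nat}" "\<lambda>_. c" "\<lambda>_. f"] by simp

lemma linear_operator_minus: "linear_operator L \<Longrightarrow> L (\<lambda>A. - f A) = (\<lambda>A. - L f A)"
  using linear_operator_scale[of L "-1" f] by simp

lemma linear_operator_sum1:
  "linear_operator L \<Longrightarrow> finite I \<Longrightarrow> L (\<lambda>A. \<Sum>i\<in>I. f i A) = (\<lambda>A. \<Sum>i\<in>I. L (f i) A)"
  using linear_operator_sum[of L I "\<lambda>_. 1" f] by simp

lemma linear_operator_compose:
  "linear_operator L \<Longrightarrow> linear_operator K \<Longrightarrow> linear_operator (\<lambda>f. L (K f))"
  by (simp add: linear_operator_def)

lemma linear_operator_id: "linear_operator (\<lambda>f. f)"
  by (simp add: linear_operator_def)

lemma linear_operator_lincomb: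
  assumes "finite J" "\<And>j. j \<in> J \<Longrightarrow> linear_operator (L j)"
  shows "linear_operator (\<lambda>f A. \<Sum>j\<in>J. d j * L j f A)"
  unfolding linear_operator_def
proof (intro allI impI ext)
  fix I :: "nat set" and c f A
  assume "finite I"
  then have "(\<Sum>j\<in>J. d j * L j (\<lambda>A. \<Sum>i\<in>I. c i * f i A) A) = (\<Sum>j\<in>J. d j * (\<Sum>i\<in>I. c i * L j (f i) A))"
    using assms by (intro sum.cong) (simp_all add: linear_operator_sum)
  also have "\<dots> = (\<Sum>i\<in>I. c i * (\<Sum>j\<in>J. d j * L j (f i) A))"
    by (simp add: sum_distrib_left sum.swap[of _ I] mult.left_commute)
  finally show "(\<Sum>j\<in>J. d j * L j (\<lambda>A. \<Sum>i\<in>I. c i * f i A) A) = (\<Sum>i\<in>I. c i * (\<Sum>j\<in>J. d j * L j (f i) A))" .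
qed

text \<open>Exterior algebra in coordinates: a function on sets of modes is the vector with these coefficients
  with respect to the basis of wedge products of modes in increasing order. Then \<open>create q\<close> is \<open>q \<and> _\<close>
  and \<open>annih q\<close> is its adjoint. With modes \<open>(k, j)\<close>, functions supported on the sets with \<open>w k\<close> elements
  in each row \<open>k\<close> form the tensor product over \<open>k\<close> of the exterior powers of degree \<open>w k\<close>. Using one
  exterior algebra for all rows makes operators on different rows anticommute.\<close>

locale fock =
  fixes M :: "'q::linorder set"
  assumes finite_modes: "finite M"
begin

text \<open>The sign of moving \<open>q\<close> past the smaller modes of \<open>A\<close> to its
  place in the increasing wedge product. Intersecting with \<open>M\<close> keeps the counted set
  finite for every \<open>A\<close>.\<close>

definition sgn_before :: "'q \<Rightarrow> 'q set \<Rightarrow> real" where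
  "sgn_before q A = (-1) ^ card {p \<in> A \<inter> M. p < q}"

definition create :: "'q \<Rightarrow> ('q set \<Rightarrow> real) \<Rightarrow> 'q set \<Rightarrow> real" where
  "create q f A = (if q \<in> A then sgn_before q A * f (A - {q}) else 0)"

definition annih :: "'q \<Rightarrow> ('q set \<Rightarrow> real) \<Rightarrow> 'q set \<Rightarrow> real" where
  "annih q f A = (if q \<in> A then 0 else sgn_before q A * f (insert q A))"

lemma linear_operator_create: "linear_operator (create q)"
  by (auto simp: linear_operator_def create_def sum_distrib_left mult.left_commute fun_eq_iff)

lemma linear_operator_annih: "linear_operator (annih q)"
  by (auto simp: linear_operator_def annih_def sum_distrib_left mult.left_commute fun_eq_iff)

lemma sgn_before_insert:
  assumes "p \<in> M" "p \<notin> A"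
  shows "sgn_before q (insert p A) = (if p < q then - sgn_before q A else sgn_before q A)"
proof (cases "p < q")
  case True
  then have "{x \<in> insert p A \<inter> M. x < q} = insert p {x \<in> A \<inter> M. x < q}"
    using assms by auto
  then show ?thesis
    using True assms finite_modes by (simp add: sgn_before_def)
next
  case False
  then have "{x \<in> insert p A \<inter> M. x < q} = {x \<in> A \<inter> M. x < q}"
    by auto
  then show ?thesis
    using False by (simp add: sgn_before_def)
qed

lemma sgn_before_remove:
  assumes "p \<in> M" "p \<in> A"
  shows "sgn_before q (A - {p}) = (if p < q then - sgn_before q A else sgn_before q A)"
  using sgn_before_insert[OF assms(1), of "A - {p}" q] assms(2) by (simp add: insert_absorb)

lemma sgn_before_square: "sgn_before q A * (sgn_before q A * x) = x"
  by (simp add: sgn_before_def flip: mult.assoc power_mult_distrib)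

lemma create_create:
  assumes "p \<in> M" "q \<in> M"
  shows "create p (create q f) = (\<lambda>A. - create q (create p f) A)"
proof
  fix A
  show "create p (create q f) A = - create q (create p f) A"
  proof (cases "p = q")
    case False
    then have "(p < q) = (\<not> q < p)"
      by auto
    moreover have "A - {q} - {p} = A - {p} - {q}"
      by blast
    ultimately show ?thesis
      using assms False unfolding create_def by (simp add: sgn_before_remove)
  qed (simp add: create_def)
qed

lemma annih_annih:
  assumes "p \<in> M" "q \<in> M"
  shows "annih p (annih q f) = (\<lambda>A. - annih q (annih p f) A)"
proof
  fix A
  show "annih p (annih q f) A = - annih q (annih p f) A"
    using assms
    by (cases p q rule: linorder_cases) (auto simp: annih_def sgn_before_insert insert_commute)
qed

lemma annih_create:
  assumes "p \<in> M" "q \<in> M" "p \<noteq> q"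
  shows "annih p (create q f) = (\<lambda>A. - create q (annih p f) A)"
proof
  fix A
  show "annih p (create q f) A = - create q (annih p f) A"
    using assms
    by (cases p q rule: linorder_cases) (auto simp: annih_def create_def sgn_before_insert
        sgn_before_remove insert_Diff_if)
qed

text \<open>Together with the next lemma, the anticommutation relation for equal modes: the two
  compositions are complementary projections.\<close>

lemma create_annih_same: "q \<in> M \<Longrightarrow> create q (annih q f) A = (if q \<in> A then f A else 0)"
  by (simp add: create_def annih_def sgn_before_remove sgn_before_square insert_absorb)

lemma annih_create_same: "q \<in> M \<Longrightarrow> annih q (create q f) A = (if q \<in> A then 0 else f A)"
  by (simp add: create_def annih_def sgn_before_insert sgn_before_square)

definition ip :: "('q set \<Rightarrow> real) \<Rightarrow> ('q set \<Rightarrow> real) \<Rightarrow> real" where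
  "ip f g = (\<Sum>A\<in>Pow M. f A * g A)"

lemma ip_commute: "ip f g = ip g f"
  by (simp add: ip_def mult.commute)

text \<open>Removing \<open>q\<close> matches the sets that contain it with those that do not. The
  sign is the same on both sides, since only modes strictly before \<open>q\<close> count.\<close>

lemma ip_create:
  assumes "q \<in> M"
  shows "ip (create q f) g = ip f (annih q g)"
proof -
  have "ip (create q f) g = (\<Sum>A\<in>{A \<in> Pow M. q \<in> A}. sgn_before q A * f (A - {q}) * g A)"
    unfolding ip_def using finite_modes by (intro sum.mono_neutral_cong_right) (auto simp: create_def)
  also have "\<dots> = (\<Sum>A\<in>{A \<in> Pow M. q \<notin> A}. f A * (sgn_before q A * g (insert q A)))"
    by (rule sum.reindex_bij_witness[where i = "insert q" and j = "\<lambda>A. A - {q}"])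
       (use assms in \<open>auto simp: sgn_before_remove insert_absorb\<close>)
  also have "\<dots> = ip f (annih q g)"
    unfolding ip_def using finite_modes by (intro sum.mono_neutral_cong_left) (auto simp: annih_def)
  finally show ?thesis .
qed

lemma ip_sum_left: "finite I \<Longrightarrow> ip (\<lambda>A. \<Sum>i\<in>I. f i A) g = (\<Sum>i\<in>I. ip (f i) g)"
  by (simp add: ip_def sum_distrib_right sum.swap[of _ I])

lemma ip_sum_right: "finite I \<Longrightarrow> ip g (\<lambda>A. \<Sum>i\<in>I. f i A) = (\<Sum>i\<in>I. ip g (f i))"
  by (simp add: ip_def sum_distrib_left sum.swap[of _ I])

lemma ip_self_eq_0:
  assumes "ip f f \<le> 0" "A \<subseteq> M"
  shows "f A = 0"
proof -
  have "\<forall>A\<in>Pow M. f A * f A = 0"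
    using assms(1) finite_modes unfolding ip_def
    by (subst sum_nonneg_eq_0_iff[symmetric]) (auto intro!: antisym sum_nonneg)
  then show ?thesis
    using assms(2) by auto
qed

lemma ip_self_nonneg: "0 \<le> ip f f"
  by (simp add: ip_def sum_nonneg)

end

section \<open>Rows of modes and operators moving a vector between rows\<close>

definition modes :: "nat \<Rightarrow> (nat \<times> nat) set" where
  "modes n = {..<n} \<times> {..<n}"

lemma mem_modes [simp]: "(k, j) \<in> modes n \<longleftrightarrow> k < n \<and> j < n"
  by (simp add: modes_def)

locale det_fock = fixes n :: nat
begin

sublocale fock "modes n"
  by unfold_locales (simp add: modes_def)

definition row_card :: "nat \<Rightarrow> (nat \<times> nat) set \<Rightarrow> nat" where
  "row_card k A = card {j. (k, j) \<in> A}"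

definition has_weight :: "(nat \<Rightarrow> nat) \<Rightarrow> ((nat \<times> nat) set \<Rightarrow> real) \<Rightarrow> bool" where
  "has_weight w f \<longleftrightarrow> (\<forall>A. f A \<noteq> 0 \<longrightarrow> A \<subseteq> modes n \<and> (\<forall>k<n. row_card k A = w k))"

lemma finite_row: "A \<subseteq> modes n \<Longrightarrow> finite {j. (k, j) \<in> A}"
  by (rule finite_subset[of _ "{..<n}"]) (auto simp: modes_def)

lemma row_card_remove:
  assumes "A \<subseteq> modes n" "(k, j) \<in> A"
  shows "row_card l A = (if l = k then Suc (row_card l (A - {(k, j)})) else row_card l (A - {(k, j)}))"
proof (cases "l = k")
  case True
  have "{i. (k, i) \<in> A} = insert j {i. (k, i) \<in> A - {(k, j)}}"
    using assms by auto
  moreover have "finite {i. (k, i) \<in> A - {(k, j)}}"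
    using assms by (intro finite_row) auto
  ultimately show ?thesis
    using True by (simp add: row_card_def)
next
  case False
  then have "{i. (l, i) \<in> A} = {i. (l, i) \<in> A - {(k, j)}}"
    by auto
  then show ?thesis
    using False by (simp add: row_card_def)
qed

lemma has_weight_sum:
  assumes "\<And>i. i \<in> I \<Longrightarrow> has_weight w (f i)"
  shows "has_weight w (\<lambda>A. \<Sum>i\<in>I. c i * f i A)"
  unfolding has_weight_def
proof (intro allI impI)
  fix A assume "(\<Sum>i\<in>I. c i * f i A) \<noteq> 0"
  then obtain i where "i \<in> I" "f i A \<noteq> 0"
    by (fastforce elim: sum.not_neutral_contains_not_neutral)
  then show "A \<subseteq> modes n \<and> (\<forall>k<n. row_card k A = w k)"
    using assms[OF \<open>i \<in> I\<close>] unfolding has_weight_def by blast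
qed

lemma has_weight_create:
  assumes "has_weight w f" "k < n" "j < n"
  shows "has_weight (w(k := Suc (w k))) (create (k, j) f)"
  unfolding has_weight_def
proof (intro allI impI)
  fix A assume "create (k, j) f A \<noteq> 0"
  then have A: "(k, j) \<in> A" "f (A - {(k, j)}) \<noteq> 0"
    by (auto simp: create_def split: if_splits)
  then have *: "A - {(k, j)} \<subseteq> modes n" "\<forall>l<n. row_card l (A - {(k, j)}) = w l"
    using assms(1) by (auto simp: has_weight_def)
  then have "A \<subseteq> modes n"
    using assms by auto
  then show "A \<subseteq> modes n \<and> (\<forall>l<n. row_card l A = (w(k := Suc (w k))) l)"
    using * row_card_remove[OF _ A(1)] by auto
qed

text \<open>The truncated subtraction is harmless: if \<open>w k = 0\<close>, the contraction of
  \<open>f\<close> is zero and has every weight.\<close>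

lemma has_weight_annih:
  assumes "has_weight w f" "k < n" "j < n"
  shows "has_weight (w(k := w k - 1)) (annih (k, j) f)"
  unfolding has_weight_def
proof (intro allI impI)
  fix A assume "annih (k, j) f A \<noteq> 0"
  then have A: "(k, j) \<notin> A" "f (insert (k, j) A) \<noteq> 0"
    by (auto simp: annih_def split: if_splits)
  then have *: "insert (k, j) A \<subseteq> modes n" "\<forall>l<n. row_card l (insert (k, j) A) = w l"
    using assms(1) by (auto simp: has_weight_def)
  then show "A \<subseteq> modes n \<and> (\<forall>l<n. row_card l A = (w(k := w k - 1)) l)"
    using row_card_remove[OF *(1), of k j] A(1) by auto
qed

text \<open>The action of the elementary matrix \<open>E_kl\<close> of \<open>gl_n\<close> on the
  rows. The operators \<open>shift k l\<close> and \<open>shift l k\<close> generate the copy of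
  \<open>sl_2\<close> in question.\<close>

definition shift :: "nat \<Rightarrow> nat \<Rightarrow> ((nat \<times> nat) set \<Rightarrow> real) \<Rightarrow> (nat \<times> nat) set \<Rightarrow> real" where
  "shift k l f = (\<lambda>A. \<Sum>j<n. create (k, j) (annih (l, j) f) A)"

lemma has_weight_shift:
  assumes "has_weight w f" "k < n" "l < n" "k \<noteq> l"
  shows "has_weight (w(k := Suc (w k), l := w l - 1)) (shift k l f)"
proof -
  have "has_weight ((w(l := w l - 1))(k := Suc ((w(l := w l - 1)) k))) (create (k, j) (annih (l, j) f))"
    if "j < n" for j
    using that assms by (intro has_weight_create has_weight_annih) auto
  then show ?thesis
    using has_weight_sum[of "{..<n}" _ "\<lambda>j. create (k, j) (annih (l, j) f)" "\<lambda>_. 1"] assms(4)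
    by (simp add: shift_def fun_upd_twist)
qed

lemma ip_shift:
  assumes "k < n" "l < n" "k \<noteq> l"
  shows "ip (shift k l f) g = ip f (shift l k g)"
proof -
  have "ip (create (k, j) (annih (l, j) f)) g = ip f (create (l, j) (annih (k, j) g))" if "j < n" for j
  proof -
    have "ip (create (k, j) (annih (l, j) f)) g = ip (annih (k, j) g) (annih (l, j) f)"
      using that assms ip_create[of "(k, j)" "annih (l, j) f" g] ip_commute[of "annih (l, j) f"] by simp
    also have "\<dots> = ip (create (l, j) (annih (k, j) g)) f"
      using that assms by (simp add: ip_create)
    finally show ?thesis
      by (simp add: ip_commute)
  qed
  then show ?thesis
    by (simp add: shift_def ip_sum_left ip_sum_right)
qed

lemma sum_create_annih:
  assumes "A \<subseteq> modes n" "k < n"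
  shows "(\<Sum>j<n. create (k, j) (annih (k, j) f) A) = real (row_card k A) * f A"
proof -
  have "(\<Sum>j<n. create (k, j) (annih (k, j) f) A) = (\<Sum>j\<in>{j. (k, j) \<in> A}. f A)"
    using assms by (intro sum.mono_neutral_cong_right) (auto simp: create_annih_same)
  then show ?thesis
    by (simp add: row_card_def)
qed

text \<open>Normal ordering: bringing the inner creation in front of the contraction costs a sign
  and, for equal columns only, leaves a quadratic term that counts the vectors in row
  \<open>k\<close>. The quartic remainder is symmetric in the two rows.\<close>

lemma shift_shift:
  assumes "k < n" "l < n" "k \<noteq> l"
  shows "shift k l (shift l k f) A =
    (\<Sum>i<n. create (k, i) (annih (k, i) f) A)
     - (\<Sum>i<n. \<Sum>j<n. create (k, i) (create (l, j) (annih (l, i) (annih (k, j) f))) A)"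
proof -
  have "create (k, i) (annih (l, i) (create (l, j) (annih (k, j) f))) A =
    (if i = j then create (k, i) (annih (k, i) f) A else 0) - create (k, i) (create (l, j) (annih (l,
        i) (annih (k, j) f))) A"
    if "i < n" "j < n" for i j
  proof (cases "i = j")
    case True
    have "annih (l, j) (create (l, j) (annih (k, j) f)) = (\<lambda>A. annih (k, j) f A - create (l, j) (annih
        (l, j) (annih (k, j) f)) A)"
      using that assms by (simp add: fun_eq_iff annih_create_same create_annih_same)
    then show ?thesis
      using True linear_operator_sum[OF linear_operator_create[of "(k, j)"], of "{0, 1::nat}" "\<lambda>i. if
          i = 0 then 1 else -1"
         "\<lambda>i. if i = 0 then annih (k, j) f else create (l, j) (annih (l, j) (annih (k, j) f))"] by simp
  next
    case False
    then show ?thesis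
      using that assms annih_create[of "(l, i)" "(l, j)" "annih (k, j) f"]
      by (simp add: linear_operator_minus[OF linear_operator_create])
  qed
  moreover have "shift k l (shift l k f) A = (\<Sum>i<n. \<Sum>j<n. create (k, i) (annih (l, i) (create (l, j)
      (annih (k, j) f))) A)"
    unfolding shift_def
    by (simp add: linear_operator_sum1[OF linear_operator_compose[OF linear_operator_create
        linear_operator_annih]])
  ultimately show ?thesis
    by (simp add: sum_subtractf)
qed

text \<open>Swapping the two creations and the two contractions costs two signs, so the quartic
  remainders of both orders agree and cancel. What is left is the relation \<open>[E, F] = H\<close>
  of \<open>sl_2\<close>.\<close>

lemma shift_commutator:
  assumes "k < n" "l < n" "k \<noteq> l" "A \<subseteq> modes n"
  shows "shift k l (shift l k f) A - shift l k (shift k l f) A =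
    (real (row_card k A) - real (row_card l A)) * f A"
proof -
  have "create (k, i) (create (l, j) (annih (l, i) (annih (k, j) f))) A
      = create (l, j) (create (k, i) (annih (k, j) (annih (l, i) f))) A" if "i < n" "j < n" for i j
  proof -
    have "annih (l, i) (annih (k, j) f) = (\<lambda>A. - annih (k, j) (annih (l, i) f) A)"
      using that assms by (intro annih_annih) auto
    moreover have "create (k, i) (create (l, j) g) = (\<lambda>A. - create (l, j) (create (k, i) g) A)" for g
      using that assms by (intro create_create) auto
    ultimately show ?thesis
      by (simp add: linear_operator_minus[OF linear_operator_create])
  qed
  then have "(\<Sum>i<n. \<Sum>j<n. create (k, i) (create (l, j) (annih (l, i) (annih (k, j) f))) A)
     = (\<Sum>j<n. \<Sum>i<n. create (l, j) (create (k, i) (annih (k, j) (annih (l, i) f))) A)"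
    by (subst sum.swap) (simp cong: sum.cong_simp)
  then show ?thesis
    using assms by (simp add: shift_shift sum_create_annih algebra_simps)
qed

text \<open>By the commutator relation, \<open>\<parallel>shift k l f\<parallel>\<^sup>2 = \<parallel>shift l k f\<parallel>\<^sup>2 + \<parallel>f\<parallel>\<^sup>2\<close>.\<close>

lemma shift_injective:
  assumes "k < n" "l < n" "k \<noteq> l" and w: "has_weight w f" "w l = Suc (w k)"
    and 0: "shift k l f = (\<lambda>_. 0)"
  shows "f = (\<lambda>_. 0)"
proof -
  have "ip (shift k l f) (shift k l f) = ip f (shift l k (shift k l f))"
    by (rule ip_shift[OF assms(1-3)])
  also have "\<dots> = ip f (shift k l (shift l k f)) + ip f f"
  proof -
    have "f A * shift l k (shift k l f) A = f A * shift k l (shift l k f) A + f A * f A"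
        if "A \<subseteq> modes n" for A
    proof (cases "f A = 0")
      case False
      then have "row_card k A = w k" "row_card l A = Suc (w k)"
        using w assms by (auto simp: has_weight_def)
      then have "shift l k (shift k l f) A = shift k l (shift l k f) A + f A"
        using shift_commutator[OF assms(1-3) that, of f] by simp
      then show ?thesis
        by (simp add: distrib_left)
    qed simp
    then show ?thesis
      unfolding ip_def by (simp add: sum.distrib[symmetric])
  qed
  also have "ip f (shift k l (shift l k f)) = ip (shift l k f) (shift l k f)"
    by (rule ip_shift[OF assms(2,1) assms(3)[symmetric], symmetric])
  finally have "ip f f \<le> 0"
    using ip_self_nonneg[of "shift l k f"] by (simp add: 0 ip_def)
  then have "f A = 0" for A
    using ip_self_eq_0[of f A] w(1) by (auto simp: has_weight_def)
  then show ?thesis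
    by auto
qed

end

section \<open>Iterated contractions, creations and shifts\<close>

context det_fock
begin

text \<open>The innermost operator has the largest index. The same convention in
  \<open>creates\<close>, \<open>shifts\<close> and \<open>creates_vec\<close> lets all four unfold
  in step.\<close>

primrec annihs :: "nat \<Rightarrow> nat \<Rightarrow> (nat \<Rightarrow> nat) \<Rightarrow> ((nat \<times> nat) set \<Rightarrow> real) \<Rightarrow> (nat \<times> nat) set \<Rightarrow> real" where
  "annihs m 0 \<iota> f = f"
| "annihs m (Suc k) \<iota> f = annihs m k \<iota> (annih (m, \<iota> k) f)"

primrec creates :: "nat \<Rightarrow> (nat \<Rightarrow> nat) \<Rightarrow> ((nat \<times> nat) set \<Rightarrow> real) \<Rightarrow> (nat \<times> nat) set \<Rightarrow> real" where
  "creates 0 \<iota> f = f"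
| "creates (Suc k) \<iota> f = creates k \<iota> (create (k, \<iota> k) f)"

primrec shifts :: "nat \<Rightarrow> nat \<Rightarrow> ((nat \<times> nat) set \<Rightarrow> real) \<Rightarrow> (nat \<times> nat) set \<Rightarrow> real" where
  "shifts m 0 f = f"
| "shifts m (Suc k) f = shifts m k (shift k m f)"

definition create_vec :: "nat \<Rightarrow> (nat \<Rightarrow> real) \<Rightarrow> ((nat \<times> nat) set \<Rightarrow> real) \<Rightarrow> (nat \<times> nat) set \<Rightarrow> real" where
  "create_vec k v f = (\<lambda>A. \<Sum>j<n. v j * create (k, j) f A)"

primrec creates_vec :: "nat \<Rightarrow> (nat \<Rightarrow> nat \<Rightarrow> real) \<Rightarrow> ((nat \<times> nat) set \<Rightarrow> real) \<Rightarrow> (nat \<times> nat) set \<Rightarrow> real"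
    where
  "creates_vec 0 v f = f"
| "creates_vec (Suc k) v f = creates_vec k v (create_vec k (v k) f)"

lemma linear_operator_annihs: "linear_operator (annihs m k \<iota>)"
proof (induction k)
  case 0
  have "annihs m 0 \<iota> = (\<lambda>f. f)"
    by (rule ext) simp
  then show ?case
    by (simp add: linear_operator_id)
next
  case (Suc k)
  have "annihs m (Suc k) \<iota> = (\<lambda>f. annihs m k \<iota> (annih (m, \<iota> k) f))"
    by (rule ext) simp
  then show ?case
    using linear_operator_compose[OF Suc.IH linear_operator_annih] by simp
qed

lemma linear_operator_creates: "linear_operator (creates k \<iota>)"
proof (induction k)
  case 0
  have "creates 0 \<iota> = (\<lambda>f. f)"
    by (rule ext) simp
  then show ?case
    by (simp add: linear_operator_id)
next
  case (Suc k)
  have "creates (Suc k) \<iota> = (\<lambda>f. creates k \<iota> (create (k, \<iota> k) f))"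
    by (rule ext) simp
  then show ?case
    using linear_operator_compose[OF Suc.IH linear_operator_create] by simp
qed

lemma linear_operator_create_vec: "linear_operator (create_vec k v)"
  unfolding create_vec_def by (intro linear_operator_lincomb linear_operator_create) simp

lemma linear_operator_creates_vec: "linear_operator (creates_vec k v)"
proof (induction k)
  case 0
  have "creates_vec 0 v = (\<lambda>f. f)"
    by (rule ext) simp
  then show ?case
    by (simp add: linear_operator_id)
next
  case (Suc k)
  have "creates_vec (Suc k) v = (\<lambda>f. creates_vec k v (create_vec k (v k) f))"
    by (rule ext) simp
  then show ?case
    using linear_operator_compose[OF Suc.IH linear_operator_create_vec] by simp
qed

text \<open>Before the shift into row \<open>k\<close> the last row holds \<open>k + 1\<close>
  vectors and row \<open>k\<close> holds \<open>k\<close>, the situation of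
  \<open>shift_injective\<close>. Afterwards the last row holds \<open>k\<close>, one more than row
  \<open>k - 1\<close>.\<close>

lemma shifts_injective:
  assumes "has_weight w f" "\<And>j. j < k \<Longrightarrow> w j = j" "w m = k" "m < n" "k \<le> m" "shifts m k f = (\<lambda>_. 0)"
  shows "f = (\<lambda>_. 0)"
  using assms
proof (induction k arbitrary: w f)
  case (Suc k)
  have w: "has_weight (w(k := Suc (w k), m := w m - 1)) (shift k m f)"
    using Suc.prems by (intro has_weight_shift) auto
  have 0: "shift k m f = (\<lambda>_. 0)"
    by (rule Suc.IH[OF w]) (use Suc.prems in auto)
  have "w m = Suc (w k)"
    using Suc.prems(2)[of k] Suc.prems(3) by simp
  then show ?case
    using Suc.prems(4,5) by (intro shift_injective[OF _ _ _ Suc.prems(1) _ 0]) simp_all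
qed simp

lemma annihs_cong: "(\<And>j. j < k \<Longrightarrow> \<iota> j = \<kappa> j) \<Longrightarrow> annihs m k \<iota> f = annihs m k \<kappa> f"
  by (induction k arbitrary: f) auto

lemma creates_cong: "(\<And>j. j < k \<Longrightarrow> \<iota> j = \<kappa> j) \<Longrightarrow> creates k \<iota> f = creates k \<kappa> f"
  by (induction k arbitrary: f) auto

lemma annihs_create:
  assumes "\<And>j. j < k \<Longrightarrow> \<iota> j < n" "m < n" "l < n" "i < n" "l \<noteq> m"
  shows "annihs m k \<iota> (create (l, i) f) = (\<lambda>A. (-1) ^ k * create (l, i) (annihs m k \<iota> f) A)"
  using assms(1)
proof (induction k arbitrary: f)
  case (Suc k)
  have "annih (m, \<iota> k) (create (l, i) f) = (\<lambda>A. - create (l, i) (annih (m, \<iota> k) f) A)"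
    using Suc.prems assms by (intro annih_create) auto
  then show ?case
    using Suc by (simp add: linear_operator_minus[OF linear_operator_annihs])
qed simp

text \<open>Each shift is expanded over its column, and every creation is moved out past the
  contractions of row \<open>m\<close>. As the rows differ, this costs only a sign independent of
  the columns, which is collected in \<open>\<epsilon>\<close>.\<close>

lemma shifts_expand:
  assumes "m < n" "k \<le> m"
  obtains \<epsilon> :: real where "\<epsilon> \<noteq> 0"
    "\<And>f A. shifts m k f A = \<epsilon> * (\<Sum>\<iota>\<in>{..<k} \<rightarrow>\<^sub>E {..<n}. creates k \<iota> (annihs m k \<iota> f) A)"
proof -
  have "\<exists>\<epsilon> :: real. \<epsilon> \<noteq> 0 \<and>
    (\<forall>f A. shifts m k f A = \<epsilon> * (\<Sum>\<iota>\<in>{..<k} \<rightarrow>\<^sub>E {..<n}. creates k \<iota> (annihs m k \<iota> f) A))"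
    using assms(2)
  proof (induction k)
    case (Suc k)
    then obtain \<epsilon> :: real where \<epsilon>: "\<epsilon> \<noteq> 0"
      "\<And>f A. shifts m k f A = \<epsilon> * (\<Sum>\<iota>\<in>{..<k} \<rightarrow>\<^sub>E {..<n}. creates k \<iota> (annihs m k \<iota> f) A)"
      by auto
    have "creates k \<iota> (annihs m k \<iota> (shift k m f)) A =
        (-1) ^ k * (\<Sum>j<n. creates (Suc k) (\<iota>(k := j)) (annihs m (Suc k) (\<iota>(k := j)) f) A)"
      if "\<iota> \<in> {..<k} \<rightarrow>\<^sub>E {..<n}" for \<iota> f A
    proof -
      have "creates k \<iota> (annihs m k \<iota> (create (k, j) (annih (m, j) f))) A =
         (-1) ^ k * creates (Suc k) (\<iota>(k := j)) (annihs m (Suc k) (\<iota>(k := j)) f) A" if "j < n" for j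
      proof -
        have "annihs m k \<iota> (create (k, j) (annih (m, j) f)) =
           (\<lambda>A. (-1) ^ k * create (k, j) (annihs m k \<iota> (annih (m, j) f)) A)"
          using that assms Suc.prems \<open>\<iota> \<in> _\<close> by (intro annihs_create) auto
        moreover have "annihs m k (\<iota>(k := j)) = annihs m k \<iota>" "creates k (\<iota>(k := j)) = creates k \<iota>"
          by (intro ext annihs_cong creates_cong fun_cong[OF annihs_cong] fun_cong[OF creates_cong];
              simp)+
        ultimately show ?thesis
          by (simp add: linear_operator_scale[OF linear_operator_creates])
      qed
      then show ?thesis
        unfolding shift_def
        by (simp add: linear_operator_sum1[OF linear_operator_compose[OF linear_operator_creates
            linear_operator_annihs]]
            sum_distrib_left)
    qed
    then have "shifts m (Suc k) f A =
      (\<epsilon> * (-1) ^ k) * (\<Sum>\<iota>\<in>{..<Suc k} \<rightarrow>\<^sub>E {..<n}. creates (Suc k) \<iota> (annihs m (Suc k) \<iota> f) A)" for f A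
      unfolding sum_PiE_Suc by (simp add: \<epsilon> sum_distrib_left[symmetric] mult.assoc del: annihs.simps
          creates.simps)
    then show ?case
      using \<epsilon>(1) by (intro exI[of _ "\<epsilon> * (-1) ^ k"]) (auto simp del: shifts.simps annihs.simps
          creates.simps)
  qed (auto intro!: exI[of _ 1])
  then show ?thesis
    using that by blast
qed

lemma creates_vec_expand:
  "creates_vec k v f A = (\<Sum>\<iota>\<in>{..<k} \<rightarrow>\<^sub>E {..<n}. (\<Prod>j<k. v j (\<iota> j)) * creates k \<iota> f A)"
proof (induction k arbitrary: f)
  case (Suc k)
  have *: "creates k (\<iota>(k := j)) = creates k \<iota>" "(\<Prod>i<k. v i ((\<iota>(k := j)) i)) = (\<Prod>i<k. v i (\<iota> i))"
      for \<iota> j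
    by (intro ext fun_cong[OF creates_cong] prod.cong; simp)+
  have "creates_vec (Suc k) v f A =
     (\<Sum>\<iota>\<in>{..<k} \<rightarrow>\<^sub>E {..<n}. (\<Prod>j<k. v j (\<iota> j)) * (\<Sum>j<n. v k j * creates k \<iota> (create (k, j) f) A))"
    unfolding creates_vec.simps Suc.IH create_vec_def
    by (simp add: linear_operator_sum[OF linear_operator_creates])
  also have "\<dots> = (\<Sum>\<iota>\<in>{..<Suc k} \<rightarrow>\<^sub>E {..<n}. (\<Prod>j<Suc k. v j (\<iota> j)) * creates (Suc k) \<iota> f A)"
    unfolding sum_PiE_Suc by (simp add: * sum_distrib_left mult.assoc del: fun_upd_apply) simp
  finally show ?case .
qed simp

text \<open>Contractions anticommute, so contracting a row is alternating in the tuple of columns;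
  this makes \<open>alternating_eq_det_tensor\<close> applicable to full contractions.\<close>

lemma annihs_swap:
  assumes "Suc j < k" "\<And>i. i < k \<Longrightarrow> \<iota> i < n" "m < n"
  shows "annihs m k (\<iota> \<circ> Transposition.transpose j (Suc j)) f A = - annihs m k \<iota> f A"
  using assms
proof (induction k arbitrary: f A)
  case (Suc k)
  let ?t = "Transposition.transpose j (Suc j)"
  show ?case
  proof (cases "Suc j = k")
    case True
    have "annihs m j (\<iota> \<circ> ?t) = annihs m j \<iota>"
      by (intro ext fun_cong[OF annihs_cong]) (simp add: Transposition.transpose_def)
    moreover have "annih (m, \<iota> (Suc j)) (annih (m, \<iota> j) f) = (\<lambda>A. - annih (m, \<iota> j) (annih (m, \<iota> (Suc
        j)) f) A)"
      using Suc.prems by (intro annih_annih) auto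
    ultimately show ?thesis
      by (simp add: comp_def linear_operator_minus[OF linear_operator_annihs] flip: True)
  next
    case False
    then have "(\<iota> \<circ> ?t) k = \<iota> k"
      using Suc.prems by (simp add: Transposition.transpose_def)
    then show ?thesis
      using Suc.IH[of "annih (m, \<iota> k) f" A] Suc.prems False by (simp del: o_apply)
  qed
qed simp

lemma has_weight_annihs:
  assumes "has_weight w f" "\<And>j. j < k \<Longrightarrow> \<iota> j < n" "m < n"
  shows "has_weight (w(m := w m - k)) (annihs m k \<iota> f)"
  using assms
proof (induction k arbitrary: w f)
  case (Suc k)
  have "has_weight (w(m := w m - 1)) (annih (m, \<iota> k) f)"
    using Suc.prems by (intro has_weight_annih) auto
  then have "has_weight ((w(m := w m - 1))(m := (w(m := w m - 1)) m - k)) (annihs m (Suc k) \<iota> f)"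
    unfolding annihs.simps by (rule Suc.IH) (use Suc.prems in auto)
  moreover have "(w(m := w m - 1))(m := (w(m := w m - 1)) m - k) = w(m := w m - Suc k)"
    by (simp add: fun_eq_iff)
  ultimately show ?case
    by metis
qed simp

lemma has_weight_create_vec:
  assumes "has_weight w f" "k < n"
  shows "has_weight (w(k := Suc (w k))) (create_vec k v f)"
  unfolding create_vec_def using assms by (intro has_weight_sum has_weight_create) auto

lemma has_weight_creates_vec:
  assumes "has_weight w f" "k \<le> n"
  shows "has_weight (\<lambda>j. if j < k then Suc (w j) else w j) (creates_vec k v f)"
  using assms
proof (induction k arbitrary: w f)
  case (Suc k)
  have "has_weight (\<lambda>j. if j < k then Suc ((w(k := Suc (w k))) j) else (w(k := Suc (w k))) j)
     (creates_vec k v (create_vec k (v k) f))"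
    using Suc.prems by (intro Suc.IH has_weight_create_vec) auto
  moreover have "(\<lambda>j. if j < k then Suc ((w(k := Suc (w k))) j) else (w(k := Suc (w k))) j) =
     (\<lambda>j. if j < Suc k then Suc (w j) else w j)"
    by (auto simp: fun_eq_iff less_Suc_eq)
  ultimately show ?case
    by simp
qed simp

lemma create_vec_anticommute:
  assumes "k < n" "l < n"
  shows "create_vec k u (create_vec l v f) = (\<lambda>A. - create_vec l v (create_vec k u f) A)"
proof
  fix A
  have "create_vec k u (create_vec l v f) A = (\<Sum>i<n. \<Sum>j<n. u i * (v j * create (k, i) (create (l, j)
      f) A))"
    unfolding create_vec_def by (simp add: linear_operator_sum[OF linear_operator_create]
        sum_distrib_left)
  also have "\<dots> = (\<Sum>i<n. \<Sum>j<n. - (v j * (u i * create (l, j) (create (k, i) f) A)))"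
  proof (intro sum.cong refl)
    fix i j assume "i \<in> {..<n}" "j \<in> {..<n}"
    then show "u i * (v j * create (k, i) (create (l, j) f) A) = - (v j * (u i * create (l, j) (create
        (k, i) f) A))"
      using fun_cong[OF create_create[of "(k, i)" "(l, j)" f], of A] assms by simp
  qed
  also have "\<dots> = - create_vec l v (create_vec k u f) A"
    unfolding create_vec_def
    by (simp add: linear_operator_sum[OF linear_operator_create] sum_distrib_left sum_negf) (rule
        sum.swap)
  finally show "create_vec k u (create_vec l v f) A = - create_vec l v (create_vec k u f) A" .
qed

lemma create_vec_creates_vec:
  assumes "l < n" "k \<le> n"
  shows "create_vec l u (creates_vec k v f) = (\<lambda>A. (-1) ^ k * creates_vec k v (create_vec l u f) A)"
  using assms(2)
proof (induction k arbitrary: f)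
  case (Suc k)
  have "create_vec l u (create_vec k (v k) f) = (\<lambda>A. - create_vec k (v k) (create_vec l u f) A)"
    using Suc.prems assms by (intro create_vec_anticommute) auto
  then show ?case
    using Suc by (simp add: linear_operator_minus[OF linear_operator_creates_vec])
qed simp

text \<open>Moved inwards, the operator meets a second copy of itself, and the square of an operator
  that anticommutes with itself is zero over the reals.\<close>

lemma create_vec_creates_vec_same:
  assumes "l < k" "k \<le> n"
  shows "create_vec l (v l) (creates_vec k v f) = (\<lambda>_. 0)"
  using assms
proof (induction k arbitrary: f)
  case (Suc k)
  show ?case
  proof (cases "l = k")
    case True
    have "create_vec k (v k) (create_vec k (v k) f) = (\<lambda>A. - create_vec k (v k) (create_vec k (v k) f)
        A)"
      using Suc.prems by (intro create_vec_anticommute) auto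
    then have "create_vec k (v k) (create_vec k (v k) f) = (\<lambda>_. 0)"
      by (metis (no_types) equal_neg_zero)
    then show ?thesis
      using True Suc.prems by (simp add: create_vec_creates_vec linear_operator_zero[OF
          linear_operator_creates_vec])
  qed (use Suc in simp)
qed simp

text \<open>The wedge product with a vector \<open>v\<close> satisfies \<open>v \<and> v \<and> x = 0\<close>, so \<open>v \<and> x\<close> is determined by its
  coordinates at the basis vectors that contain a fixed index \<open>p\<close> with \<open>v p \<noteq> 0\<close>.\<close>

lemma creates_vec_eq_0I:
  assumes w: "has_weight w (creates_vec m v f)" and "m \<le> n"
    and p: "\<And>k. k < m \<Longrightarrow> p k < n \<and> v k (p k) \<noteq> 0"
    and 0: "\<And>A. A \<subseteq> modes n \<Longrightarrow> (\<And>k. k < m \<Longrightarrow> (k, p k) \<in> A) \<Longrightarrow> (\<And>k. k < n \<Longrightarrow> row_card k A = w k)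
        \<Longrightarrow> creates_vec m v f A = 0"
  shows "creates_vec m v f = (\<lambda>_. 0)"
proof -
  define y where "y = creates_vec m v f"
  have "y A = 0" for A
  proof (induction "card {k. k < m \<and> (k, p k) \<notin> A}" arbitrary: A rule: less_induct)
    case less
    show ?case
    proof (cases "A \<subseteq> modes n \<and> (\<forall>k<m. (k, p k) \<in> A)")
      case True
      then show ?thesis
        using 0[of A] w unfolding y_def has_weight_def by (meson)
    next
      case False
      show ?thesis
      proof (cases "A \<subseteq> modes n")
        case True
        then obtain k where k: "k < m" "(k, p k) \<notin> A"
          using False by auto
        \<comment> \<open>The coefficient at \<open>B\<close> of the wedge product of
          \<open>v k\<close> with \<open>y\<close> is zero. Apart from the term at \<open>A\<close>,
          it involves only values of \<open>y\<close> at sets that miss fewer of the pairs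
          \<open>(k, p k)\<close> than \<open>A\<close>, so \<open>y A\<close> is forced to
          vanish.\<close>
        define B where "B = insert (k, p k) A"
        have "create_vec k (v k) y B = 0"
          using create_vec_creates_vec_same[OF k(1) assms(2)] by (simp add: y_def)
        moreover have "v k j * create (k, j) y B = 0" if "j < n" "j \<noteq> p k" for j
        proof (cases "(k, j) \<in> B")
          case True
          have "{l. l < m \<and> (l, p l) \<notin> B - {(k, j)}} \<subset> {l. l < m \<and> (l, p l) \<notin> A}"
            using k that by (auto simp: B_def)
          then have "y (B - {(k, j)}) = 0"
            by (intro less psubset_card_mono) auto
          then show ?thesis
            by (simp add: create_def)
        qed (simp add: create_def)
        ultimately have "v k (p k) * create (k, p k) y B = 0"
          using p[OF k(1)] by (simp add: create_vec_def sum.remove[of "{..<n}" "p k"])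
        moreover have "B - {(k, p k)} = A"
          using k by (simp add: B_def)
        ultimately show ?thesis
          using p[OF k(1)] by (simp add: create_def B_def sgn_before_def)
      qed (use w in \<open>auto simp: has_weight_def y_def\<close>)
    qed
  qed
  then show ?thesis
    by (auto simp: y_def)
qed

end

section \<open>Counting basis vectors row by row\<close>

definition configurations :: "nat \<Rightarrow> nat \<Rightarrow> (nat \<Rightarrow> nat set set) \<Rightarrow> (nat \<times> nat) set set" where
  "configurations n m S = (\<lambda>s. Sigma {..<m} s) ` (\<Pi>\<^sub>E k\<in>{..<m}. S k)"

lemma finite_configurations: "(\<And>k. k < m \<Longrightarrow> finite (S k)) \<Longrightarrow> finite (configurations n m S)"
  by (auto simp: configurations_def intro!: finite_PiE)

lemma card_configurations: "card (configurations n m S) = (\<Prod>k<m. card (S k))"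
proof -
  have "inj_on (\<lambda>s. Sigma {..<m} s) (\<Pi>\<^sub>E k\<in>{..<m}. S k)"
  proof (rule inj_onI)
    fix s t assume st: "s \<in> (\<Pi>\<^sub>E k\<in>{..<m}. S k)" "t \<in> (\<Pi>\<^sub>E k\<in>{..<m}. S k)" "Sigma {..<m} s
        = Sigma {..<m} t"
    have "s k = t k" if "k < m" for k
      using st(3) that by auto
    then show "s = t"
      using st(1,2) by (intro PiE_ext[of s "{..<m}" S]) auto
  qed
  then show ?thesis
    by (simp add: configurations_def card_image card_PiE)
qed

lemma mem_configurationsI:
  assumes "A \<subseteq> {..<m} \<times> UNIV" "\<And>k. k < m \<Longrightarrow> {j. (k, j) \<in> A} \<in> S k"
  shows "A \<in> configurations n m S"
  unfolding configurations_def
proof (rule image_eqI)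
  show "A = Sigma {..<m} (\<lambda>k\<in>{..<m}. {j. (k, j) \<in> A})"
    using assms(1) by auto
qed (use assms in auto)

text \<open>The rank of the wedge product with a nonzero vector from degree \<open>k\<close> to
  degree \<open>k + 1\<close>: by \<open>creates_vec_eq_0I\<close> the coordinates at these sets
  determine the image.\<close>

lemma card_subsets_containing:
  assumes "p < n"
  shows "card {S. S \<subseteq> {..<n} \<and> card S = Suc k \<and> p \<in> S} = (n - 1) choose k"
proof -
  have "bij_betw (insert p) {S. S \<subseteq> {..<n} - {p} \<and> card S = k} {S. S \<subseteq> {..<n} \<and> card S = Suc k \<and> p \<in> S}"
  proof (rule bij_betw_byWitness[where f' = "\<lambda>S. S - {p}"])
    show "insert p ` {S. S \<subseteq> {..<n} - {p} \<and> card S = k} \<subseteq> {S. S \<subseteq> {..<n} \<and> card S = Suc k \<and> p \<in> S}"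
    proof safe
      fix S assume "S \<subseteq> {..<n} - {p}"
      moreover from this have "finite S"
        by (rule finite_subset) simp
      ultimately show "card (insert p S) = Suc (card S)"
        by (subst card_insert_disjoint) auto
    qed (use assms in auto)
    show "(\<lambda>S. S - {p}) ` {S. S \<subseteq> {..<n} \<and> card S = Suc k \<and> p \<in> S} \<subseteq> {S. S \<subseteq> {..<n} - {p} \<and> card S = k}"
      by auto
  qed auto
  then show ?thesis
    using assms n_subsets[of "{..<n} - {p}" k] by (simp add: bij_betw_same_card)
qed

text \<open>The absorption identity \<open>(n choose k) * (n - k) = n * ((n - 1) choose k)\<close>,
  multiplied over the rows below \<open>m\<close>.\<close>

lemma prod_choose_ratio:
  assumes "m < n"
  shows "(\<Prod>k<m. n choose k) * (\<Prod>k<m. n - k) = n ^ m * (\<Prod>k<m. (n - 1) choose k)"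
proof -
  have "(n choose k) * (n - k) = n * ((n - 1) choose k)" if "k < m" for k
  proof -
    obtain n' where "n = Suc n'"
      using that assms by (cases n) auto
    then show ?thesis
      using Suc_times_binomial_eq[of n' "n' - k"] that assms
      by (metis Suc_diff_le binomial_absorb_comp diff_Suc_1 less_Suc_eq_le mult.commute)
  qed
  then have "(\<Prod>k<m. (n choose k) * (n - k)) = (\<Prod>k<m. n * ((n - 1) choose k))"
    by (intro prod.cong) auto
  then show ?thesis
    by (simp add: prod.distrib)
qed

lemma prod_falling: "(\<Prod>k<m. Suc m - k) = fact (Suc m)"
proof -
  have "(\<Prod>k<m. Suc m - k) = (\<Prod>k<m. Suc (Suc k))"
    by (subst prod.nat_diff_reindex[symmetric]) (intro prod.cong, auto)
  also have "\<dots> = fact (Suc m)"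
    by (induction m) (simp_all add: algebra_simps)
  finally show ?thesis .
qed

context det_fock
begin

text \<open>Otherwise some \<open>x \<noteq> 0\<close> of weight \<open>k \<mapsto> k\<close> has all \<open>y i x = 0\<close>, where \<open>y i x\<close> is the image of \<open>x\<close>
  under the map induced by the \<open>i\<close>-th pure tensor. The last row is handled by contraction: removing its
  modes \<open>\<iota> 0, \<dots>, \<iota> (m - 1)\<close> from \<open>x\<close> is alternating in \<open>\<iota>\<close>, so the result is a combination of the
  values \<open>det_tensor n (\<iota>(m := q))\<close> with coefficients \<open>z x q\<close>.\<close>

lemma det_tensor_decomposition_bound:
  fixes v :: "nat \<Rightarrow> nat \<Rightarrow> nat \<Rightarrow> real"
  assumes n: "n = Suc m" and det: "det_tensor n = (\<lambda>\<iota>. \<Sum>i<r. pure_tensor n n (v i) \<iota>)"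
  shows "(\<Prod>k<n. n choose k) \<le> r * (\<Prod>k<m. (n - 1) choose k)"
proof (rule ccontr)
  define p where "p i k = (SOME j. j < n \<and> v i k j \<noteq> 0)" for i k
  \<comment> \<open>A pure tensor with a zero vector among its first \<open>m\<close> factors
    induces the zero map and imposes no condition on \<open>x\<close>.\<close>
  define R where "R = {i. i < r \<and> (\<forall>k<m. \<exists>j<n. v i k j \<noteq> 0)}"
  have p: "p i k < n \<and> v i k (p i k) \<noteq> 0" if "i \<in> R" "k < m" for i k
    unfolding p_def by (rule someI_ex) (use that in \<open>auto simp: R_def\<close>)
  \<comment> \<open>The coordinates that decide whether \<open>y i x\<close> vanishes. Only
    \<open>m\<close> rows occur because the last row ends up empty.\<close>
  define C where "C i = configurations n m (\<lambda>k. {S. S \<subseteq> {..<n} \<and> card S = Suc k \<and> p i k \<in> S})" for i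
  define I where "I = configurations n n (\<lambda>k. {S. S \<subseteq> {..<n} \<and> card S = k})"
  \<comment> \<open>Row \<open>m\<close> of \<open>x\<close> holds \<open>m\<close> vectors;
    \<open>create (m, q)\<close> fills all \<open>n\<close> columns of it, and
    \<open>annihs m n id\<close> empties it again.\<close>
  define z where "z x q = annihs m n id (create (m, q) x)" for x q
  define y where "y i x = creates_vec m (v i) (\<lambda>A. \<Sum>q<n. v i m q * z x q A)" for i x
  have mn: "m < n"
    using n by simp
  have fin: "finite (C i)" for i
    by (simp add: C_def finite_configurations)
  have "finite I"
    by (simp add: I_def finite_configurations)
  assume "\<not> (\<Prod>k<n. n choose k) \<le> r * (\<Prod>k<m. (n - 1) choose k)"
  moreover have "card (C i) = (\<Prod>k<m. (n - 1) choose k)" if "i \<in> R" for i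
    using p[OF that] unfolding C_def by (simp add: card_configurations card_subsets_containing)
  moreover have "card R \<le> r"
    using card_mono[of "{..<r}" R] by (auto simp: R_def)
  moreover have "card I = (\<Prod>k<n. n choose k)"
    by (simp add: I_def card_configurations n_subsets)
  ultimately have "card (Sigma R C) < card I"
    using fin by (simp add: card_SigmaI R_def) (meson le_less_trans linorder_not_le mult_le_mono1)
  moreover have "finite (Sigma R C)"
    using fin by (auto simp: R_def intro!: finite_SigmaI)
  \<comment> \<open>The unknowns are the coefficients of \<open>x\<close> in the basis
    \<open>I\<close>; the equations, indexed by \<open>Sigma R C\<close>, are the deciding
    coordinates of all the \<open>y i x\<close>.\<close>
  ultimately obtain c where c: "\<exists>B\<in>I. c B \<noteq> 0"
    "\<And>e. e \<in> Sigma R C \<Longrightarrow> (\<Sum>B\<in>I. c B * (case e of (i, A) \<Rightarrow> y i (\<lambda>A'. if A' = B then 1 else 0) A)) = 0"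
    using homogeneous_system_nontrivial_solution[OF _ \<open>finite I\<close>, of "Sigma R C"
        "\<lambda>e B. case e of (i, A) \<Rightarrow> y i (\<lambda>A'. if A' = B then 1 else 0) A"] by blast
  define x where "x = (\<lambda>A. \<Sum>B\<in>I. c B * (if A = B then 1 else 0))"
  have lin: "linear_operator (y i)" for i
  proof -
    have "linear_operator (\<lambda>x A. \<Sum>q<n. v i m q * z x q A)"
      unfolding z_def using linear_operator_compose[OF linear_operator_annihs linear_operator_create]
      by (intro linear_operator_lincomb) auto
    from linear_operator_compose[OF linear_operator_creates_vec this] show ?thesis
      by (simp add: y_def[abs_def])
  qed
  have x_eq: "x A = (if A \<in> I then c A else 0)" for A
    using \<open>finite I\<close> by (simp add: x_def if_distrib cong: if_cong)
  have wx: "has_weight (\<lambda>k. k) x"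
    unfolding has_weight_def row_card_def
    by (auto simp: x_eq I_def configurations_def modes_def PiE_iff subset_iff split: if_splits)
  have wz: "has_weight (\<lambda>k. if k = m then 0 else k) (z x q)" if "q < n" for q
  proof -
    have "has_weight ((\<lambda>k. k)(m := Suc m)) (create (m, q) x)"
      using has_weight_create[OF wx, of m q] that n by simp
    from has_weight_annihs[OF this, of n id m] show ?thesis
      using n by (simp add: z_def fun_upd_def if_distrib cong: if_cong)
  qed
  have wy: "has_weight (\<lambda>j. if j < m then Suc j else 0) (y i x)" for i
  proof -
    have "has_weight (\<lambda>k. if k = m then 0 else k) (\<lambda>A. \<Sum>q<n. v i m q * z x q A)"
      using wz by (intro has_weight_sum) auto
    from has_weight_creates_vec[OF this, of m "v i"]
    have "has_weight (\<lambda>j. if j < m then Suc (if j = m then 0 else j) else if j = m then 0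
        else j) (y i x)"
      using n by (simp add: y_def)
    moreover have "(if j < m then Suc (if j = m then 0 else j) else if j = m then 0 else j) =
        (if j < m then Suc j else 0)" if "j < n" for j
      using that n by auto
    ultimately show ?thesis
      unfolding has_weight_def by simp
  qed
  have y0: "y i x = (\<lambda>_. 0)" if "i < r" for i
  proof (cases "i \<in> R")
    case True
    have "y i x A = 0" if A: "A \<subseteq> modes n" "\<And>k. k < m \<Longrightarrow> (k, p i k) \<in> A"
      "\<And>k. k < n \<Longrightarrow> row_card k A = (if k < m then Suc k else 0)" for A
    proof -
      have "finite {j. (m, j) \<in> A}" "card {j. (m, j) \<in> A} = 0"
        using A(1) A(3)[of m] n finite_row by (auto simp: row_card_def)
      then have "\<forall>j. (m, j) \<notin> A"
        by auto
      then have "A \<subseteq> {..<m} \<times> UNIV"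
        using A(1) n by (force simp: modes_def less_Suc_eq)
      then have "A \<in> C i"
        unfolding C_def using A n by (intro mem_configurationsI) (auto simp: row_card_def modes_def)
      then have "(\<Sum>B\<in>I. c B * y i (\<lambda>A'. if A' = B then 1 else 0) A) = 0"
        using c(2)[of "(i, A)"] True by simp
      then show ?thesis
        unfolding x_def using linear_operator_sum[OF lin \<open>finite I\<close>] by simp
    qed
    then show ?thesis
      using creates_vec_eq_0I[OF wy[unfolded y_def], of "p i"] p[OF True] n unfolding y_def by auto
  next
    case False
    then obtain k where k: "k < m" "\<And>j. j < n \<Longrightarrow> v i k j = 0"
      using \<open>i < r\<close> by (auto simp: R_def)
    then have "(\<Prod>j<m. v i j (\<iota> j)) = 0" if "\<iota> \<in> {..<m} \<rightarrow>\<^sub>E {..<n}" for \<iota>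
      using that by (intro prod_zero) (auto intro!: bexI[of _ k])
    then show ?thesis
      unfolding y_def fun_eq_iff creates_vec_expand by (intro allI sum.neutral) (metis mult_zero_left)
  qed
  obtain \<epsilon> :: real where \<epsilon>: "\<And>f A. shifts m m f A =
      \<epsilon> * (\<Sum>\<iota>\<in>{..<m} \<rightarrow>\<^sub>E {..<n}. creates m \<iota> (annihs m m \<iota> f) A)"
  proof (rule shifts_expand[of m m])
    fix \<epsilon> :: real
    assume "\<And>f A. shifts m m f A =
      \<epsilon> * (\<Sum>\<iota>\<in>{..<m} \<rightarrow>\<^sub>E {..<n}. creates m \<iota> (annihs m m \<iota> f) A)"
    then show thesis
      by (rule that)
  qed (use n in simp_all)
  have "annihs m m \<iota> x = (\<lambda>A. \<Sum>i<r. (\<Prod>k<m. v i k (\<iota> k)) * (\<Sum>q<n. v i m q * z x q A))"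
    if \<iota>: "\<iota> \<in> {..<m} \<rightarrow>\<^sub>E {..<n}" for \<iota>
  proof
    fix A
    have Suc_eq: "annihs m k (\<iota>(m := q)) g = annihs m m \<iota> (annih (m, q) g)" if "k = Suc m" for k q g
      using annihs_cong[of m "\<iota>(m := q)" \<iota> m] by (simp add: that)
    have mi: "\<iota>(m := q) \<in> multi_indices n n" if "q < n" for q
      using that \<iota> n by (auto simp: multi_indices_def PiE_iff extensional_def less_Suc_eq)
    have "annih (m, q) (create (m, q) x) A = (if (m, q) \<in> A then 0 else x A)" if "q < n" for q A
      using that mn by (simp add: annih_create_same)
    \<comment> \<open>A set in the support of \<open>x\<close> misses exactly one column of the last
      row, so exactly one summand survives.\<close>
    then have "(\<Sum>q<n. annih (m, q) (create (m, q) x) A) = x A" for A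
    proof (cases "x A = 0")
      case False
      then have A: "A \<subseteq> modes n" "card {j. (m, j) \<in> A} = m"
        using wx mn by (auto simp: has_weight_def row_card_def)
      then have fr: "finite {j. (m, j) \<in> A}" "{j. (m, j) \<in> A} \<subseteq> {..<n}"
        using finite_row by (auto simp: modes_def)
      have "(\<Sum>q<n. annih (m, q) (create (m, q) x) A) = (\<Sum>q\<in>{..<n} - {j. (m, j) \<in> A}. x A)"
        using mn by (intro sum.mono_neutral_cong_right) (auto simp: annih_create_same)
      moreover have "card ({..<n} - {j. (m, j) \<in> A}) = 1"
        using A n fr by (simp add: card_Diff_subset)
      ultimately show ?thesis
        by simp
    qed (use mn in \<open>auto simp: annih_create_same intro!: sum.neutral\<close>)
    then have "annihs m m \<iota> x A = annihs m m \<iota> (\<lambda>A. \<Sum>q<n. annih (m, q) (create (m, q) x) A) A"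
      by simp
    also have "\<dots> = (\<Sum>q<n. annihs m m \<iota> (annih (m, q) (create (m, q) x)) A)"
      by (simp add: linear_operator_sum1[OF linear_operator_annihs])
    also have "\<dots> = (\<Sum>q<n. annihs m n (\<iota>(m := q)) (create (m, q) x) A)"
      by (simp add: Suc_eq[OF n])
    \<comment> \<open>The full contraction of the last row is alternating in its \<open>n\<close>
      columns, hence a multiple of \<open>det_tensor n\<close>; the factor is the value at
      \<open>id\<close>, which is \<open>z x q A\<close>.\<close>
    also have "\<dots> = (\<Sum>q<n. z x q A * det_tensor n (\<iota>(m := q)))"
    proof (intro sum.cong refl)
      fix q assume "q \<in> {..<n}"
      then show "annihs m n (\<iota>(m := q)) (create (m, q) x) A = z x q A * det_tensor n (\<iota>(m := q))"
        unfolding z_def using mi[of q] mn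
        by (intro alternating_eq_det_tensor[of n "\<lambda>\<iota>. annihs m n \<iota> (create (m, q) x) A"])
          (auto intro!: annihs_swap fun_cong[OF annihs_cong])
    qed
    also have "\<dots> = (\<Sum>q<n. z x q A * (\<Sum>i<r. (\<Prod>k<m. v i k (\<iota> k)) * v i m q))"
    proof (intro sum.cong refl)
      fix q assume "q \<in> {..<n}"
      then have "det_tensor n (\<iota>(m := q)) = (\<Sum>i<r. \<Prod>j<n. v i j ((\<iota>(m := q)) j))"
        using mi[of q] by (simp add: det pure_tensor_def)
      also have "\<dots> = (\<Sum>i<r. (\<Prod>k<m. v i k (\<iota> k)) * v i m q)"
        by (simp add: n)
      finally show "z x q A * det_tensor n (\<iota>(m := q)) = z x q A * (\<Sum>i<r. (\<Prod>k<m. v i k (\<iota> k)) * v i m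
          q)"
        by simp
    qed
    also have "\<dots> = (\<Sum>i<r. (\<Prod>k<m. v i k (\<iota> k)) * (\<Sum>q<n. v i m q * z x q A))"
      by (simp add: sum_distrib_left sum.swap[of _ "{..<n}"] mult_ac)
    finally show "annihs m m \<iota> x A = (\<Sum>i<r. (\<Prod>k<m. v i k (\<iota> k)) * (\<Sum>q<n. v i m q * z x q A))" .
  qed
  \<comment> \<open>Summed over \<open>\<iota>\<close>, the coordinate products in the decomposition
    reassemble to \<open>creates_vec\<close>, so each pure tensor contributes exactly
    \<open>y i x\<close>.\<close>
  then have "(\<Sum>\<iota>\<in>{..<m} \<rightarrow>\<^sub>E {..<n}. creates m \<iota> (annihs m m \<iota> x) A) = (\<Sum>i<r. y i x A)" for A
    by (simp add: linear_operator_sum[OF linear_operator_creates] y_def creates_vec_expand sum.swap[of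
        _ "{..<r}"])
  then have "shifts m m x = (\<lambda>_. 0)"
    by (simp add: \<epsilon> y0 fun_eq_iff)
  then have "x = (\<lambda>_. 0)"
    using shifts_injective[OF wx, of m m] n by simp
  then show False
    using c(1) x_eq by metis
qed

end

theorem det_tensor_rank_lower_bound:
  assumes "n \<ge> 1"
  shows "real (tensor_rank n n (det_tensor n :: _ \<Rightarrow> real)) \<ge> real n ^ (n - 1) / fact (n - 1)"
proof -
  obtain m where n: "n = Suc m"
    using assms by (cases n) auto
  define r where "r = tensor_rank n n (det_tensor n :: _ \<Rightarrow> real)"
  obtain v :: "nat \<Rightarrow> nat \<Rightarrow> nat \<Rightarrow> real" where "det_tensor n = (\<lambda>\<iota>. \<Sum>i<r. pure_tensor n n (v i) \<iota>)"
    using tensor_rank_attained[OF det_tensor_in_tensor_power assms] unfolding r_def by metis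
  then have le: "(\<Prod>k<n. n choose k) \<le> r * (\<Prod>k<m. (n - 1) choose k)"
    by (rule det_fock.det_tensor_decomposition_bound[OF n])
  have pos: "(\<Prod>k<m. (n - 1) choose k) > 0"
    using n by (intro prod_pos) auto
  have "n ^ n * (\<Prod>k<m. (n - 1) choose k) = n * ((\<Prod>k<m. n choose k) * (\<Prod>k<m. n - k))"
    using prod_choose_ratio[of m n] n by (simp add: algebra_simps)
  \<comment> \<open>The separate factor \<open>n\<close> is the last binomial coefficient
    \<open>n choose m\<close>.\<close>
  also have "\<dots> = (\<Prod>k<n. n choose k) * fact n"
    using prod_falling[of m] n by (simp add: algebra_simps)
  also have "\<dots> \<le> r * (\<Prod>k<m. (n - 1) choose k) * fact n"
    using le by (rule mult_le_mono1)
  finally have "n ^ n \<le> r * fact n"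
    using pos by (simp add: mult.assoc mult.commute[of _ "fact n"] flip: mult.assoc[of r])
  then have "real n ^ n \<le> real r * fact n"
    by (metis of_nat_fact of_nat_le_iff of_nat_mult of_nat_power)
  then have "real n * real n ^ m \<le> real n * (real r * fact m)"
    by (simp add: n algebra_simps)
  then have "real n ^ m \<le> real r * fact m"
    using n by (simp del: of_nat_Suc)
  then show ?thesis
    by (simp add: r_def n divide_le_eq)
qed

section \<open>Cocycles and cycles\<close>

definition rat_chain :: "('a \<Rightarrow>\<^sub>0 int) \<Rightarrow> 'a \<Rightarrow>\<^sub>0 rat" where
  "rat_chain = Poly_Mapping.map of_int"

definition rat_scale :: "rat \<Rightarrow> ('a \<Rightarrow>\<^sub>0 rat) \<Rightarrow> 'a \<Rightarrow>\<^sub>0 rat" where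
  "rat_scale q = Poly_Mapping.map ((*) q)"

lemma lookup_rat_chain: "Poly_Mapping.lookup (rat_chain z) i = of_int (Poly_Mapping.lookup z i)"
  by (simp add: rat_chain_def Poly_Mapping.map.rep_eq when_def)

lemma lookup_rat_scale: "Poly_Mapping.lookup (rat_scale q z) i = q * Poly_Mapping.lookup z i"
  by (simp add: rat_scale_def Poly_Mapping.map.rep_eq when_def)

lemma rat_chain_diff: "rat_chain (a - b) = rat_chain a - rat_chain b"
  by (rule poly_mapping_eqI) (simp add: lookup_rat_chain lookup_minus)

lemma rat_chain_cmul: "rat_chain (frag_cmul m a) = rat_scale (of_int m) (rat_chain a)"
  by (rule poly_mapping_eqI) (simp add: lookup_rat_chain lookup_rat_scale)

lemma rat_chain_0: "rat_chain 0 = 0"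
  by (rule poly_mapping_eqI) (simp add: lookup_rat_chain)

lemma rat_chain_add: "rat_chain (a + b) = rat_chain a + rat_chain b"
  by (rule poly_mapping_eqI) (simp add: lookup_rat_chain lookup_add)

lemma rat_chain_sum: "rat_chain (sum f I) = (\<Sum>i\<in>I. rat_chain (f i))"
  by (induction I rule: infinite_finite_induct) (simp_all add: rat_chain_0 rat_chain_add)

lemma rat_chain_eq_0: "rat_chain a = 0 \<longleftrightarrow> a = 0"
  by (metis lookup_rat_chain lookup_zero of_int_0_eq_iff poly_mapping_eqI rat_chain_0)

text \<open>Rational chains on one side, the reals as a rational vector space on the other: linear
  maps between them extend from independent sets, while the integral boundaries generate the
  subspace to start from.\<close>

interpretation rat_chain_space: vector_space_pair
  "rat_scale :: rat \<Rightarrow> ('a \<Rightarrow>\<^sub>0 rat) \<Rightarrow> _" "\<lambda>q (r::real). of_rat q * r"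
  by unfold_locales
    (auto intro!: poly_mapping_eqI
      simp: lookup_rat_scale lookup_add distrib_left distrib_right of_rat_mult of_rat_add)

lemma common_denominator:
  fixes q :: "'b \<Rightarrow> rat"
  assumes "finite T"
  shows "\<exists>N::int. N \<noteq> 0 \<and> (\<forall>b\<in>T. \<exists>m::int. of_int N * q b = of_int m)"
  using assms
proof (induction T rule: finite_induct)
  case empty
  then show ?case
    by (intro exI[of _ 1]) auto
next
  case (insert b T)
  then obtain N :: int where N: "N \<noteq> 0" "\<forall>b\<in>T. \<exists>m::int. of_int N * q b = of_int m"
    by auto
  obtain a d :: int where d: "d \<noteq> 0" "of_int d * q b = of_int a"
  proof (cases "q b")
    case (Fract a d)
    then show ?thesis
      using that[of d a] by (simp add: Fract_of_int_quotient)
  qed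
  have "\<exists>m::int. of_int (N * d) * q c = of_int m" if "c \<in> insert b T" for c
  proof (cases "c = b")
    case True
    then show ?thesis
      using d(2) by (intro exI[of _ "N * a"]) (simp add: mult.assoc)
  next
    case False
    then have "c \<in> T"
      using that by simp
    then obtain m :: int where "of_int N * q c = of_int m"
      using N(2) by metis
    then show ?thesis
      by (intro exI[of _ "d * m"]) (simp add: mult_ac)
  qed
  then show ?case
    using N(1) d(1) by (intro exI[of _ "N * d"]) auto
qed

lemma chain_eval_diff: "chain_eval c (y - z) = chain_eval c y - chain_eval c z"
  using chain_eval_add[of c "y - z" z] by simp

text \<open>This is where divisibility of the coefficients enters: a homomorphism from the group of
  boundaries to \<open>\<real>\<close> extends to all chains, by \<open>\<rat>\<close>-linear extension.\<close>

lemma cochain_through_boundary: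
  fixes F :: "('a, real) cochain"
  assumes F: "\<And>z. singular_chain p X z \<Longrightarrow> chain_boundary p z = 0 \<Longrightarrow> chain_eval F z = 0"
  shows "\<exists>G. \<forall>\<tau>. singular_simplex p X \<tau> \<longrightarrow> F \<tau> = chain_eval G (chain_boundary p (frag_of \<tau>))"
proof -
  define dv where "dv \<tau> = rat_chain (chain_boundary p (frag_of \<tau>))" for \<tau> :: "(nat \<Rightarrow> real) \<Rightarrow> 'a"
  obtain B where B: "B \<subseteq> dv ` singular_simplex_set p X" "rat_chain_space.vs1.independent B"
    "dv ` singular_simplex_set p X \<subseteq> rat_chain_space.vs1.span B"
    by (rule rat_chain_space.vs1.maximal_independent_subset)
  have "\<forall>b\<in>B. \<exists>\<tau>. singular_simplex p X \<tau> \<and> dv \<tau> = b"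
    using B(1) by auto
  then obtain pre where pre: "\<And>b. b \<in> B \<Longrightarrow> singular_simplex p X (pre b) \<and> dv (pre b) = b"
    by metis
  \<comment> \<open>The values on a basis of boundaries may be prescribed freely; that they fit all
    other boundaries is where the vanishing of \<open>F\<close> on cycles enters.\<close>
  obtain g where g: "Vector_Spaces.linear rat_scale (\<lambda>q (r::real). of_rat q * r) g"
    "\<And>b. b \<in> B \<Longrightarrow> g b = F (pre b)"
    using rat_chain_space.linear_independent_extend[OF B(2), of "\<lambda>b. F (pre b)"] by blast
  interpret g: Vector_Spaces.linear rat_scale "\<lambda>q (r::real). of_rat q * r" g
    by (rule g(1))
  define G where "G j = g (rat_chain (frag_of j))" for j
  have gG: "g (rat_chain c) = chain_eval G c" for c
    using subset_UNIV
  proof (induction c rule: frag_induction)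
    case (diff a b)
    then show ?case
      by (simp add: rat_chain_diff g.diff chain_eval_diff)
  qed (simp_all add: rat_chain_0 g.zero G_def chain_eval_of)
  have "F \<tau> = chain_eval G (chain_boundary p (frag_of \<tau>))" if \<tau>: "singular_simplex p X \<tau>" for \<tau>
  proof -
    have "dv \<tau> \<in> rat_chain_space.vs1.span B"
      using B(3) \<tau> by auto
    then obtain T q where T: "finite T" "T \<subseteq> B" "dv \<tau> = (\<Sum>b\<in>T. rat_scale (q b) b)"
      unfolding rat_chain_space.vs1.span_explicit by auto
    obtain N :: int where N: "N \<noteq> 0" "\<forall>b\<in>T. \<exists>m::int. of_int N * q b = of_int m"
      using common_denominator[OF T(1)] by blast
    then obtain m :: "_ \<Rightarrow> int" where m: "\<And>b. b \<in> T \<Longrightarrow> of_int N * q b = of_int (m b)"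
      by metis
    \<comment> \<open>Clearing denominators turns the rational relation between the boundary of
      \<open>\<tau>\<close> and the basis boundaries into an integral cycle, on which
      \<open>F\<close> vanishes.\<close>
    define z where "z = frag_cmul N (frag_of \<tau>) - (\<Sum>b\<in>T. frag_cmul (m b) (frag_of (pre b)))"
    have "singular_chain p X z"
      unfolding z_def using \<tau> pre T(2)
      by (intro singular_chain_diff singular_chain_cmul singular_chain_sum)
          (auto simp: singular_chain_of)
    moreover have "rat_chain (chain_boundary p z) = 0"
    proof -
      have "rat_chain (chain_boundary p z) = rat_scale (of_int N) (dv \<tau>) - (\<Sum>b\<in>T. rat_scale (of_int (m
          b)) (dv (pre b)))"
        by (simp add: z_def chain_boundary_diff chain_boundary_cmul chain_boundary_sum rat_chain_diff
            rat_chain_cmul rat_chain_sum dv_def)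
      also have "(\<Sum>b\<in>T. rat_scale (of_int (m b)) (dv (pre b))) = (\<Sum>b\<in>T. rat_scale (of_int N)
          (rat_scale (q b) b))"
        using pre T(2) by (intro sum.cong) (auto simp flip: m)
      also have "\<dots> = rat_scale (of_int N) (dv \<tau>)"
        unfolding T(3) by (simp add: rat_chain_space.vs1.scale_sum_right)
      finally show ?thesis
        by simp
    qed
    ultimately have "chain_eval F z = 0"
      by (intro F) (simp_all add: rat_chain_eq_0)
    moreover have "chain_eval F z + chain_eval F (\<Sum>b\<in>T. frag_cmul (m b) (frag_of (pre b))) =
        chain_eval F (frag_cmul N (frag_of \<tau>))"
      unfolding z_def chain_eval_add[symmetric] by simp
    ultimately have "of_int N * F \<tau> = (\<Sum>b\<in>T. of_int (m b) * F (pre b))"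
      by (simp add: chain_eval_sum chain_eval_cmul chain_eval_of)
    also have "\<dots> = (\<Sum>b\<in>T. of_int N * (of_rat (q b) * F (pre b)))"
    proof (intro sum.cong refl)
      fix b assume "b \<in> T"
      then have "real_of_rat (of_int N * q b) = of_int (m b)"
        by (simp add: m)
      then show "of_int (m b) * F (pre b) = of_int N * (of_rat (q b) * F (pre b))"
        by (simp add: of_rat_mult flip: mult.assoc)
    qed
    also have "\<dots> = of_int N * g (dv \<tau>)"
      unfolding T(3) using T(2) by (simp add: g.sum g.scale sum_distrib_left subset_iff g(2))
    finally show ?thesis
      using N(1) gG by (simp add: dv_def)
  qed
  then show ?thesis
    by blast
qed

text \<open>Injectivity of the map from real cohomology to homomorphisms on integral homology: a
  cocycle that vanishes on all cycles factors through the boundary map, and the factor is a cochain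
  whose coboundary it is.\<close>

lemma non_coboundary_detected_by_cycle:
  fixes F :: "('a, real) cochain"
  assumes F: "F \<in> singular_cocycles p X" "F \<notin> singular_coboundaries p X" and p: "p \<ge> 1"
  obtains z where "singular_chain p X z" "chain_boundary p z = 0" "chain_eval F z \<noteq> 0"
proof (rule ccontr)
  assume "\<not> thesis"
  then have "\<And>z. singular_chain p X z \<Longrightarrow> chain_boundary p z = 0 \<Longrightarrow> chain_eval F z = 0"
    using that by blast
  then obtain G where G: "\<And>\<tau>. singular_simplex p X \<tau> \<Longrightarrow> F \<tau> = chain_eval G (chain_boundary p (frag_of
      \<tau>))"
    using cochain_through_boundary[of p X F] by blast
  obtain q where q: "p = Suc q"
    using p by (cases p) auto
  define G' where "G' \<sigma> = (if singular_simplex q X \<sigma> then G \<sigma> else 0)" for \<sigma>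
  have "F \<tau> = cochain_coboundary q X G' \<tau>" for \<tau>
  proof (cases "singular_simplex p X \<tau>")
    case True
    then have "singular_chain q X (chain_boundary p (frag_of \<tau>))"
      unfolding q by (intro singular_chain_boundary_alt) (simp add: singular_chain_of)
    then have "chain_eval G' (chain_boundary p (frag_of \<tau>)) = chain_eval G (chain_boundary p (frag_of
        \<tau>))"
      unfolding chain_eval_def by (intro sum.cong) (auto simp: G'_def singular_chain_def)
    then show ?thesis
      using G[OF True] True chain_eval_coboundary_of[of q X \<tau> G'] q by simp
  next
    case False
    then show ?thesis
      using F(1) q by (simp add: singular_cocycles_def singular_cochain_def cochain_coboundary_def)
  qed
  then have "F = cochain_coboundary q X G'"
    by blast
  moreover have "singular_cochain q X G'"
    by (simp add: singular_cochain_def G'_def)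
  ultimately show False
    using F(2) by (simp add: q singular_coboundaries_def)
qed

section \<open>Graded commutativity of the cup product\<close>

definition subsimplex :: "nat \<Rightarrow> (nat \<Rightarrow> nat) \<Rightarrow> ((nat \<Rightarrow> real) \<Rightarrow> 'a) \<Rightarrow> (nat \<Rightarrow> real) \<Rightarrow> 'a" where
  "subsimplex q e \<sigma> = restrict (\<sigma> \<circ> vertex_map q e) (standard_simplex q)"

lemma vertex_map_in_standard_simplex:
  assumes "x \<in> standard_simplex q" "\<And>i. i \<le> q \<Longrightarrow> e i \<le> p"
  shows "vertex_map q e x \<in> standard_simplex p"
proof -
  have x: "\<And>i. 0 \<le> x i" "(\<Sum>i\<le>q. x i) = 1"
    using assms(1) by (auto simp: standard_simplex_def)
  have le: "vertex_map q e x j \<le> 1" for j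
    unfolding vertex_map_def x(2)[symmetric] using x(1) by (intro sum_mono2) auto
  have "vertex_map q e x j = 0" if "j > p" for j
    unfolding vertex_map_def using assms(2) that by (intro sum.neutral) fastforce
  moreover have "(\<Sum>j\<le>p. vertex_map q e x j) = (\<Sum>i\<le>q. x i)"
    unfolding vertex_map_def using assms(2) sum.group[of "{..q}" "{..p}" e x] by
        (simp add: image_subset_iff)
  ultimately show ?thesis
    using x le by (auto simp: standard_simplex_def vertex_map_def sum_nonneg)
qed

lemma vertex_map_vertex_map:
  assumes "\<And>i. i \<le> q \<Longrightarrow> f i \<le> p"
  shows "vertex_map p e (vertex_map q f x) = vertex_map q (e \<circ> f) x"
proof
  fix j
  have "vertex_map p e (vertex_map q f x) j = (\<Sum>k | k \<le> p \<and> e k = j. \<Sum>i | i \<in> {i. i \<le> q \<and> e (f i) = j}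
      \<and> f i = k. x i)"
    unfolding vertex_map_def by (intro sum.cong refl) (auto intro!: sum.cong)
  also have "\<dots> = (\<Sum>i\<in>{i. i \<le> q \<and> e (f i) = j}. x i)"
    using assms by (intro sum.group) auto
  finally show "vertex_map p e (vertex_map q f x) j = vertex_map q (e \<circ> f) x j"
    by (simp add: vertex_map_def)
qed

lemma vertex_map_cong: "(\<And>i. i \<le> q \<Longrightarrow> e i = f i) \<Longrightarrow> vertex_map q e = vertex_map q f"
  unfolding vertex_map_def by (intro ext sum.cong) auto

lemma vertex_map_inj:
  assumes "inj_on e {..q}" "i \<le> q"
  shows "vertex_map q e x (e i) = x i"
proof -
  have "{k. k \<le> q \<and> e k = e i} = {i}"
    using assms by (auto simp: inj_on_def)
  then show ?thesis
    by (simp add: vertex_map_def)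
qed

lemma vertex_map_not_image: "j \<notin> e ` {..q} \<Longrightarrow> vertex_map q e x j = 0"
  unfolding vertex_map_def by (intro sum.neutral) auto

lemma vertex_map_id: "x \<in> standard_simplex q \<Longrightarrow> vertex_map q id x = x"
proof
  fix j
  assume x: "x \<in> standard_simplex q"
  show "vertex_map q id x j = x j"
  proof (cases "j \<le> q")
    case True
    then show ?thesis
      using vertex_map_inj[of id q j x] by simp
  next
    case False
    then show ?thesis
      using x vertex_map_not_image[of j id q x] by (auto simp: standard_simplex_def)
  qed
qed

lemma continuous_map_vertex_map:
  assumes "\<And>i. i \<le> q \<Longrightarrow> e i \<le> p"
  shows "continuous_map (subtopology (powertop_real UNIV) (standard_simplex q))
    (subtopology (powertop_real UNIV) (standard_simplex p)) (vertex_map q e)"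
proof -
  have "continuous_map (powertop_real UNIV) euclideanreal (\<lambda>x. vertex_map q e x j)" for j
    unfolding vertex_map_def by (intro continuous_map_sum continuous_map_product_projection) auto
  then show ?thesis
    using vertex_map_in_standard_simplex[OF _ assms]
    by (auto simp: continuous_map_in_subtopology continuous_map_componentwise intro:
        continuous_map_from_subtopology)
qed

lemma singular_simplex_subsimplex:
  assumes "singular_simplex p X \<sigma>" "\<And>i. i \<le> q \<Longrightarrow> e i \<le> p"
  shows "singular_simplex q X (subsimplex q e \<sigma>)"
proof -
  have "continuous_map (subtopology (powertop_real UNIV) (standard_simplex q))
      (subtopology (powertop_real UNIV) (standard_simplex p)) (vertex_map q e)"
    by (rule continuous_map_vertex_map) (rule assms(2))
  moreover have "continuous_map (subtopology (powertop_real UNIV) (standard_simplex p)) X \<sigma>"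
    using assms(1) by (simp add: singular_simplex_def)
  ultimately have "continuous_map (subtopology (powertop_real UNIV) (standard_simplex q)) X (\<sigma> \<circ>
      vertex_map q e)"
    by (rule continuous_map_compose)
  then show ?thesis
    by (simp add: singular_simplex_def subsimplex_def)
qed

text \<open>Single faces, front faces, back faces and reorderings of vertices all have this form, so
  their compositions reduce to compositions of index maps.\<close>

lemma subsimplex_subsimplex:
  assumes "\<And>i. i \<le> q \<Longrightarrow> f i \<le> p"
  shows "subsimplex q f (subsimplex p e \<sigma>) = subsimplex q (e \<circ> f) \<sigma>"
proof -
  have "vertex_map q f x \<in> standard_simplex p" if "x \<in> standard_simplex q" for x
    using vertex_map_in_standard_simplex[OF that] assms by blast
  moreover have "vertex_map p e (vertex_map q f x) = vertex_map q (e \<circ> f) x" for x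
    by (rule vertex_map_vertex_map) (rule assms)
  ultimately show ?thesis
    unfolding subsimplex_def by (intro restrict_ext) simp
qed

lemma subsimplex_cong: "(\<And>i. i \<le> q \<Longrightarrow> e i = f i) \<Longrightarrow> subsimplex q e \<sigma> = subsimplex q f \<sigma>"
  using vertex_map_cong[of q e f] by (simp add: subsimplex_def)

lemma front_face_eq: "front_face p \<sigma> = subsimplex p id \<sigma>"
  by (auto simp: front_face_def subsimplex_def vertex_map_id intro!: restrict_ext)

lemma back_face_eq: "back_face p q \<sigma> = subsimplex q ((+) p) \<sigma>"
proof -
  have "vertex_map q ((+) p) x = (\<lambda>i. if i < p then 0 else x (i - p))" if "x \<in> standard_simplex q" for x
  proof
    fix j
    show "vertex_map q ((+) p) x j = (if j < p then 0 else x (j - p))"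
    proof (cases "p \<le> j \<and> j \<le> p + q")
      case True
      then have "j - p \<le> q"
        by auto
      then show ?thesis
        using True vertex_map_inj[of "(+) p" q "j - p" x] by simp
    next
      case False
      then have "j \<notin> (+) p ` {..q}"
        by auto
      then show ?thesis
        using that False vertex_map_not_image[of j "(+) p" q x] by (auto simp: standard_simplex_def)
    qed
  qed
  then show ?thesis
    by (auto simp: back_face_def subsimplex_def intro!: restrict_ext)
qed

definition skip :: "nat \<Rightarrow> nat \<Rightarrow> nat" where
  "skip k i = (if i < k then i else Suc i)"

lemma simplical_face_eq_vertex_map:
  assumes "x \<in> standard_simplex q"
  shows "simplical_face k x = vertex_map q (skip k) x"
proof
  fix j
  have inj: "inj_on (skip k) {..q}"
    by (auto simp: inj_on_def skip_def split: if_splits)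
  consider "j \<in> skip k ` {..q}" | "j \<notin> skip k ` {..q}"
    by blast
  then show "simplical_face k x j = vertex_map q (skip k) x j"
  proof cases
    case 1
    then obtain i where "i \<le> q" "j = skip k i"
      by auto
    then show ?thesis
      using vertex_map_inj[OF inj, of i x] by (simp add: simplical_face_def skip_def)
  next
    case 2
    have "j = k \<or> q < (if j < k then j else j - 1)"
    proof (rule ccontr)
      assume *: "\<not> (j = k \<or> q < (if j < k then j else j - 1))"
      then have "j = skip k (if j < k then j else j - 1)"
        by (auto simp: skip_def)
      with * 2 show False
        by (metis atMost_iff imageI not_le)
    qed
    then have "simplical_face k x j = 0"
      using assms by (auto simp: simplical_face_def standard_simplex_def split: if_splits)
    then show ?thesis
      using vertex_map_not_image[OF 2] by simp
  qed
qed

lemma singular_face_eq: "singular_face (Suc q) k \<sigma> = subsimplex q (skip k) \<sigma>"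
  by (auto simp: singular_face_def subsimplex_def simplical_face_eq_vertex_map intro!: restrict_ext)

definition vertex_enum :: "nat set \<Rightarrow> nat \<Rightarrow> nat" where
  "vertex_enum S i = sorted_list_of_set S ! i"

lemma vertex_enum_image:
  assumes "strict_mono_on {..q} e" "i \<le> q"
  shows "vertex_enum (e ` {..q}) i = e i"
proof -
  have "sorted_list_of_set (e ` {..q}) = map e [0..<Suc q]"
  proof (rule sorted_list_of_set_unique[THEN iffD1])
    show "finite (e ` {..q})"
      by simp
    have "sorted_wrt (<) (map e [0..<Suc q])"
      unfolding sorted_wrt_map using assms(1)
      by (auto simp: strict_mono_on_def sorted_wrt_iff_nth_less simp del: upt_Suc)
    then show "sorted_wrt (<) (map e [0..<Suc q]) \<and> set (map e [0..<Suc q]) = e ` {..q} \<and>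
        length (map e [0..<Suc q]) = card (e ` {..q})"
      using strict_mono_on_imp_inj_on[OF assms(1)] by
          (auto simp: card_image atLeast0LessThan lessThan_Suc_atMost simp del: upt_Suc)
  qed
  then show ?thesis
    using assms(2) by (simp add: vertex_enum_def nth_append del: upt_Suc)
qed

text \<open>Names faces by their vertex sets, so that the cup-one identity becomes a statement about
  a function of finite sets.\<close>

definition on_faces :: "('a, 'k) cochain \<Rightarrow> nat \<Rightarrow> ((nat \<Rightarrow> real) \<Rightarrow> 'a) \<Rightarrow> nat set \<Rightarrow> 'k" where
  "on_faces f q \<sigma> S = f (subsimplex q (vertex_enum S) \<sigma>)"

lemma on_faces_image:
  "strict_mono_on {..q} e \<Longrightarrow> on_faces f q \<sigma> (e ` {..q}) = f (subsimplex q e \<sigma>)"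
  unfolding on_faces_def by (intro arg_cong[where f = f] subsimplex_cong vertex_enum_image)

text \<open>The cocycle condition on the face of dimension \<open>q + 1\<close> spanned by
  \<open>e\<close>; its facets omit one vertex \<open>e k\<close> each.\<close>

lemma on_faces_cocycle:
  fixes f :: "('a, 'k::comm_ring_1) cochain"
  assumes f: "f \<in> singular_cocycles q X" and \<sigma>: "singular_simplex p X \<sigma>"
    and e: "strict_mono_on {..Suc q} e" "\<And>i. i \<le> Suc q \<Longrightarrow> e i \<le> p"
  shows "(\<Sum>k\<le>Suc q. (-1) ^ k * on_faces f q \<sigma> (e ` {..Suc q} - {e k})) = 0"
proof -
  have *: "on_faces f q \<sigma> (e ` {..Suc q} - {e k}) = f (singular_face (Suc q) k (subsimplex (Suc q) e
      \<sigma>))"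
    if "k \<le> Suc q" for k
  proof -
    have le: "skip k i \<le> Suc q" if "i \<le> q" for i
      using that by (simp add: skip_def)
    have mono: "strict_mono_on {..q} (e \<circ> skip k)"
      using e(1) by (auto simp: strict_mono_on_def skip_def)
    have "skip k ` {..q} = {..Suc q} - {k}"
    proof (intro equalityI subsetI)
      fix j assume "j \<in> {..Suc q} - {k}"
      then show "j \<in> skip k ` {..q}"
        using \<open>k \<le> Suc q\<close> by (intro image_eqI[of _ _ "if j < k then j else j - 1"])
            (auto simp: skip_def)
    qed (auto simp: skip_def split: if_splits)
    then have "(e \<circ> skip k) ` {..q} = e ` ({..Suc q} - {k})"
      by (metis image_comp)
    also have "\<dots> = e ` {..Suc q} - {e k}"
      using inj_on_image_set_diff[OF strict_mono_on_imp_inj_on[OF e(1)], of "{..Suc q}" "{k}"] \<open>k \<le>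
          Suc q\<close>
      by auto
    finally have "(e \<circ> skip k) ` {..q} = e ` {..Suc q} - {e k}" .
    then have "on_faces f q \<sigma> (e ` {..Suc q} - {e k}) = f (subsimplex q (e \<circ> skip k) \<sigma>)"
      using on_faces_image[OF mono, of f \<sigma>] by metis
    then show ?thesis
      using le by (simp add: singular_face_eq subsimplex_subsimplex)
  qed
  have "cochain_coboundary q X f (subsimplex (Suc q) e \<sigma>) = 0"
    using f by (simp add: singular_cocycles_def)
  then show ?thesis
    using singular_simplex_subsimplex[OF \<sigma> e(2)] *
    by (simp add: cochain_coboundary_def del: sum.atMost_Suc cong: sum.cong_simp)
qed

text \<open>The alternating sum below is the coboundary of the cup-one square of a cochain \<open>c\<close> of odd
  degree \<open>d\<close> on the simplex with vertices \<open>0, \<dots>, 2d\<close>; deleting the vertex \<open>k\<close> gives \<open>H k\<close>. If \<open>c\<close>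
  is a cocycle, the sum telescopes to \<open>-2 (c \<smile> c)\<close>.\<close>

lemma cup_one_square_identity:
  fixes c :: "nat set \<Rightarrow> real"
  assumes d: "odd d"
    and X: "\<And>j. j \<le> d \<Longrightarrow>
      (\<Sum>k\<le>j. (-1) ^ k * c ({..j} \<union> {j + d..2 * d} - {k})) +
      (\<Sum>k\<in>{j + d..2 * d}. (-1) ^ k * c ({..j} \<union> {j + d..2 * d} - {k})) = 0"
    and Y: "\<And>i. i < d \<Longrightarrow> (\<Sum>k\<in>{i..Suc (i + d)}. (-1) ^ k * c ({i..Suc (i + d)} - {k})) = 0"
    and H: "\<And>k. k \<le> 2 * d \<Longrightarrow> H k = (\<Sum>i<d.
        if k \<le> i then c ({..Suc i} \<union> {Suc i + d..2 * d} - {k}) * c {Suc i..Suc (i + d)}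
        else if k \<le> i + d then c ({..i} \<union> {Suc (i + d)..2 * d}) * c ({i..Suc (i + d)} - {k})
        else c ({..i} \<union> {i + d..2 * d} - {k}) * c {i..i + d})"
  shows "(\<Sum>k\<le>2 * d. (-1) ^ k * H k) = - 2 * (c {..d} * c {d..2 * d})"
proof -
  \<comment> \<open>For fixed \<open>i\<close> the deleted vertex lies before, inside or after a
    block of consecutive vertices, which gives the partial sums \<open>P\<close>, \<open>R\<close>
    and \<open>Q\<close>. By the cocycle conditions \<open>X\<close> and \<open>Y\<close> these
    reduce to the few omitted terms: values \<open>W\<close> at complements of \<open>d\<close>
    consecutive vertices, and values \<open>y\<close> at \<open>d + 1\<close> consecutive
    ones.\<close>
  define y where "y j = c {j..j + d}" for j
  define W where "W j = c ({..<j} \<union> {j + d..2 * d})" for j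
  define P where "P j = (\<Sum>k<j. (-1) ^ k * c ({..j} \<union> {j + d..2 * d} - {k}))" for j
  define Q where "Q j = (\<Sum>k\<in>{j + d<..2 * d}. (-1) ^ k * c ({..j} \<union> {j + d..2 * d} - {k}))" for j
  define R where "R i = (\<Sum>k\<in>{i<..i + d}. (-1) ^ k * c ({i..Suc (i + d)} - {k}))" for i
  have PQ: "P j + Q j = (-1) ^ j * (W (Suc j) - W j)" if j: "j \<le> d" for j
  proof -
    have "(\<Sum>k\<le>j. (-1) ^ k * c ({..j} \<union> {j + d..2 * d} - {k})) = P j + (-1) ^ j * c ({..j} \<union> {j
        + d..2 * d} - {j})"
      unfolding P_def lessThan_Suc_atMost[symmetric] by simp
    moreover have "{..j} \<union> {j + d..2 * d} - {j} = {..<j} \<union> {j + d..2 * d}"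
      using d by (auto elim: oddE)
    moreover have "{j + d..2 * d} = insert (j + d) {j + d<..2 * d}"
      using j by auto
    then have "(\<Sum>k\<in>{j + d..2 * d}. (-1) ^ k * c ({..j} \<union> {j + d..2 * d} - {k})) =
        (-1) ^ (j + d) * c ({..j} \<union> {j + d..2 * d} - {j + d}) + Q j"
      unfolding Q_def by (subst sum.insert[symmetric]) auto
    moreover have "{..j} \<union> {j + d..2 * d} - {j + d} = {..<Suc j} \<union> {Suc j + d..2 * d}"
      using d by (auto elim: oddE)
    ultimately show ?thesis
      using X[OF j] d by (simp add: W_def power_add algebra_simps)
  qed
  have R: "R i = - ((-1) ^ i * (y (Suc i) + y i))" if i: "i < d" for i
  proof -
    have "{i..Suc (i + d)} = insert i (insert (Suc (i + d)) {i<..i + d})"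
      by auto
    then have "(\<Sum>k\<in>{i..Suc (i + d)}. (-1) ^ k * c ({i..Suc (i + d)} - {k})) =
       (-1) ^ i * c ({i..Suc (i + d)} - {i}) + ((-1) ^ Suc (i + d) * c ({i..Suc (i + d)} - {Suc (i
           + d)}) + R i)"
      unfolding R_def by (subst sum.insert[symmetric] | simp)+
    moreover have "{i..Suc (i + d)} - {i} = {Suc i..Suc i + d}" "{i..Suc (i + d)} - {Suc (i + d)}
        = {i..i + d}"
      by auto
    ultimately show ?thesis
      using Y[OF i] d by (simp add: y_def power_add algebra_simps)
  qed
  have "(\<Sum>k\<le>2 * d. (-1) ^ k * H k) = (\<Sum>k\<le>2 * d. \<Sum>i<d. (-1) ^ k *
      (if k \<le> i then c ({..Suc i} \<union> {Suc i + d..2 * d} - {k}) * c {Suc i..Suc (i + d)}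
        else if k \<le> i + d then c ({..i} \<union> {Suc (i + d)..2 * d}) * c ({i..Suc (i + d)} - {k})
        else c ({..i} \<union> {i + d..2 * d} - {k}) * c {i..i + d}))"
    by (intro sum.cong refl) (simp only: H sum_distrib_left atMost_iff)
  also have "\<dots> = (\<Sum>i<d. \<Sum>k\<le>2 * d. (-1) ^ k *
      (if k \<le> i then c ({..Suc i} \<union> {Suc i + d..2 * d} - {k}) * c {Suc i..Suc (i + d)}
        else if k \<le> i + d then c ({..i} \<union> {Suc (i + d)..2 * d}) * c ({i..Suc (i + d)} - {k})
        else c ({..i} \<union> {i + d..2 * d} - {k}) * c {i..i + d}))"
    by (rule sum.swap)
  also have "\<dots> = (\<Sum>i<d. P (Suc i) * y (Suc i) + W (Suc i) * R i + Q i * y i)"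
  proof (intro sum.cong refl)
    fix i assume "i \<in> {..<d}"
    then have eq: "{..2 * d} = {..<Suc i} \<union> ({i<..i + d} \<union> {i + d<..2 * d})"
      by auto
    let ?t = "\<lambda>k. (-1) ^ k *
      (if k \<le> i then c ({..Suc i} \<union> {Suc i + d..2 * d} - {k}) * c {Suc i..Suc (i + d)}
        else if k \<le> i + d then c ({..i} \<union> {Suc (i + d)..2 * d}) * c ({i..Suc (i + d)} - {k})
        else c ({..i} \<union> {i + d..2 * d} - {k}) * c {i..i + d})"
    have "(\<Sum>k\<le>2 * d. ?t k) = (\<Sum>k<Suc i. ?t k) + ((\<Sum>k\<in>{i<..i + d}. ?t k) + (\<Sum>k\<in>{i + d<..2 * d}. ?t k))"
      unfolding eq by (subst sum.union_disjoint | force)+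
    also have "(\<Sum>k<Suc i. ?t k) = P (Suc i) * y (Suc i)"
      unfolding P_def y_def sum_distrib_right by (intro sum.cong) auto
    also have "(\<Sum>k\<in>{i<..i + d}. ?t k) = W (Suc i) * R i"
      unfolding R_def W_def sum_distrib_left by (intro sum.cong) (auto simp: lessThan_Suc_atMost)
    also have "(\<Sum>k\<in>{i + d<..2 * d}. ?t k) = Q i * y i"
      unfolding Q_def y_def sum_distrib_right by (intro sum.cong) auto
    finally show "(\<Sum>k\<le>2 * d. ?t k) = P (Suc i) * y (Suc i) + W (Suc i) * R i + Q i * y i"
      by simp
  qed
  \<comment> \<open>Collecting the terms with the same \<open>y j\<close> is possible at both ends
    because \<open>P 0\<close> and \<open>Q d\<close> are empty sums.\<close>
  also have "\<dots> = (\<Sum>j\<le>d. (P j + Q j) * y j) + (\<Sum>i<d. W (Suc i) * R i)"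
  proof -
    have "(\<Sum>j\<le>d. P j * y j) = (\<Sum>i<d. P (Suc i) * y (Suc i))"
      by (simp add: sum.atMost_shift P_def)
    moreover have "(\<Sum>j\<le>d. Q j * y j) = (\<Sum>i<d. Q i * y i)"
      unfolding lessThan_Suc_atMost[symmetric] by (simp add: Q_def)
    ultimately show ?thesis
      by (simp add: sum.distrib distrib_right)
  qed
  also have "(\<Sum>i<d. W (Suc i) * R i) = (\<Sum>i<d. - ((-1) ^ i * W (Suc i) * y (Suc i)) - (-1) ^ i * W (Suc
      i) * y i)"
    by (intro sum.cong) (auto simp: R algebra_simps)
  also have "(\<Sum>j\<le>d. (P j + Q j) * y j) = (\<Sum>j\<le>d. (-1) ^ j * W (Suc j) * y j) - (\<Sum>j\<le>d. (-1) ^ j * W j *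
      y j)"
    unfolding sum_subtractf[symmetric] by (intro sum.cong) (auto simp: PQ algebra_simps)
  also have "(\<Sum>j\<le>d. (-1) ^ j * W (Suc j) * y j) = (\<Sum>j<d. (-1) ^ j * W (Suc j) * y j) - W (Suc d) * y d"
    unfolding lessThan_Suc_atMost[symmetric] using d by simp
  also have "(\<Sum>j\<le>d. (-1) ^ j * W j * y j) = W 0 * y 0 + (\<Sum>j<d. - ((-1) ^ j * W (Suc j) * y (Suc j)))"
    by (simp add: sum.atMost_shift)
  finally have "(\<Sum>k\<le>2 * d. (-1) ^ k * H k) = - W (Suc d) * y d - W 0 * y 0"
    by (simp add: sum_subtractf sum_negf)
  \<comment> \<open>The two surviving ends are the same product with its factors exchanged, hence
    the coefficient \<open>-2\<close>.\<close>
  moreover have "W (Suc d) = c {..d}" "W 0 = c {d..2 * d}" "y 0 = c {..d}" "y d = c {d..2 * d}"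
    by (simp_all add: W_def y_def lessThan_Suc_atMost atLeast0AtMost mult_2)
  ultimately show ?thesis
    by simp
qed

lemma strict_mono_on_split:
  fixes m :: nat
  shows "strict_mono_on A (\<lambda>j. if j \<le> i then j else j + m)"
  by (auto simp: strict_mono_on_def)

lemma image_split:
  assumes "i \<le> q"
  shows "(\<lambda>j. if j \<le> i then j else j + m) ` {..q} = {..i} \<union> {Suc (i + m)..q + m}"
proof (intro equalityI subsetI)
  fix x assume "x \<in> {..i} \<union> {Suc (i + m)..q + m}"
  then show "x \<in> (\<lambda>j. if j \<le> i then j else j + m) ` {..q}"
    using assms by (intro image_eqI[of _ _ "if x \<le> i then x else x - m"]) auto
qed auto

lemma image_shift: "(+) i ` {..q} = {i..i + q}" for i q :: nat
  using image_add_atLeastAtMost[of i 0 q] by (simp add: atLeast0AtMost add.commute)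

lemma skip_atMost: "skip k ` {..b} = (if b < k then {..b} else {..Suc b} - {k})"
proof (cases "b < k")
  case False
  show ?thesis
  proof (intro equalityI subsetI)
    fix x assume "x \<in> (if b < k then {..b} else {..Suc b} - {k})"
    then show "x \<in> skip k ` {..b}"
      using False by (intro image_eqI[of _ _ "if x < k then x else x - 1"]) (auto simp: skip_def)
  qed (use False in \<open>auto simp: skip_def split: if_splits\<close>)
qed (simp add: skip_def cong: image_cong_simp)

lemma skip_atLeastAtMost:
  "skip k ` {a..b} = (if k \<le> a then {Suc a..Suc b} else if b < k then {a..b} else {a..Suc b} - {k})"
proof (intro equalityI subsetI)
  fix x assume x: "x \<in> (if k \<le> a then {Suc a..Suc b} else if b < k then {a..b} else {a..Suc b} - {k})"
  then show "x \<in> skip k ` {a..b}"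
    by (intro image_eqI[of _ _ "if x < k then x else x - 1"]) (auto simp: skip_def split: if_splits)
qed (auto simp: skip_def split: if_splits)

text \<open>The cochain \<open>h\<close> is the cup-one square of \<open>f\<close>, whose summands
  all carry the same sign for odd \<open>d\<close>. Its coboundary is \<open>-2\<close> times the
  cup square, and over the reals the factor can be divided out.\<close>

lemma cup_square_coboundary:
  fixes f :: "('a, real) cochain"
  assumes d: "odd d" and f: "f \<in> singular_cocycles d X"
  shows "cochain_cup d d X f f \<in> singular_coboundaries (d + d) X"
proof -
  define a where "a i = (\<lambda>j. if j \<le> i then j else j + (d - 1))" for i
  define h where "h \<sigma> = (if singular_simplex (2 * d - 1) X \<sigma> then
     (\<Sum>i<d. f (subsimplex d (a i) \<sigma>) * f (subsimplex d ((+) i) \<sigma>)) else 0)" for \<sigma>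
  have dpos: "0 < d"
    using d by (auto elim: oddE)
  then have dS: "Suc (2 * d - 1) = 2 * d"
    by simp
  have amono: "strict_mono_on A (a i)" for A i
    unfolding a_def by (rule strict_mono_on_split)
  have a_le: "a i j \<le> 2 * d - 1" if "i < d" "j \<le> d" for i j
    using that by (auto simp: a_def)
  have aim: "a i ` {..d} = {..i} \<union> {i + d..2 * d - 1}" if "i < d" for i
    using image_split[of i d "d - 1"] that dpos by (simp add: a_def mult_2)
  have "cochain_coboundary (2 * d - 1) X h \<tau> = - 2 * cochain_cup d d X f f \<tau>" for \<tau>
  proof (cases "singular_simplex (2 * d) X \<tau>")
    case True
    define c where "c = on_faces f d \<tau>"
    define H where "H k = h (singular_face (2 * d) k \<tau>)" for k
    have "(\<Sum>k\<le>2 * d. (-1) ^ k * H k) = - 2 * (c {..d} * c {d..2 * d})"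
    proof (rule cup_one_square_identity[OF d])
      fix j assume j: "j \<le> d"
      let ?e = "\<lambda>k. if k \<le> j then k else k + (d - 1)"
      \<comment> \<open>The jump \<open>d - 1\<close> is even, so signs may be indexed by the
        vertices themselves instead of their positions.\<close>
      have sgn_e: "(-1::real) ^ ?e k = (-1) ^ k" for k
        using d by (simp add: power_add)
      have im: "?e ` {..Suc d} = {..j} \<union> {j + d..2 * d}"
        using image_split[of j "Suc d" "d - 1"] j dpos by (simp add: mult_2)
      have "(\<Sum>k\<le>Suc d. (-1) ^ k * c (?e ` {..Suc d} - {?e k})) = 0"
        unfolding c_def using j dpos
        by (intro on_faces_cocycle[OF f True] strict_mono_on_split) auto
      then have "0 = (\<Sum>k\<le>Suc d. (-1) ^ ?e k * c ({..j} \<union> {j + d..2 * d} - {?e k}))"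
        unfolding im by (simp only: sgn_e)
      also have "\<dots> = (\<Sum>k\<in>?e ` {..Suc d}. (-1) ^ k * c ({..j} \<union> {j + d..2 * d} - {k}))"
        by (rule sum.reindex_cong[symmetric, OF strict_mono_on_imp_inj_on[OF strict_mono_on_split]])
            auto
      also have "\<dots> = (\<Sum>k\<le>j. (-1) ^ k * c ({..j} \<union> {j + d..2 * d} - {k})) +
          (\<Sum>k\<in>{j + d..2 * d}. (-1) ^ k * c ({..j} \<union> {j + d..2 * d} - {k}))"
        unfolding im using dpos by (intro sum.union_disjoint) auto
      finally show "\<dots> = 0"
        by simp
    next
      fix i assume i: "i < d"
      have im: "(+) i ` {..Suc d} = {i..Suc (i + d)}"
        using image_shift[of i "Suc d"] by simp
      have "(\<Sum>k\<le>Suc d. (-1) ^ k * c ((+) i ` {..Suc d} - {i + k})) = 0"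
        unfolding c_def using i
        by (intro on_faces_cocycle[OF f True]) (auto simp: strict_mono_on_def)
      then have "0 = (-1) ^ i * (\<Sum>k\<le>Suc d. (-1) ^ k * c ({i..Suc (i + d)} - {i + k}))"
        unfolding im by simp
      also have "\<dots> = (\<Sum>k\<le>Suc d. (-1) ^ (i + k) * c ({i..Suc (i + d)} - {i + k}))"
        by (simp add: sum_distrib_left power_add mult.assoc del: sum.atMost_Suc)
      also have "\<dots> = (\<Sum>k\<in>(+) i ` {..Suc d}. (-1) ^ k * c ({i..Suc (i + d)} - {k}))"
        by (rule sum.reindex_cong[symmetric, of "(+) i"]) auto
      finally show "(\<Sum>k\<in>{i..Suc (i + d)}. (-1) ^ k * c ({i..Suc (i + d)} - {k})) = 0"
        unfolding im by simp
    next
      fix k assume k: "k \<le> 2 * d"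
      have ss: "singular_simplex (2 * d - 1) X (singular_face (2 * d) k \<tau>)"
        using singular_simplex_singular_face[OF True _ k] dpos by simp
      have skip_mono: "strict_mono_on A (skip k \<circ> e)" if "strict_mono_on A e" for A e
        unfolding strict_mono_on_def
      proof (intro allI impI, elim conjE)
        fix r s assume "r \<in> A" "s \<in> A" "r < s"
        then have "e r < e s"
          using that by (simp add: strict_mono_on_def)
        then show "(skip k \<circ> e) r < (skip k \<circ> e) s"
          by (simp add: skip_def)
      qed
      have *: "f (subsimplex d e (singular_face (2 * d) k \<tau>)) = c (skip k ` e ` {..d})"
        if "strict_mono_on {..d} e" "\<And>j. j \<le> d \<Longrightarrow> e j \<le> 2 * d - 1" for e
        using that on_faces_image[OF skip_mono[OF that(1)], of f \<tau>] singular_face_eq[of "2 * d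
            - 1" k \<tau>] dS
        by (simp add: c_def subsimplex_subsimplex image_comp)
      show "H k = (\<Sum>i<d.
        if k \<le> i then c ({..Suc i} \<union> {Suc i + d..2 * d} - {k}) * c {Suc i..Suc (i + d)}
        else if k \<le> i + d then c ({..i} \<union> {Suc (i + d)..2 * d}) * c ({i..Suc (i + d)} - {k})
        else c ({..i} \<union> {i + d..2 * d} - {k}) * c {i..i + d})"
        unfolding H_def h_def if_P[OF ss]
      proof (intro sum.cong refl)
        fix i assume "i \<in> {..<d}"
        then have i: "i < d"
          by simp
        have e1: "f (subsimplex d (a i) (singular_face (2 * d) k \<tau>)) = c (skip k ` ({..i} \<union> {i
            + d..2 * d - 1}))"
          using i a_le by (subst *) (auto simp: amono aim)
        have e2: "f (subsimplex d ((+) i) (singular_face (2 * d) k \<tau>)) = c (skip k ` {i..i + d})"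
          using i by (subst *) (auto simp: strict_mono_on_def image_shift)
        consider "k \<le> i" | "i < k" "k \<le> i + d" | "i + d < k"
          by linarith
        then show "f (subsimplex d (a i) (singular_face (2 * d) k \<tau>)) * f (subsimplex d ((+) i)
            (singular_face (2 * d) k \<tau>)) =
           (if k \<le> i then c ({..Suc i} \<union> {Suc i + d..2 * d} - {k}) * c {Suc i..Suc (i + d)}
        else if k \<le> i + d then c ({..i} \<union> {Suc (i + d)..2 * d}) * c ({i..Suc (i + d)} - {k})
        else c ({..i} \<union> {i + d..2 * d} - {k}) * c {i..i + d})"
        proof cases
          case 1
          have "skip k ` ({..i} \<union> {i + d..2 * d - 1}) = {..Suc i} \<union> {Suc i + d..2 * d} - {k}"
            "skip k ` {i..i + d} = {Suc i..Suc (i + d)}"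
            using 1 i by (auto simp: image_Un skip_atMost skip_atLeastAtMost)
          then show ?thesis
            using 1 unfolding e1 e2 by simp
        next
          case 2
          have "skip k ` ({..i} \<union> {i + d..2 * d - 1}) = {..i} \<union> {Suc (i + d)..2 * d}"
            "skip k ` {i..i + d} = {i..Suc (i + d)} - {k}"
            using 2 i by (auto simp: image_Un skip_atMost skip_atLeastAtMost)
          then show ?thesis
            using 2 unfolding e1 e2 by simp
        next
          case 3
          have "skip k ` ({..i} \<union> {i + d..2 * d - 1}) = {..i} \<union> {i + d..2 * d} - {k}"
            "skip k ` {i..i + d} = {i..i + d}"
            using 3 i k by (auto simp: image_Un skip_atMost skip_atLeastAtMost)
          then show ?thesis
            using 3 unfolding e1 e2 by simp
        qed
      qed
    qed
    moreover have "f (front_face d \<tau>) = c {..d}"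
      using on_faces_image[of d id f \<tau>] by (simp add: front_face_eq c_def strict_mono_on_def)
    moreover have "f (back_face d d \<tau>) = c {d..2 * d}"
      using on_faces_image[of d "(+) d" f \<tau>] by (simp add: back_face_eq c_def strict_mono_on_def
          image_shift mult_2)
    ultimately show ?thesis
      using True dS by (simp add: cochain_coboundary_def cochain_cup_def H_def mult_2[symmetric] del:
          sum.atMost_Suc)
  next
    case False
    then show ?thesis
      using dS by (simp add: cochain_coboundary_def cochain_cup_def mult_2[symmetric])
  qed
  then have "cochain_cup d d X f f = cochain_coboundary (2 * d - 1) X (\<lambda>\<sigma>. (-1/2) * h \<sigma> + 0 * h \<sigma>)"
    unfolding cochain_coboundary_lincomb by auto
  moreover have "singular_cochain (2 * d - 1) X (\<lambda>\<sigma>. (-1/2) * h \<sigma> + 0 * h \<sigma>)"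
    by (simp add: singular_cochain_def h_def)
  ultimately have "cochain_cup d d X f f \<in> cochain_coboundary (2 * d - 1) X ` Collect
      (singular_cochain (2 * d - 1) X)"
    by blast
  moreover have eq: "d + d = Suc (2 * d - 1)"
    using dpos by simp
  ultimately show ?thesis
    unfolding eq singular_coboundaries_def by (simp only: nat.case)
qed

lemma chain_eval_coboundary_cycle:
  assumes "F \<in> singular_coboundaries p X" "singular_chain p X z" "chain_boundary p z = 0"
  shows "chain_eval F z = 0"
proof (cases p)
  case 0
  then show ?thesis
    using assms(1) by (simp add: singular_coboundaries_def chain_eval_def)
next
  case (Suc q)
  then show ?thesis
    using assms by (auto simp: singular_coboundaries_def chain_eval_coboundary)
qed

lemma cochain_cup_assoc:
  "cochain_cup (p + q) r X (cochain_cup p q X f g) h = cochain_cup p (q + r) X f (cochain_cup q r X g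
      h)"
proof
  fix \<sigma>
  show "cochain_cup (p + q) r X (cochain_cup p q X f g) h \<sigma> = cochain_cup p (q + r) X f (cochain_cup q
      r X g h) \<sigma>"
  proof (cases "singular_simplex (p + q + r) X \<sigma>")
    case True
    then have "singular_simplex (p + q) X (front_face (p + q) \<sigma>)" "singular_simplex (q
        + r) X (back_face p (q + r) \<sigma>)"
      using singular_simplex_front_face[of "p + q" r X \<sigma>] singular_simplex_back_face[of p "q + r" X \<sigma>]
      by (simp_all add: add.assoc)
    moreover have "front_face p (front_face (p + q) \<sigma>) = front_face p \<sigma>"
      by (simp add: front_face_eq subsimplex_subsimplex)
    moreover have "back_face p q (front_face (p + q) \<sigma>) = front_face q (back_face p (q + r) \<sigma>)"
      by (simp add: front_face_eq back_face_eq subsimplex_subsimplex)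
    moreover have "back_face q r (back_face p (q + r) \<sigma>) = back_face (p + q) r \<sigma>"
      by (simp add: back_face_eq subsimplex_subsimplex comp_def add.assoc[symmetric])
    ultimately show ?thesis
      using True by (simp add: cochain_cup_def add.assoc mult.assoc)
  qed (simp add: cochain_cup_def add.assoc)
qed

lemma cochain_cup_lincomb_left:
  "cochain_cup p q X (\<lambda>\<sigma>. a * f \<sigma> + b * g \<sigma>) h =
     (\<lambda>\<sigma>. a * cochain_cup p q X f h \<sigma> + b * cochain_cup p q X g h \<sigma>)"
  by (auto simp: cochain_cup_def algebra_simps)

lemma cochain_cup_lincomb_right:
  "cochain_cup p q X h (\<lambda>\<sigma>. a * f \<sigma> + b * g \<sigma>) =
     (\<lambda>\<sigma>. a * cochain_cup p q X h f \<sigma> + b * cochain_cup p q X h g \<sigma>)"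
  by (auto simp: cochain_cup_def algebra_simps)

text \<open>Polarization: expand the cup square of \<open>f + g\<close> and subtract the squares of
  \<open>f\<close> and \<open>g\<close>.\<close>

lemma cup_anticommute_coboundary:
  fixes f g :: "('a, real) cochain"
  assumes d: "odd d" and f: "f \<in> singular_cocycles d X" and g: "g \<in> singular_cocycles d X"
  shows "(\<lambda>\<sigma>. cochain_cup d d X f g \<sigma> + cochain_cup d d X g f \<sigma>) \<in> singular_coboundaries (d + d) X"
proof -
  let ?s = "\<lambda>\<sigma>. 1 * f \<sigma> + 1 * g \<sigma>"
  have s: "cochain_cup d d X ?s ?s \<in> singular_coboundaries (d + d) X"
    by (rule cup_square_coboundary[OF d singular_cocycles_lincomb[OF f g]])
  have fg: "(\<lambda>\<sigma>. 1 * cochain_cup d d X f f \<sigma> + 1 * cochain_cup d d X g g \<sigma>) \<in> singular_coboundaries (d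
      + d) X"
    by (rule singular_coboundaries_lincomb[OF cup_square_coboundary[OF d f] cup_square_coboundary[OF d
        g]])
  have "(\<lambda>\<sigma>. 1 * cochain_cup d d X ?s ?s \<sigma> + (-1) * (1 * cochain_cup d d X f f \<sigma> + 1 * cochain_cup d d
      X g g \<sigma>)) =
     (\<lambda>\<sigma>. cochain_cup d d X f g \<sigma> + cochain_cup d d X g f \<sigma>)"
    unfolding cochain_cup_lincomb_left cochain_cup_lincomb_right by auto
  then show ?thesis
    using singular_coboundaries_lincomb[OF s fg, of 1 "-1"] by simp
qed

section \<open>Iterated cup products and their values on a cycle\<close>

primrec cup_cochain :: "nat \<Rightarrow> 'a topology \<Rightarrow> (nat \<Rightarrow> ('a, 'k::comm_ring_1) cochain) \<Rightarrow> nat \<Rightarrow> ('a, 'k)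
    cochain" where
  "cup_cochain d X f 0 = (\<lambda>\<sigma>. if singular_simplex 0 X \<sigma> then 1 else 0)"
| "cup_cochain d X f (Suc n) = cochain_cup (n * d) d X (cup_cochain d X f n) (f n)"

lemma cup_cochain_cocycle:
  "(\<And>i. i < n \<Longrightarrow> f i \<in> singular_cocycles d X) \<Longrightarrow> cup_cochain d X f n \<in> singular_cocycles (n * d) X"
proof (induction n)
  case (Suc n)
  then show ?case
    using cochain_cup_cocycle[of "cup_cochain d X f n" "n * d" X "f n" d] by (simp add: add.commute)
qed (simp add: cohomology_unit_cocycle)

lemma cup_prod_eq_class:
  "(\<And>i. i < n \<Longrightarrow> f i \<in> singular_cocycles d X) \<Longrightarrow> (\<And>i. i < n \<Longrightarrow> \<alpha> i = cohomology_class d X (f i)) \<Longrightarrow>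
    cup_prod d X \<alpha> n = cohomology_class (n * d) X (cup_cochain d X f n)"
proof (induction n)
  case (Suc n)
  have "cup_prod d X \<alpha> (Suc n) =
      cup (n * d) d X (cohomology_class (n * d) X (cup_cochain d X f n)) (cohomology_class d X (f n))"
    using Suc by simp
  also have "\<dots> = cohomology_class (n * d + d) X (cochain_cup (n * d) d X (cup_cochain d X f n) (f n))"
    using Suc.prems by (intro cup_cohomology_class cup_cochain_cocycle) auto
  finally show ?case
    by (simp add: add.commute)
qed (simp add: cohomology_unit_def)

lemma cup_cochain_cong: "(\<And>i. i < n \<Longrightarrow> f i = g i) \<Longrightarrow> cup_cochain d X f n = cup_cochain d X g n"
  by (induction n) auto

text \<open>Iterated front and back faces cut a simplex of dimension \<open>n * d\<close> into the
  faces on the vertices \<open>j * d, ..., (j + 1) * d\<close>. The factors separate, as the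
  coordinates of a pure tensor do.\<close>

lemma cup_cochain_eval:
  assumes "singular_simplex (n * d) X \<sigma>"
  shows "cup_cochain d X f n \<sigma> = (\<Prod>j<n. f j (subsimplex d ((+) (j * d)) \<sigma>))"
  using assms
proof (induction n arbitrary: \<sigma>)
  case (Suc n)
  then have \<sigma>: "singular_simplex (n * d + d) X \<sigma>"
    by (simp add: add.commute)
  have "subsimplex d ((+) (j * d)) (subsimplex (n * d) id \<sigma>) = subsimplex d ((+) (j * d)) \<sigma>"
      if "j < n" for j
  proof -
    have "j * d + i \<le> n * d" if "i \<le> d" for i
    proof -
      have "j * d + i \<le> Suc j * d"
        using that by simp
      also have "\<dots> \<le> n * d"
        using \<open>j < n\<close> by (intro mult_le_mono1) simp
      finally show ?thesis .
    qed
    then show ?thesis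
      by (simp add: subsimplex_subsimplex)
  qed
  then have "cup_cochain d X f n (front_face (n * d) \<sigma>) = (\<Prod>j<n. f j (subsimplex d ((+) (j * d)) \<sigma>))"
    using Suc.IH[OF singular_simplex_front_face[OF \<sigma>]] by (simp add: front_face_eq)
  then show ?case
    using \<sigma> by (simp add: cochain_cup_def back_face_eq)
qed simp

text \<open>If the exchanged factors are the last two, associativity isolates their product.
  Otherwise the last factor is untouched, and multiplying by a cocycle preserves
  coboundaries.\<close>

lemma cup_cochain_swap:
  fixes f :: "nat \<Rightarrow> ('a, real) cochain"
  assumes d: "odd d" and "Suc j < n" "\<And>i. i < n \<Longrightarrow> f i \<in> singular_cocycles d X"
  shows "(\<lambda>\<sigma>. cup_cochain d X (f \<circ> Transposition.transpose j (Suc j)) n \<sigma> + cup_cochain d X f n \<sigma>)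
    \<in> singular_coboundaries (n * d) X"
  using assms(2,3)
proof (induction n)
  case (Suc n)
  let ?t = "Transposition.transpose j (Suc j)"
  show ?case
  proof (cases "Suc j = n")
    case True
    define A where "A = cup_cochain d X f j"
    have A: "A \<in> singular_cocycles (j * d) X"
      unfolding A_def using Suc.prems by (intro cup_cochain_cocycle) auto
    have At: "cup_cochain d X (f \<circ> ?t) j = A"
      unfolding A_def by (intro cup_cochain_cong) (simp add: Transposition.transpose_def)
    have assoc: "cochain_cup (d + j * d) d X (cochain_cup (j * d) d X A g) h =
        cochain_cup (j * d) (d + d) X A (cochain_cup d d X g h)" for g h
      using cochain_cup_assoc[of "j * d" d d X A g h] by (simp add: add.commute)
    have "cup_cochain d X (f \<circ> ?t) (Suc n) \<sigma> + cup_cochain d X f (Suc n) \<sigma> =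
      cochain_cup (j * d) (d + d) X A (\<lambda>\<sigma>. 1 * cochain_cup d d X (f (Suc j)) (f j) \<sigma> + 1 * cochain_cup
          d d X (f j) (f (Suc j)) \<sigma>) \<sigma>" for \<sigma>
      unfolding cochain_cup_lincomb_right using At by (simp add: assoc A_def[symmetric] flip: True)
    moreover have "cochain_cup (j * d) (d + d) X A (\<lambda>\<sigma>. 1 * cochain_cup d d X (f (Suc j)) (f j) \<sigma>
        + 1 * cochain_cup d d X (f j) (f (Suc j)) \<sigma>)
      \<in> singular_coboundaries (j * d + (d + d)) X"
      using cochain_cup_coboundary_right[OF A cup_anticommute_coboundary[OF d Suc.prems(2)[of "Suc j"]
          Suc.prems(2)[of j]]] True
      by simp
    moreover have "j * d + (d + d) = Suc n * d"
      by (simp flip: True)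
    ultimately show ?thesis
      by (simp only:)
  next
    case False
    then have t: "(f \<circ> ?t) n = f n"
      using Suc.prems by (simp add: Transposition.transpose_def)
    have "(\<lambda>\<sigma>. 1 * cup_cochain d X (f \<circ> ?t) n \<sigma> + 1 * cup_cochain d X f n \<sigma>) \<in> singular_coboundaries
        (n * d) X"
      unfolding mult_1 by (rule Suc.IH) (use Suc.prems False in auto)
    from cochain_cup_coboundary_left[OF this Suc.prems(2)[of n]]
    have "cochain_cup (n * d) d X (\<lambda>\<sigma>. 1 * cup_cochain d X (f \<circ> ?t) n \<sigma> + 1 * cup_cochain d X f n \<sigma>)
        (f n)
      \<in> singular_coboundaries (n * d + d) X"
      by simp
    then show ?thesis
      unfolding cochain_cup_lincomb_left cup_cochain.simps t by (simp add: add.commute)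
  qed
qed simp

lemma tensor_rank_leI:
  assumes "\<And>i j. i < r \<Longrightarrow> j < n \<Longrightarrow> v i j \<in> coordinate_space m" "T = (\<lambda>\<iota>. \<Sum>i<r. pure_tensor m n (v i) \<iota>)"
  shows "tensor_rank m n T \<le> r"
  unfolding tensor_rank_def using assms by (intro Least_le exI[of _ v]) auto

lemma tensor_rank_det_le_card_keys:
  fixes f :: "nat \<Rightarrow> ('a, real) cochain"
  assumes d: "odd d" and n: "n \<ge> 1" and f: "\<And>i. i < n \<Longrightarrow> f i \<in> singular_cocycles d X"
    and z: "singular_chain (n * d) X z" "chain_boundary (n * d) z = 0" "chain_eval (cup_cochain d X f
        n) z \<noteq> 0"
  shows "tensor_rank n n (det_tensor n :: _ \<Rightarrow> real) \<le> card (Poly_Mapping.keys z)"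
proof -
  define T where "T \<iota> = chain_eval (cup_cochain d X (f \<circ> \<iota>) n) z" for \<iota>
  have T_det: "T \<iota> = T id * det_tensor n \<iota>" if "\<iota> \<in> multi_indices n n" for \<iota>
  proof (rule alternating_eq_det_tensor[OF _ _ that])
    fix \<iota> :: "nat \<Rightarrow> nat" and j
    assume *: "Suc j < n" "\<And>i. i < n \<Longrightarrow> \<iota> i < n"
    have "(\<lambda>\<sigma>. cup_cochain d X ((f \<circ> \<iota>) \<circ> Transposition.transpose j (Suc j)) n \<sigma> + cup_cochain d X (f
        \<circ> \<iota>) n \<sigma>)
      \<in> singular_coboundaries (n * d) X"
      using * f by (intro cup_cochain_swap d) auto
    from chain_eval_coboundary_cycle[OF this z(1,2)]
    have "chain_eval (cup_cochain d X ((f \<circ> \<iota>) \<circ> Transposition.transpose j (Suc j)) n) z + T \<iota> = 0"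
      by (simp add: chain_eval_def T_def distrib_left sum.distrib)
    then show "T (\<iota> \<circ> Transposition.transpose j (Suc j)) = - T \<iota>"
      unfolding T_def comp_assoc by linarith
  next
    fix \<iota> \<kappa> :: "nat \<Rightarrow> nat"
    assume "\<And>j. j < n \<Longrightarrow> \<iota> j = \<kappa> j"
    then show "T \<iota> = T \<kappa>"
      unfolding T_def by (metis comp_apply cup_cochain_cong)
  qed
  have T0: "T id \<noteq> 0"
    using z(3) by (simp add: T_def)
  obtain h where h: "bij_betw h {..<card (Poly_Mapping.keys z)} (Poly_Mapping.keys z)"
    using ex_bij_betw_nat_finite[OF finite_keys, of z] by (auto simp: atLeast0LessThan)
  \<comment> \<open>The coefficient of the simplex in \<open>z\<close> and the normalization by
    \<open>T id\<close> are absorbed into the factor \<open>j = 0\<close>, which exists since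
    \<open>n \<ge> 1\<close>.\<close>
  define v where "v i j k = (if k < n then (if j = 0 then of_int (Poly_Mapping.lookup z (h i)) / T id
      else 1) *
    f k (subsimplex d ((+) (j * d)) (h i)) else 0)" for i j k :: nat
  show ?thesis
  proof (rule tensor_rank_leI[where v = v])
    show "v i j \<in> coordinate_space n" for i j
      by (simp add: v_def coordinate_space_def)
    show "det_tensor n = (\<lambda>\<iota>. \<Sum>i<card (Poly_Mapping.keys z). pure_tensor n n (v i) \<iota>)"
    proof
      fix \<iota>
      show "det_tensor n \<iota> = (\<Sum>i<card (Poly_Mapping.keys z). pure_tensor n n (v i) \<iota>)"
      proof (cases "\<iota> \<in> multi_indices n n")
        case True
        then have \<iota>: "\<iota> j < n" if "j < n" for j
          using that by (auto simp: multi_indices_def)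
        have "pure_tensor n n (v i) \<iota> =
            of_int (Poly_Mapping.lookup z (h i)) * cup_cochain d X (f \<circ> \<iota>) n (h i) / T id"
          if "i < card (Poly_Mapping.keys z)" for i
        proof -
          have "h i \<in> Poly_Mapping.keys z"
            using h that by (auto simp: bij_betw_def)
          then have "singular_simplex (n * d) X (h i)"
            using z(1) by (auto simp: singular_chain_def)
          then have "cup_cochain d X (f \<circ> \<iota>) n (h i) = (\<Prod>j<n. f (\<iota> j) (subsimplex d ((+) (j * d)) (h
              i)))"
            by (simp add: cup_cochain_eval)
          moreover have "(\<Prod>j<n. if j = 0 then of_int (Poly_Mapping.lookup z (h i)) / T id else 1) =
             of_int (Poly_Mapping.lookup z (h i)) / T id"
            using n by simp
          moreover have "(\<Prod>j<n. v i j (\<iota> j)) =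
            (\<Prod>j<n. (if j = 0 then of_int (Poly_Mapping.lookup z (h i)) / T id else 1) *
              f (\<iota> j) (subsimplex d ((+) (j * d)) (h i)))"
            by (intro prod.cong) (auto simp: v_def \<iota>)
          ultimately show ?thesis
            using True by (simp add: pure_tensor_def prod.distrib)
        qed
        then have "(\<Sum>i<card (Poly_Mapping.keys z). pure_tensor n n (v i) \<iota>) =
          (\<Sum>i<card (Poly_Mapping.keys z). of_int (Poly_Mapping.lookup z (h i)) * cup_cochain d X (f \<circ>
              \<iota>) n (h i) / T id)"
          by simp
        also have "\<dots> = (\<Sum>\<sigma>\<in>Poly_Mapping.keys z. of_int (Poly_Mapping.lookup z \<sigma>) * cup_cochain d X (f
            \<circ> \<iota>) n \<sigma> / T id)"
          by (rule sum.reindex_bij_betw[OF h])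
        also have "\<dots> = T \<iota> / T id"
          by (simp add: T_def chain_eval_def sum_divide_distrib)
        finally show ?thesis
          using T_det[OF True] T0 by simp
      next
        case False
        moreover have "det_tensor n \<in> (tensor_power n n :: (_ \<Rightarrow> real) set)"
          by (rule det_tensor_in_tensor_power)
        ultimately show ?thesis
          by (simp add: pure_tensor_def tensor_power_def)
      qed
    qed
  qed
qed

section \<open>Homology of a cell attachment\<close>

abbreviation simplex_space :: "nat \<Rightarrow> (nat \<Rightarrow> real) topology" where
  "simplex_space k \<equiv> subtopology (powertop_real UNIV) (standard_simplex k)"

definition simplex_boundary :: "nat \<Rightarrow> (nat \<Rightarrow> real) set" where
  "simplex_boundary k = {x \<in> standard_simplex k. \<exists>i\<le>k. x i = 0}"

lemma open_simplex_eq: "open_simplex k = standard_simplex k - simplex_boundary k"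
  by (auto simp: open_simplex_def simplex_boundary_def standard_simplex_def less_le)

text \<open>Recursion instead of a minimum over a set, so that continuity follows by
  induction.\<close>

primrec min_coord :: "nat \<Rightarrow> (nat \<Rightarrow> real) \<Rightarrow> real" where
  "min_coord 0 x = x 0"
| "min_coord (Suc k) x = min (min_coord k x) (x (Suc k))"

lemma min_coord_le: "i \<le> k \<Longrightarrow> min_coord k x \<le> x i"
  by (induction k) (auto simp: le_Suc_eq min_le_iff_disj)

lemma min_coord_attained: "\<exists>i\<le>k. min_coord k x = x i"
proof (induction k)
  case (Suc k)
  then show ?case
    by (metis le_Suc_eq min_coord.simps(2) min_def)
qed auto

lemma min_coord_eqI: "i \<le> k \<Longrightarrow> c = x i \<Longrightarrow> (\<And>j. j \<le> k \<Longrightarrow> c \<le> x j) \<Longrightarrow> min_coord k x = c"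
  by (metis min_coord_attained min_coord_le order_antisym)

definition radius :: "nat \<Rightarrow> (nat \<Rightarrow> real) \<Rightarrow> real" where
  "radius k x = 1 - real (Suc k) * min_coord k x"

text \<open>\<open>radius k\<close> is \<open>0\<close> at the barycentre and \<open>1\<close> on the boundary, and it is linear on the rays from
  the barycentre. The homotopy \<open>stretch k\<close> pushes points away from the barycentre until, at
  \<open>t = 1\<close>, everything of radius at least \<open>1/2\<close> has reached the boundary.\<close>

definition stretch :: "nat \<Rightarrow> real \<Rightarrow> (nat \<Rightarrow> real) \<Rightarrow> nat \<Rightarrow> real" where
  "stretch k t x = (\<lambda>i. if i \<le> k then
     1 / real (Suc k) + (1 - t + t / max (1/2) (radius k x)) * (x i - 1 / real (Suc k)) else 0)"

lemma radius_bounds: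
  assumes "x \<in> standard_simplex k"
  shows "0 \<le> radius k x" "radius k x \<le> 1"
proof -
  have "(\<Sum>i\<le>k. min_coord k x) \<le> (\<Sum>i\<le>k. x i)"
    by (intro sum_mono) (simp add: min_coord_le)
  then show "0 \<le> radius k x"
    using assms by (simp add: radius_def standard_simplex_def)
  show "radius k x \<le> 1"
    using assms min_coord_attained[of k x] by (auto simp: radius_def standard_simplex_def)
qed

lemma radius_eq_1_iff:
  assumes "x \<in> standard_simplex k"
  shows "radius k x = 1 \<longleftrightarrow> x \<in> simplex_boundary k"
proof
  assume "radius k x = 1"
  then have "min_coord k x = 0"
    by (simp add: radius_def)
  then show "x \<in> simplex_boundary k"
    using assms min_coord_attained[of k x] by (auto simp: simplex_boundary_def)
next
  assume "x \<in> simplex_boundary k"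
  then have "min_coord k x = 0"
    using assms by (auto simp: simplex_boundary_def standard_simplex_def intro!: min_coord_eqI)
  then show "radius k x = 1"
    by (simp add: radius_def)
qed

text \<open>The number \<open>max (1/2) (radius k x)\<close> is at most \<open>1\<close> and at
  least the radius, so points never move inwards and never leave the simplex.\<close>

lemma stretch_factor:
  assumes "x \<in> standard_simplex k" "0 \<le> t" "t \<le> 1"
  shows "1 \<le> 1 - t + t / max (1/2) (radius k x)" "(1 - t + t / max (1/2) (radius k x)) * radius k x \<le> 1"
proof -
  define m where "m = max (1/2) (radius k x)"
  have m: "0 < m" "m \<le> 1" "radius k x \<le> m" "0 \<le> radius k x"
    using radius_bounds[OF assms(1)] by (auto simp: m_def)
  have "t * 1 \<le> t * (1 / m)"
    using m assms by (intro mult_left_mono) (auto simp: field_simps)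
  then show "1 \<le> 1 - t + t / max (1/2) (radius k x)"
    by (simp add: m_def)
  have "(1 - t + t / m) * radius k x = (1 - t) * radius k x + t * (radius k x / m)"
    by (simp add: algebra_simps)
  also have "\<dots> \<le> (1 - t) * 1 + t * 1"
    using m assms by (intro add_mono mult_left_mono) (auto simp: field_simps)
  finally show "(1 - t + t / max (1/2) (radius k x)) * radius k x \<le> 1"
    by (simp add: m_def)
qed

text \<open>\<open>stretch\<close> is a dilation about the barycentre by a factor at least
  \<open>1\<close>. It keeps a least coordinate least, so the radius is multiplied by that
  factor.\<close>

lemma radius_stretch:
  assumes "x \<in> standard_simplex k" "0 \<le> t" "t \<le> 1"
  shows "radius k (stretch k t x) = (1 - t + t / max (1/2) (radius k x)) * radius k x"
proof -
  define c where "c = 1 - t + t / max (1/2) (radius k x)"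
  define b where "b = 1 / real (Suc k)"
  have c: "1 \<le> c"
    using stretch_factor[OF assms] by (simp add: c_def)
  obtain i where i: "i \<le> k" "min_coord k x = x i"
    using min_coord_attained by blast
  have "min_coord k (stretch k t x) = b + c * (min_coord k x - b)"
  proof (rule min_coord_eqI[OF i(1)])
    show "b + c * (min_coord k x - b) = stretch k t x i"
      using i by (simp add: stretch_def b_def c_def)
    show "b + c * (min_coord k x - b) \<le> stretch k t x j" if "j \<le> k" for j
    proof -
      have "stretch k t x j = b + c * (x j - b)"
        using that by (simp add: stretch_def b_def c_def)
      then show ?thesis
        using that c min_coord_le[of j k x] by (simp add: mult_left_mono)
    qed
  qed
  then have "radius k (stretch k t x) = 1 - real (Suc k) * (b + c * (min_coord k x - b))"
    by (simp add: radius_def)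
  also have "\<dots> = 1 - real (Suc k) * b + c * (real (Suc k) * b - real (Suc k) * min_coord k x)"
    by (simp only: right_diff_distrib distrib_left mult.left_commute)
  also have "real (Suc k) * b = 1"
    by (simp add: b_def)
  finally have "radius k (stretch k t x) = c * radius k x"
    by (simp add: radius_def)
  then show ?thesis
    by (simp add: c_def)
qed

lemma stretch_in_standard_simplex:
  assumes "x \<in> standard_simplex k" "0 \<le> t" "t \<le> 1"
  shows "stretch k t x \<in> standard_simplex k"
proof -
  define c where "c = 1 - t + t / max (1/2) (radius k x)"
  define b where "b = 1 / real (Suc k)"
  have "radius k (stretch k t x) \<le> 1"
    using radius_stretch[OF assms] stretch_factor[OF assms] by simp
  then have "0 \<le> min_coord k (stretch k t x)"
    by (simp add: radius_def zero_le_mult_iff)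
  then have nn: "0 \<le> stretch k t x i" for i
    using min_coord_le[of i k "stretch k t x"] by (cases "i \<le> k") (auto simp: stretch_def)
  have "(\<Sum>i\<le>k. stretch k t x i) = (\<Sum>i\<le>k. b + c * (x i - b))"
    by (intro sum.cong) (auto simp: stretch_def b_def c_def)
  also have "\<dots> = real (Suc k) * b + c * ((\<Sum>i\<le>k. x i) - real (Suc k) * b)"
    by (simp add: sum.distrib sum_subtractf flip: sum_distrib_left)
  also have "\<dots> = 1"
    using assms by (simp add: b_def standard_simplex_def)
  finally have sum: "(\<Sum>i\<le>k. stretch k t x i) = 1" .
  moreover have "stretch k t x i \<le> 1" for i
  proof (cases "i \<le> k")
    case True
    then have "stretch k t x i \<le> (\<Sum>i\<le>k. stretch k t x i)"
      using nn by (intro member_le_sum) auto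
    then show ?thesis
      using sum by simp
  qed (simp add: stretch_def)
  moreover have "stretch k t x i = 0" if "i > k" for i
    using that by (simp add: stretch_def)
  ultimately show ?thesis
    using nn by (auto simp: standard_simplex_def)
qed

lemma stretch_boundary:
  assumes "x \<in> simplex_boundary k"
  shows "stretch k t x = x"
proof -
  have "x \<in> standard_simplex k"
    using assms by (simp add: simplex_boundary_def)
  then show ?thesis
    using radius_eq_1_iff[of x k] assms by (auto simp: stretch_def standard_simplex_def fun_eq_iff)
qed

lemma stretch_0: "x \<in> standard_simplex k \<Longrightarrow> stretch k 0 x = x"
  by (auto simp: stretch_def standard_simplex_def fun_eq_iff)

definition collar :: "nat \<Rightarrow> (nat \<Rightarrow> real) set" where
  "collar k = {x \<in> standard_simplex k. 1/2 \<le> radius k x}"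

lemma stretch_collar:
  assumes "x \<in> collar k" "0 \<le> t" "t \<le> 1"
  shows "stretch k t x \<in> collar k"
proof -
  have x: "x \<in> standard_simplex k" "1/2 \<le> radius k x"
    using assms by (auto simp: collar_def)
  have "1/2 \<le> 1 * radius k x"
    using x by simp
  also have "\<dots> \<le> radius k (stretch k t x)"
    unfolding radius_stretch[OF x(1) assms(2,3)]
    using x stretch_factor[OF x(1) assms(2,3)] by (intro mult_right_mono) auto
  finally show ?thesis
    using stretch_in_standard_simplex[OF x(1) assms(2,3)] by (simp add: collar_def)
qed

lemma stretch_1_collar:
  assumes "x \<in> collar k"
  shows "stretch k 1 x \<in> simplex_boundary k"
proof -
  have x: "x \<in> standard_simplex k" "1/2 \<le> radius k x"
    using assms by (auto simp: collar_def)
  then have "radius k (stretch k 1 x) = 1"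
    using radius_stretch[OF x(1), of 1] by (simp add: max_def)
  then show ?thesis
    using radius_eq_1_iff stretch_in_standard_simplex[OF x(1), of 1] by simp
qed

lemma boundary_subset_collar: "simplex_boundary k \<subseteq> collar k"
proof
  fix x assume x: "x \<in> simplex_boundary k"
  then have "x \<in> standard_simplex k"
    by (simp add: simplex_boundary_def)
  moreover from this have "radius k x = 1"
    using x radius_eq_1_iff by blast
  ultimately show "x \<in> collar k"
    by (simp add: collar_def)
qed

lemma continuous_map_coord: "continuous_map (simplex_space k) euclideanreal (\<lambda>x. x i)"
  by (intro continuous_map_from_subtopology continuous_map_product_projection) simp

lemma continuous_map_radius: "continuous_map (simplex_space k) euclideanreal (radius k)"
proof -
  have "continuous_map (simplex_space k) euclideanreal (min_coord l)" for l
  proof (induction l)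
    case (Suc l)
    then show ?case
      using continuous_map_coord[of k "Suc l"] by (simp add: continuous_map_real_min)
  qed (use continuous_map_coord in simp)
  then show ?thesis
    unfolding radius_def by (intro continuous_intros)
qed

lemma continuous_map_stretch:
  "continuous_map (prod_topology (top_of_set {0..1::real}) (simplex_space k)) (simplex_space k)
     (\<lambda>(t, x). stretch k t x)"
proof -
  let ?P = "prod_topology (top_of_set {0..1::real}) (simplex_space k)"
  have t: "continuous_map ?P euclideanreal fst"
    using continuous_map_fst[of "top_of_set {0..1::real}" "simplex_space k"]
    by (simp add: continuous_map_in_subtopology)
  have snd: "continuous_map ?P euclideanreal (\<lambda>p. f (snd p))" if "continuous_map
      (simplex_space k) euclideanreal f" for f
    using continuous_map_compose[OF continuous_map_snd that] by (simp add: comp_def)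
  have "continuous_map ?P euclideanreal (\<lambda>p. stretch k (fst p) (snd p) i)" for i
  proof (cases "i \<le> k")
    case True
    have "continuous_map ?P euclideanreal (\<lambda>p. 1 / real (Suc k) +
        (1 - fst p + fst p / max (1/2) (radius k (snd p))) * (snd p i - 1 / real (Suc k)))"
      using snd[OF continuous_map_coord, of i] snd[OF continuous_map_radius] t
      by (intro continuous_intros) auto
    then show ?thesis
      using True by (simp add: stretch_def)
  qed (simp add: stretch_def)
  then show ?thesis
    using stretch_in_standard_simplex
    by (auto simp: continuous_map_in_subtopology continuous_map_componentwise case_prod_unfold)
qed

section \<open>Collar and excision for an attached cell\<close>

lemma continuous_map_paste_closed:
  fixes X :: "'a topology"
  assumes A: "closedin X A" and B: "closedin X B" and AB: "topspace X = A \<union> B"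
    and f: "continuous_map (subtopology X A) Y f" and g: "continuous_map (subtopology X B) Y g"
    and eq: "\<And>x. x \<in> A \<inter> B \<Longrightarrow> f x = g x"
  shows "continuous_map X Y (\<lambda>x. if x \<in> A then f x else g x)"
proof (rule pasting_lemma_closed[where I = "{True, False}" and T = "\<lambda>b. if b then A else B"
    and f = "\<lambda>b. if b then f else g"])
  fix x assume "x \<in> topspace X"
  then show "\<exists>j. j \<in> {True, False} \<and> x \<in> (if j then A else B) \<and>
      (if x \<in> A then f x else g x) = (if j then f else g) x"
    using AB by (intro exI[of _ "x \<in> A"]) auto
qed (use assms in \<open>auto split: if_splits\<close>)

text \<open>Injectivity on the closed simplex and compactness make \<open>\<phi>\<close> a
  homeomorphism onto a closed subspace. The locale is used for a subcomplex with a top cell, for the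
  boundary of a simplex over a horn, and for a simplex over its own boundary.\<close>

locale cell_attachment =
  fixes L :: "'a topology" and L' :: "'a set" and k :: nat and \<phi> :: "(nat \<Rightarrow> real) \<Rightarrow> 'a"
  assumes Hausdorff: "Hausdorff_space L"
    and closed: "closedin L L'"
    and cont: "continuous_map (simplex_space k) L \<phi>"
    and inj: "inj_on \<phi> (standard_simplex k)"
    and bd: "\<phi> ` simplex_boundary k \<subseteq> L'"
    and interior: "\<phi> ` open_simplex k \<inter> L' = {}"
    and cover: "topspace L = L' \<union> \<phi> ` standard_simplex k"
begin

definition cell_collar :: "'a set" where
  "cell_collar = L' \<union> \<phi> ` collar k"

lemma closed_subset: "L' \<subseteq> topspace L"
  using closed closedin_subset by blast

lemma mem_L'_iff:
  assumes "x \<in> standard_simplex k"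
  shows "\<phi> x \<in> L' \<longleftrightarrow> x \<in> simplex_boundary k"
  using assms bd interior by (auto simp: open_simplex_eq)

lemma closedin_cell_image: "closedin (simplex_space k) S \<Longrightarrow> closedin L (\<phi> ` S)"
proof -
  assume "closedin (simplex_space k) S"
  moreover have "compact_space (simplex_space k)"
    by (simp add: compact_space_subtopology compactin_standard_simplex)
  ultimately have "compactin (simplex_space k) S"
    by (simp add: closedin_compact_space)
  then show "closedin L (\<phi> ` S)"
    by (intro compactin_imp_closedin[OF Hausdorff] image_compactin[OF _ cont])
qed

lemma closedin_cell: "closedin L (\<phi> ` standard_simplex k)"
  using closedin_cell_image[of "standard_simplex k"] closedin_topspace[of "simplex_space k"] by simp

lemma homeomorphic_cell: "homeomorphic_map (simplex_space k) (subtopology L (\<phi> ` standard_simplex k)) \<phi>"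
proof (rule continuous_imp_homeomorphic_map)
  show "continuous_map (simplex_space k) (subtopology L (\<phi> ` standard_simplex k)) \<phi>"
    using cont by (auto simp: continuous_map_in_subtopology)
  show "compact_space (simplex_space k)"
    by (simp add: compact_space_subtopology compactin_standard_simplex)
  show "Hausdorff_space (subtopology L (\<phi> ` standard_simplex k))"
    using Hausdorff by (rule Hausdorff_space_subtopology)
  show "\<phi> ` topspace (simplex_space k) = topspace (subtopology L (\<phi> ` standard_simplex k))"
    using cover by auto
qed (use inj in simp)

text \<open>\<open>stretch\<close>, carried over by \<open>\<phi>\<close> and extended by the
  identity on \<open>L'\<close>, preserves \<open>L'\<close> and the collar at all times and ends
  with a map \<open>g\<close> of the collar into \<open>L'\<close>. So \<open>id\<close> and
  \<open>g\<close> are mutually inverse homotopy equivalences of pairs.\<close>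

lemma collar_iso:
  "hom_induced p L L' L cell_collar id \<in>
     iso (relative_homology_group p L L') (relative_homology_group p L cell_collar)"
proof -
  define C where "C = \<phi> ` standard_simplex k"
  obtain \<psi> where \<psi>: "homeomorphic_maps (simplex_space k) (subtopology L C) \<phi> \<psi>"
    using homeomorphic_cell homeomorphic_map_maps C_def by metis
  have \<psi>\<phi>: "\<psi> (\<phi> x) = x" if "x \<in> standard_simplex k" for x
    using \<psi> that by (simp add: homeomorphic_maps_def)
  \<comment> \<open>The last branch concerns only points outside the space; it makes
    \<open>h (0, y) = y\<close> hold for all \<open>y\<close>.\<close>
  define h where "h = (\<lambda>(t, y). if y \<in> L' then y else if y \<in> C then \<phi> (stretch k t (\<psi> y)) else y)"
  let ?I = "top_of_set {0..1::real}"
  have hL: "h (t, y) = y" if "y \<in> L'" for t y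
    using that by (simp add: h_def)
  have hC: "h (t, \<phi> x) = \<phi> (stretch k t x)" if "x \<in> standard_simplex k" for t x
    using that mem_L'_iff[OF that] by (auto simp: h_def C_def \<psi>\<phi> stretch_boundary)
  have cont_h: "continuous_map (prod_topology ?I L) L h"
  proof -
    have "continuous_map (prod_topology ?I L) L
      (\<lambda>z. if z \<in> {0..1} \<times> L' then snd z else \<phi> (stretch k (fst z) (\<psi> (snd z))))"
    proof (rule continuous_map_paste_closed)
      show "closedin (prod_topology ?I L) ({0..1} \<times> L')" "closedin (prod_topology ?I L) ({0..1} \<times> C)"
        using closed closedin_cell closedin_topspace[of ?I] by
            (simp_all add: closedin_prod_Times_iff C_def)
      show "topspace (prod_topology ?I L) = {0..1} \<times> L' \<union> {0..1} \<times> C"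
        using cover by (auto simp: C_def)
      show "continuous_map (subtopology (prod_topology ?I L) ({0..1} \<times> L')) L snd"
        by (intro continuous_map_from_subtopology continuous_map_snd)
      have "subtopology (prod_topology ?I L) ({0..1} \<times> C) = prod_topology ?I (subtopology L C)"
        by (simp add: subtopology_Times subtopology_subtopology)
      moreover have "continuous_map (prod_topology ?I (subtopology L C)) (prod_topology ?I
          (simplex_space k))
          (\<lambda>z. (fst z, \<psi> (snd z)))"
        using \<psi> continuous_map_compose[OF continuous_map_snd, of "subtopology L C" "simplex_space k" \<psi>
            ?I]
        by (simp add: continuous_map_pairwise comp_def homeomorphic_maps_def continuous_map_fst)
      then have "continuous_map (prod_topology ?I (subtopology L C)) L
          (\<phi> \<circ> (\<lambda>(t, x). stretch k t x) \<circ> (\<lambda>z. (fst z, \<psi> (snd z))))"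
        by (intro continuous_map_compose[OF _ continuous_map_compose[OF continuous_map_stretch cont]])
      ultimately show "continuous_map (subtopology (prod_topology ?I L) ({0..1} \<times> C)) L
          (\<lambda>z. \<phi> (stretch k (fst z) (\<psi> (snd z))))"
        by (simp add: comp_def)
      show "snd z = \<phi> (stretch k (fst z) (\<psi> (snd z)))" if "z \<in> {0..1} \<times> L' \<inter> {0..1} \<times> C" for z
      proof -
        have "snd z \<in> L'" "snd z \<in> C"
          using that by auto
        then obtain x where "snd z = \<phi> x" "x \<in> standard_simplex k" "\<phi> x \<in> L'"
          unfolding C_def by auto
        then show ?thesis
          by (simp add: \<psi>\<phi> mem_L'_iff stretch_boundary)
      qed
    qed
    then show ?thesis
      by (rule continuous_map_eq) (use cover in \<open>auto simp: h_def simp flip: C_def split: if_splits\<close>)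
  qed
  have h0: "h (0, y) = y" for y
    by (auto simp: h_def C_def \<psi>\<phi> stretch_0)
  define g where "g y = h (1, y)" for y
  have stretch_mem: "h (t, y) \<in> cell_collar" if t: "t \<in> {0..1}" and y: "y \<in> cell_collar" for t y
  proof (cases "y \<in> L'")
    case True
    then show ?thesis
      by (simp add: hL cell_collar_def)
  next
    case False
    then obtain x where "y = \<phi> x" "x \<in> collar k"
      using y by (auto simp: cell_collar_def)
    then show ?thesis
      using t stretch_collar[of x k t] by (auto simp: hC cell_collar_def collar_def)
  qed
  have g_mem: "g y \<in> L'" if y: "y \<in> cell_collar" for y
  proof (cases "y \<in> L'")
    case False
    then obtain x where "y = \<phi> x" "x \<in> collar k"
      using y by (auto simp: cell_collar_def)
    then show ?thesis
      using stretch_1_collar[of x k] bd by (auto simp: hC g_def collar_def)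
  qed (simp add: g_def hL)
  have cont_g: "continuous_map L L g"
  proof -
    have "continuous_map L L (h \<circ> (\<lambda>y. (1, y)))"
      by (rule continuous_map_compose[OF _ cont_h]) (simp add: continuous_map_pairwise comp_def)
    then show ?thesis
      by (simp add: comp_def g_def[abs_def])
  qed
  have "homotopic_with (\<lambda>f. f \<in> L' \<rightarrow> L') L L id g" "homotopic_with (\<lambda>f. f \<in> cell_collar \<rightarrow> cell_collar)
      L L id g"
    unfolding homotopic_with_def using cont_h h0 hL stretch_mem by
        (auto intro!: exI[of _ h] simp: g_def)
  then show ?thesis
    using cont_g g_mem by (intro homotopy_equivalence_relative_homology_group_isomorphism[where g = g])
      (auto simp: cell_collar_def homotopic_with_symD)
qed

text \<open>The closed core of radius at most \<open>1/2\<close> has an open complement that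
  contains \<open>L'\<close> and lies in the collar, so the closed set \<open>L'\<close> is interior
  to the collar and can be excised.\<close>

lemma excision_iso:
  "hom_induced p (subtopology L (topspace L - L')) (cell_collar - L') L cell_collar id \<in>
     iso (relative_homology_group p (subtopology L (topspace L - L')) (cell_collar - L'))
       (relative_homology_group p L cell_collar)"
proof -
  define K where "K = {x \<in> topspace (simplex_space k). radius k x \<in> {..1/2}}"
  have "closedin (simplex_space k) K"
    unfolding K_def by (rule closedin_continuous_map_preimage[OF continuous_map_radius]) simp
  then have op: "openin L (topspace L - \<phi> ` K)"
    using closedin_cell_image by blast
  have "L' \<subseteq> topspace L - \<phi> ` K"
  proof
    fix y assume y: "y \<in> L'"
    moreover have "y \<notin> \<phi> ` K"
    proof
      assume "y \<in> \<phi> ` K"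
      then obtain x where x: "y = \<phi> x" "x \<in> standard_simplex k" "radius k x \<le> 1/2"
        by (auto simp: K_def)
      then show False
        using y mem_L'_iff[of x] radius_eq_1_iff[of x k] by simp
    qed
    ultimately show "y \<in> topspace L - \<phi> ` K"
      using closed_subset by blast
  qed
  moreover have "topspace L - \<phi> ` K \<subseteq> cell_collar"
  proof
    fix y assume y: "y \<in> topspace L - \<phi> ` K"
    show "y \<in> cell_collar"
    proof (cases "y \<in> L'")
      case False
      then obtain x where x: "y = \<phi> x" "x \<in> standard_simplex k"
        using y cover by auto
      then have "x \<notin> K"
        using y by auto
      then show ?thesis
        using x by (auto simp: cell_collar_def collar_def K_def)
    qed (simp add: cell_collar_def)
  qed
  ultimately have "L' \<subseteq> L interior_of cell_collar"
    using interior_of_maximal[OF _ op] by blast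
  then have sub: "L closure_of L' \<subseteq> L interior_of cell_collar"
    using closed by (simp add: closure_of_closedin)
  have "cell_collar \<subseteq> topspace L"
    using cover closed_subset by (auto simp: cell_collar_def collar_def)
  from homology_excision_axiom[OF sub this, of p] show ?thesis
    by simp
qed

end

text \<open>Makes the collar and excision isomorphisms available for the simplex itself, to be
  compared with those of a general attachment.\<close>

lemma simplex_cell_attachment: "cell_attachment (simplex_space k) (simplex_boundary k) k id"
proof
  show "Hausdorff_space (simplex_space k)"
    by (intro Hausdorff_space_subtopology) (simp add: Hausdorff_space_product_topology)
  have "simplex_boundary k = {x \<in> topspace (simplex_space k). radius k x \<in> {1}}"
    using radius_eq_1_iff[of _ k] by (auto simp: simplex_boundary_def)
  then show "closedin (simplex_space k) (simplex_boundary k)"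
    using closedin_continuous_map_preimage[OF continuous_map_radius, of "{1}" k] by simp
qed (auto simp: open_simplex_eq simplex_boundary_def)

context cell_attachment
begin

text \<open>Both pairs are enlarged to their collars and then excised down to the open cell, where
  \<open>\<phi>\<close> is a homeomorphism; naturality brings the isomorphism back.\<close>

theorem cell_iso:
  "hom_induced p (simplex_space k) (simplex_boundary k) L L' \<phi> \<in>
     iso (relative_homology_group p (simplex_space k) (simplex_boundary k)) (relative_homology_group p
         L L')"
proof -
  interpret s: cell_attachment "simplex_space k" "simplex_boundary k" k id
    by (rule simplex_cell_attachment)
  have sc: "s.cell_collar = collar k"
    using boundary_subset_collar by (auto simp: s.cell_collar_def)
  let ?D = "simplex_space k" and ?B = "simplex_boundary k" and ?C = "collar k"
  let ?D' = "subtopology ?D (topspace ?D - ?B)" and ?L' = "subtopology L (topspace L - L')"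
  let ?H = "relative_homology_group p"
  have iso_bij: "bij_betw f (carrier G) (carrier H)" if "f \<in> iso G H" for f and G :: "'x monoid"
      and H :: "'y monoid"
    using that by (simp add: iso_def)
  have a: "bij_betw (hom_induced p ?D ?B ?D ?C id) (carrier (?H ?D ?B)) (carrier (?H ?D ?C))"
    using iso_bij[OF s.collar_iso[of p]] by (simp add: sc)
  have b: "bij_betw (hom_induced p ?D' (?C - ?B) ?D ?C id) (carrier (?H ?D' (?C - ?B))) (carrier (?H
      ?D ?C))"
    using iso_bij[OF s.excision_iso[of p]] by (simp only: sc)
  have d: "bij_betw (hom_induced p ?L' (cell_collar - L') L cell_collar id)
      (carrier (?H ?L' (cell_collar - L'))) (carrier (?H L cell_collar))"
    by (rule iso_bij[OF excision_iso])
  have e: "bij_betw (hom_induced p L L' L cell_collar id) (carrier (?H L L')) (carrier (?H L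
      cell_collar))"
    by (rule iso_bij[OF collar_iso])
  have c: "bij_betw (hom_induced p ?D' (?C - ?B) ?L' (cell_collar - L') \<phi>)
      (carrier (?H ?D' (?C - ?B))) (carrier (?H ?L' (cell_collar - L')))"
  proof (rule iso_bij, rule homeomorphic_map_relative_homology_iso)
    have "homeomorphic_map ?D' (subtopology (subtopology L (\<phi> ` standard_simplex k)) (topspace L
        - L')) \<phi>"
      using mem_L'_iff cover by (intro homeomorphic_map_subtopologies_alt[OF homeomorphic_cell]) auto
    moreover have "\<phi> ` standard_simplex k \<inter> (topspace L - L') = topspace L - L'"
      using cover by auto
    ultimately show "homeomorphic_map ?D' ?L' \<phi>"
      by (simp add: subtopology_subtopology)
    show "?C - ?B \<subseteq> topspace ?D'"
      by (auto simp: collar_def)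
    show "\<phi> ` (?C - ?B) = cell_collar - L'"
      using mem_L'_iff by (auto simp: cell_collar_def collar_def)
  qed
  have contD': "continuous_map ?D' L \<phi>"
    using cont by (rule continuous_map_from_subtopology)
  \<comment> \<open>The naturality square of the excisions: three of its sides are bijective, hence
    so is the fourth.\<close>
  have "hom_induced p ?D ?C L cell_collar \<phi> \<circ> hom_induced p ?D' (?C - ?B) ?D ?C id =
      hom_induced p ?D' (?C - ?B) L cell_collar (\<phi> \<circ> id)"
    using cont by (intro hom_induced_compose[symmetric])
        (auto simp: cell_collar_def continuous_map_from_subtopology)
  also have "\<dots> = hom_induced p ?D' (?C - ?B) L cell_collar (id \<circ> \<phi>)"
    by simp
  also have "\<dots> = hom_induced p ?L' (cell_collar - L') L cell_collar id \<circ> hom_induced p ?D' (?C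
      - ?B) ?L' (cell_collar - L') \<phi>"
    using contD' mem_L'_iff cover
    by (intro hom_induced_compose) (auto simp: cell_collar_def continuous_map_from_subtopology
        continuous_map_in_subtopology collar_def)
  finally have "bij_betw (hom_induced p ?D ?C L cell_collar \<phi> \<circ> hom_induced p ?D' (?C - ?B) ?D ?C id)
      (carrier (?H ?D' (?C - ?B))) (carrier (?H L cell_collar))"
    using bij_betw_trans[OF c d] by simp
  then have f: "bij_betw (hom_induced p ?D ?C L cell_collar \<phi>) (carrier (?H ?D ?C)) (carrier (?H L
      cell_collar))"
    using bij_betw_comp_iff[OF b] by blast
  \<comment> \<open>The same argument for the square of inclusions into the collar pairs.\<close>
  have "hom_induced p L L' L cell_collar id \<circ> hom_induced p ?D ?B L L' \<phi> = hom_induced p ?D ?B L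
      cell_collar (id \<circ> \<phi>)"
    using cont bd by (intro hom_induced_compose[symmetric]) (auto simp: cell_collar_def)
  also have "\<dots> = hom_induced p ?D ?B L cell_collar (\<phi> \<circ> id)"
    by simp
  also have "\<dots> = hom_induced p ?D ?C L cell_collar \<phi> \<circ> hom_induced p ?D ?B ?D ?C id"
    using cont subsetD[OF boundary_subset_collar[of k]] by (intro hom_induced_compose)
        (auto simp: cell_collar_def)
  finally have "bij_betw (hom_induced p L L' L cell_collar id \<circ> hom_induced p ?D ?B L L' \<phi>) (carrier
      (?H ?D ?B)) (carrier (?H L cell_collar))"
    using bij_betw_trans[OF a f] by simp
  moreover have "hom_induced p ?D ?B L L' \<phi> \<in> carrier (?H ?D ?B) \<rightarrow> carrier (?H L L')"
    by (simp add: hom_induced_carrier)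
  ultimately have "bij_betw (hom_induced p ?D ?B L L' \<phi>) (carrier (?H ?D ?B)) (carrier (?H L L'))"
    using bij_betw_comp_iff2[OF e, of "hom_induced p ?D ?B L L' \<phi>" "carrier (?H ?D ?B)"] by auto
  then show ?thesis
    by (simp add: iso_def hom_induced_hom)
qed

text \<open>Surjectivity of \<open>cell_iso\<close> in terms of chains; injectivity follows in the
  next lemma.\<close>

lemma relcycle_homologous_to_cell:
  assumes "singular_relcycle p L L' z"
  obtains y where "singular_relcycle p (simplex_space k) (simplex_boundary k) y"
    "homologous_rel p L L' z (chain_map p \<phi> y)"
proof -
  have "homologous_rel_set p L L' z \<in> carrier (relative_homology_group (int p) L L')"
    using assms by (auto simp: carrier_relative_homology_group)
  then have "homologous_rel_set p L L' z \<in> hom_induced (int p) (simplex_space k)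
      (simplex_boundary k) L L' \<phi> `
      carrier (relative_homology_group (int p) (simplex_space k) (simplex_boundary k))"
    using cell_iso[of "int p"] by (simp add: iso_def bij_betw_def)
  then obtain c where
    "homologous_rel_set p L L' z = hom_induced (int p) (simplex_space k) (simplex_boundary k) L L' \<phi> c"
    "c \<in> carrier (relative_homology_group (int p) (simplex_space k) (simplex_boundary k))"
    by (rule imageE)
  then obtain y where y: "singular_relcycle p (simplex_space k) (simplex_boundary k) y"
    "hom_induced (int p) (simplex_space k) (simplex_boundary k) L L' \<phi>
        (homologous_rel_set p (simplex_space k) (simplex_boundary k) y) = homologous_rel_set p L L' z"
    by (auto simp: carrier_relative_homology_group)
  then have "homologous_rel_set p L L' z = homologous_rel_set p L L' (chain_map p \<phi> y)"
    using hom_induced_chain_map[OF cont _ y(1), of L'] bd by auto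
  then show ?thesis
    using that y(1) by (simp add: homologous_rel_set_eq)
qed

lemma cell_relboundary_injective:
  assumes y: "singular_relcycle p (simplex_space k) (simplex_boundary k) y"
    and "singular_relboundary p L L' (chain_map p \<phi> y)"
  shows "singular_relboundary p (simplex_space k) (simplex_boundary k) y"
proof -
  let ?D = "simplex_space k" and ?B = "simplex_boundary k"
  let ?h = "hom_induced (int p) ?D ?B L L' \<phi>"
  have im: "\<phi> \<in> ?B \<rightarrow> L'"
    using bd by auto
  have 0: "singular_relcycle p ?D ?B 0"
    by simp
  have "?h (homologous_rel_set p ?D ?B y) = homologous_rel_set p L L' (chain_map p \<phi> y)"
    by (rule hom_induced_chain_map[OF cont im y])
  also have "\<dots> = homologous_rel_set p L L' 0"
  proof -
    have "homologous_rel p L L' (chain_map p \<phi> y) 0"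
      using assms(2) by (simp add: homologous_rel_def)
    then show ?thesis
      by (simp only: homologous_rel_set_eq)
  qed
  also have "\<dots> = ?h (homologous_rel_set p ?D ?B 0)"
    using hom_induced_chain_map[OF cont im 0] by simp
  finally have "homologous_rel_set p ?D ?B y = homologous_rel_set p ?D ?B 0"
    using cell_iso[of "int p"] y 0 
    by (auto simp: iso_def bij_betw_def carrier_relative_homology_group dest: inj_onD)
  then have "homologous_rel p ?D ?B y 0"
    by (simp only: homologous_rel_set_eq)
  then show ?thesis
    by (simp add: homologous_rel_def)
qed

end

section \<open>Relative homology of a simplex modulo its boundary\<close>

definition id_simplex :: "nat \<Rightarrow> (nat \<Rightarrow> real) chain" where
  "id_simplex k = frag_of (restrict id (standard_simplex k))"

text \<open>The straight-line contraction to \<open>v\<close>. The comparison is with the constant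
  chain rather than with zero, which keeps degree \<open>0\<close> included.\<close>

lemma star_shaped_homologous_const:
  fixes S :: "(nat \<Rightarrow> real) set"
  assumes v: "v \<in> S" and star: "\<And>x t. x \<in> S \<Longrightarrow> 0 \<le> t \<Longrightarrow> t \<le> 1 \<Longrightarrow> (\<lambda>i. (1 - t) * x i + t * v i) \<in> S"
    and z: "singular_chain q (subtopology (powertop_real UNIV) S) z" "chain_boundary q z = 0"
  shows "homologous_rel q (subtopology (powertop_real UNIV) S) {} z (chain_map q (\<lambda>_. v) z)"
proof -
  let ?X = "subtopology (powertop_real UNIV) S"
  let ?I = "top_of_set {0..1::real}"
  have t: "continuous_map (prod_topology ?I ?X) euclideanreal fst"
    using continuous_map_fst[of ?I ?X] by (simp add: continuous_map_in_subtopology)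
  have x: "continuous_map (prod_topology ?I ?X) euclideanreal (\<lambda>p. snd p i)" for i
  proof -
    have "continuous_map ?X euclideanreal (\<lambda>x. x i)"
      by (intro continuous_map_from_subtopology continuous_map_product_projection) simp
    from continuous_map_compose[OF continuous_map_snd this] show ?thesis
      by (simp add: comp_def)
  qed
  have "continuous_map (prod_topology ?I ?X) euclideanreal (\<lambda>p. (1 - fst p) * snd p i + fst p * v i)"
      for i
    using t x[of i] by (intro continuous_intros) auto
  then have "continuous_map (prod_topology ?I ?X) ?X (\<lambda>p i. (1 - fst p) * snd p i + fst p * v i)"
    using star by (auto simp: continuous_map_in_subtopology continuous_map_componentwise)
  then have "homotopic_with (\<lambda>h. h \<in> {} \<rightarrow> {}) ?X ?X id (\<lambda>_. v)"
    unfolding homotopic_with_def by (intro exI[of _ "\<lambda>p i. (1 - fst p) * snd p i + fst p * v i"]) auto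
  then have "homologous_rel q ?X {} (chain_map q id z) (chain_map q (\<lambda>_. v) z)"
    by (rule homotopic_imp_homologous_rel_chain_maps) (use z in \<open>simp add: singular_cycle\<close>)
  then show ?thesis
    using z(1) by (simp add: chain_map_ident)
qed

text \<open>In degree \<open>0\<close> a cycle need not bound. Being the boundary of a chain
  \<open>y\<close> in some space \<open>X\<close> suffices, because the image of \<open>y\<close>
  under the constant map then bounds the constant chain.\<close>

lemma star_shaped_boundary:
  fixes S :: "(nat \<Rightarrow> real) set"
  assumes v: "v \<in> S" and star: "\<And>x t. x \<in> S \<Longrightarrow> 0 \<le> t \<Longrightarrow> t \<le> 1 \<Longrightarrow> (\<lambda>i. (1 - t) * x i + t * v i) \<in> S"
    and u: "singular_chain q (subtopology (powertop_real UNIV) S) (chain_boundary (Suc q) y)"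
    and y: "singular_chain (Suc q) X y"
  shows "singular_relboundary q (subtopology (powertop_real UNIV) S) {} (chain_boundary (Suc q) y)"
proof -
  let ?X = "subtopology (powertop_real UNIV) S"
  have "chain_boundary q (chain_boundary (Suc q) y) = 0"
    using chain_boundary_boundary_alt[OF y] by (cases q) (auto simp: chain_boundary_def)
  from star_shaped_homologous_const[OF v star u this]
  have 1: "homologous_rel q ?X {} (chain_boundary (Suc q) y) (chain_map q (\<lambda>_. v) (chain_boundary (Suc
      q) y))" .
  have "chain_map q (\<lambda>_. v) (chain_boundary (Suc q) y) = chain_boundary (Suc q) (chain_map (Suc q)
      (\<lambda>_. v) y)"
    using chain_boundary_chain_map[OF y, of "\<lambda>_. v"] by simp
  moreover have "singular_chain (Suc q) ?X (chain_map (Suc q) (\<lambda>_. v) y)"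
    using v by (intro singular_chain_chain_map[OF y]) auto
  ultimately have "singular_relboundary q ?X {} (chain_map q (\<lambda>_. v) (chain_boundary (Suc q) y))"
    by (auto simp: singular_boundary)
  from singular_relboundary_add[OF 1[unfolded homologous_rel_def] this] show ?thesis
    by simp
qed

lemma star_shaped_cycle:
  fixes S :: "(nat \<Rightarrow> real) set"
  assumes v: "v \<in> S" and star: "\<And>x t. x \<in> S \<Longrightarrow> 0 \<le> t \<Longrightarrow> t \<le> 1 \<Longrightarrow> (\<lambda>i. (1 - t) * x i + t * v i) \<in> S"
    and z: "singular_chain q (subtopology (powertop_real UNIV) S) z" "chain_boundary q z = 0"
        and q: "q \<ge> 1"
  shows "singular_relboundary q (subtopology (powertop_real UNIV) S) {} z"
proof -
  let ?X = "subtopology (powertop_real UNIV) S"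
  let ?V = "subtopology (powertop_real UNIV) {v}"
  have "singular_relcycle q ?V {} (chain_map q (\<lambda>_. v) z)"
    using z by (intro singular_relcycle_chain_map[of q ?X "{}"]) (auto simp: singular_cycle)
  then have "singular_relboundary q ?V {} (chain_map q (\<lambda>_. v) z)"
    using singular_boundary_eq_cycle_singleton[of ?V v q] q by simp
  then have "singular_relboundary q ?X {} (chain_map q (\<lambda>_. v) z)"
    using v by (intro singular_boundary_mono[where T = "{v}" and S = S]) simp_all
  moreover have "homologous_rel q ?X {} z (chain_map q (\<lambda>_. v) z)"
    by (rule star_shaped_homologous_const[OF v star z])
  ultimately show ?thesis
    using singular_relboundary_add[of q ?X "{}" "z - chain_map q (\<lambda>_. v) z" "chain_map q (\<lambda>_. v) z"]
    by (simp add: homologous_rel_def)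
qed

lemma standard_simplex_star_shaped:
  assumes "x \<in> standard_simplex k" "v \<in> standard_simplex k" "0 \<le> t" "t \<le> 1"
  shows "(\<lambda>i. (1 - t) * x i + t * v i) \<in> standard_simplex k"
  using convex_standard_simplex[OF assms(1,2), of t] assms(3,4) by (simp add: add.commute)

text \<open>The union of the facets containing vertex \<open>0\<close>, hence star-shaped about it.
  The only facet left out is the one opposite to vertex \<open>0\<close>.\<close>

definition horn :: "nat \<Rightarrow> (nat \<Rightarrow> real) set" where
  "horn k = {x \<in> standard_simplex k. \<exists>i\<in>{1..k}. x i = 0}"

abbreviation vertex0 :: "nat \<Rightarrow> real" where
  "vertex0 \<equiv> \<lambda>i. if i = 0 then 1 else 0"

lemma horn_subset_boundary: "horn k \<subseteq> simplex_boundary k"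
  by (auto simp: horn_def simplex_boundary_def)

lemma horn_star_shaped:
  assumes "x \<in> horn k" "0 \<le> t" "t \<le> 1"
  shows "(\<lambda>i. (1 - t) * x i + t * vertex0 i) \<in> horn k"
proof -
  have "vertex0 \<in> standard_simplex k"
    by simp
  then have "(\<lambda>i. (1 - t) * x i + t * vertex0 i) \<in> standard_simplex k"
    using assms by (intro standard_simplex_star_shaped) (auto simp: horn_def)
  moreover obtain i where "i \<in> {1..k}" "x i = 0"
    using assms by (auto simp: horn_def)
  ultimately show ?thesis
    unfolding horn_def by (intro CollectI conjI bexI[of _ i]) auto
qed

lemma vertex0_in_horn: "vertex0 \<in> horn (Suc k)"
  by (auto simp: horn_def intro!: bexI[of _ 1])

lemma closedin_horn: "closedin (simplex_space k) (horn k)"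
proof -
  have "closedin (simplex_space k) {x \<in> topspace (simplex_space k). x i \<in> {0}}" for i
    by (rule closedin_continuous_map_preimage[OF continuous_map_coord]) simp
  then have "closedin (simplex_space k) (\<Union>i\<in>{1..k}. {x \<in> topspace (simplex_space k). x i \<in> {0}})"
    by (intro closedin_Union) auto
  moreover have "(\<Union>i\<in>{1..k}. {x \<in> topspace (simplex_space k). x i \<in> {0}}) = horn k"
    by (auto simp: horn_def)
  ultimately show ?thesis
    by simp
qed

lemma Hausdorff_simplex_space: "Hausdorff_space (simplex_space k)"
  by (intro Hausdorff_space_subtopology) (simp add: Hausdorff_space_product_topology)

lemma simplical_face_mem:
  "x \<in> standard_simplex k \<Longrightarrow> i \<le> Suc k \<Longrightarrow> simplical_face i x \<in> standard_simplex (Suc k)"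
  using simplical_face_in_standard_simplex[of "Suc k" i x] by simp

text \<open>The link between consecutive dimensions: the boundary of a simplex is a contractible
  horn with one cell, the facet \<open>0\<close>, attached.\<close>

lemma boundary_cell_attachment:
  "cell_attachment (subtopology (powertop_real UNIV) (simplex_boundary (Suc k))) (horn (Suc k)) k
      (simplical_face 0)"
proof
  let ?L = "subtopology (powertop_real UNIV) (simplex_boundary (Suc k))"
  have eq: "?L = subtopology (simplex_space (Suc k)) (simplex_boundary (Suc k))"
    by (simp add: subtopology_subtopology simplex_boundary_def inf_absorb2 subset_iff Int_def
        conj_commute cong: conj_cong)
  show "Hausdorff_space ?L"
    unfolding eq by (intro Hausdorff_space_subtopology Hausdorff_simplex_space)
  show "closedin ?L (horn (Suc k))"
    unfolding eq by (rule closedin_subset_topspace[OF closedin_horn horn_subset_boundary])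
  have face_bd: "simplical_face 0 x \<in> simplex_boundary (Suc k)" if "x \<in> standard_simplex k" for x
    using simplical_face_mem[OF that, of 0] by (auto simp: simplex_boundary_def simplical_face_def)
  have "continuous_map (simplex_space k) (simplex_space (Suc k)) (simplical_face 0)"
    by (rule continuous_map_eq[OF continuous_map_vertex_map[of k "skip 0" "Suc k"]])
      (auto simp: skip_def simplical_face_eq_vertex_map)
  then show "continuous_map (simplex_space k) ?L (simplical_face 0)"
    using face_bd by (auto simp: continuous_map_in_subtopology)
  show "inj_on (simplical_face 0) (standard_simplex k)"
  proof (rule inj_onI)
    fix x y :: "nat \<Rightarrow> real"
    assume "simplical_face 0 x = simplical_face 0 y"
    then have "simplical_face 0 x (Suc i) = simplical_face 0 y (Suc i)" for i
      by simp
    then show "x = y"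
      by (auto simp: simplical_face_def)
  qed
  show "simplical_face 0 ` simplex_boundary k \<subseteq> horn (Suc k)"
  proof clarify
    fix x assume "x \<in> simplex_boundary k"
    then obtain i where "x \<in> standard_simplex k" "i \<le> k" "x i = 0"
      by (auto simp: simplex_boundary_def)
    then show "simplical_face 0 x \<in> horn (Suc k)"
      using simplical_face_mem[of x k 0] by (auto simp: horn_def simplical_face_def intro!: bexI[of _
          "Suc i"])
  qed
  show "simplical_face 0 ` open_simplex k \<inter> horn (Suc k) = {}"
  proof (intro equals0I, elim IntE imageE)
    fix y x assume y: "y \<in> horn (Suc k)" "y = simplical_face 0 x" and x: "x \<in> open_simplex k"
    then obtain i where "1 \<le> i" "i \<le> Suc k" "x (i - 1) = 0"
      by (auto simp: horn_def simplical_face_def split: if_splits)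
    moreover from this have "i - 1 \<le> k"
      by simp
    then have "0 < x (i - 1)"
      using x unfolding open_simplex_def by blast
    ultimately show False
      by simp
  qed
  show "topspace ?L = horn (Suc k) \<union> simplical_face 0 ` standard_simplex k"
  proof
    show "topspace ?L \<subseteq> horn (Suc k) \<union> simplical_face 0 ` standard_simplex k"
    proof
      fix x assume "x \<in> topspace ?L"
      then obtain i where x: "x \<in> standard_simplex (Suc k)" "i \<le> Suc k" "x i = 0"
        by (auto simp: simplex_boundary_def)
      show "x \<in> horn (Suc k) \<union> simplical_face 0 ` standard_simplex k"
      proof (cases "i = 0")
        case True
        have "(\<Sum>j\<le>Suc k. x j) = (\<Sum>j\<le>k. x (Suc j))"
          using x True by (simp add: sum.atMost_Suc_shift del: sum.atMost_Suc)
        then have "(\<lambda>j. x (Suc j)) \<in> standard_simplex k"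
          using x by (auto simp: standard_simplex_def)
        moreover have "simplical_face 0 (\<lambda>j. x (Suc j)) = x"
          using x True by (auto simp: simplical_face_def fun_eq_iff)
        ultimately show ?thesis
          by force
      next
        case False
        then show ?thesis
          using x by (auto simp: horn_def)
      qed
    qed
    show "horn (Suc k) \<union> simplical_face 0 ` standard_simplex k \<subseteq> topspace ?L"
      using face_bd horn_subset_boundary by auto
  qed
qed

lemma singular_chain_id_simplex: "singular_chain k (simplex_space k) (id_simplex k)"
  by (simp add: id_simplex_def singular_chain_of singular_simplex_def)

lemma chain_map_id_simplex: "chain_map k f (id_simplex k) = frag_of (restrict f (standard_simplex k))"
  by (auto simp: id_simplex_def simplex_map_def intro!: arg_cong[where f = frag_of] restrict_ext)

lemma singular_face_id:
  "singular_face (Suc k) i id = restrict (simplical_face i) (standard_simplex k)"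
  by (simp add: singular_face_def)

lemma chain_boundary_id_simplex:
  "chain_boundary (Suc k) (id_simplex (Suc k)) =
    chain_map k (simplical_face 0) (id_simplex k) +
    (\<Sum>i\<in>{1..Suc k}. frag_cmul ((-1) ^ i) (frag_of (restrict (simplical_face i) (standard_simplex k))))"
proof -
  have "chain_boundary (Suc k) (id_simplex (Suc k)) =
      (\<Sum>i\<in>{..Suc k}. frag_cmul ((-1) ^ i) (frag_of (restrict (simplical_face i) (standard_simplex k))))"
    unfolding id_simplex_def chain_boundary_of by (simp add: singular_face_id del: sum.atMost_Suc)
  also have "{..Suc k} = insert 0 {1..Suc k}"
    by auto
  also have "sum f (insert 0 {1..Suc k}) = f 0 + sum f {1..Suc k}" for f :: "nat \<Rightarrow> (nat \<Rightarrow> real) chain"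
    by (subst sum.insert) auto
  finally show ?thesis
    by (simp only: chain_map_id_simplex power_0 frag_cmul_one)
qed

lemma other_faces_in_horn:
  "singular_chain k (subtopology (powertop_real UNIV) (horn (Suc k)))
    (\<Sum>i\<in>{1..Suc k}. frag_cmul ((-1) ^ i) (frag_of (restrict (simplical_face i) (standard_simplex k))))"
proof (intro singular_chain_sum singular_chain_cmul)
  fix i assume i: "i \<in> {1..Suc k}"
  have "singular_simplex k (simplex_space (Suc k)) (restrict (simplical_face i) (standard_simplex k))"
    using singular_simplex_singular_face[of "Suc k" "simplex_space (Suc k)" "restrict id
        (standard_simplex (Suc k))" i] i
      singular_chain_id_simplex[of "Suc k"]
    by (simp add: singular_face_id singular_chain_of id_simplex_def)
  moreover have "simplical_face i x \<in> horn (Suc k)" if "x \<in> standard_simplex k" for x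
    using simplical_face_mem[OF that, of i] i by (auto simp: horn_def simplical_face_def intro!:
        bexI[of _ i])
  ultimately show "singular_chain k (subtopology (powertop_real UNIV) (horn (Suc k))) (frag_of
      (restrict (simplical_face i) (standard_simplex k)))"
    by (auto simp: singular_chain_of singular_simplex_subtopology)
qed

lemma subspace_of_simplex_space: "S \<subseteq> standard_simplex k \<Longrightarrow> subtopology
    (simplex_space k) S = subtopology (powertop_real UNIV) S"
  by (simp add: subtopology_subtopology inf_absorb2)

lemma simplex_boundary_subset: "simplex_boundary k \<subseteq> standard_simplex k"
  by (auto simp: simplex_boundary_def)

lemma simplex_boundary_0: "simplex_boundary 0 = {}"
  by (auto simp: simplex_boundary_def standard_simplex_def)

lemma relcycle_id_simplex: "singular_relcycle k (simplex_space k) (simplex_boundary k) (id_simplex k)"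
proof (cases k)
  case 0
  then show ?thesis
    using singular_chain_id_simplex[of 0] by (simp add: simplex_boundary_0 singular_cycle
        chain_boundary_def)
next
  case (Suc j)
  have "singular_chain j (subtopology (powertop_real UNIV) (simplex_boundary (Suc j))) (chain_map j
      (simplical_face 0) (id_simplex j))"
    by (rule singular_chain_chain_map[OF singular_chain_id_simplex]) (rule cell_attachment.cont[OF
        boundary_cell_attachment])
  moreover have "singular_chain j (subtopology (powertop_real UNIV) (simplex_boundary (Suc j)))
    (\<Sum>i\<in>{1..Suc j}. frag_cmul ((-1) ^ i) (frag_of (restrict (simplical_face i) (standard_simplex j))))"
    by (rule singular_chain_mono[OF other_faces_in_horn horn_subset_boundary])
  ultimately show ?thesis
    using singular_chain_id_simplex[of "Suc j"]
    by (simp add: Suc singular_relcycle subspace_of_simplex_space[OF simplex_boundary_subset]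
        chain_boundary_id_simplex singular_chain_add)
qed

text \<open>Induction on \<open>k\<close>: modulo the horn, the boundary of \<open>y\<close> is
  \<open>m\<close> times the facet \<open>0\<close>. Subtracting \<open>m\<close> copies of
  \<open>id_simplex\<close> moves the boundary into the horn, where it bounds, and the simplex is
  contractible.\<close>

theorem simplex_relcycle_generated:
  assumes "singular_relcycle p (simplex_space k) (simplex_boundary k) y"
  shows "\<exists>m. (p \<noteq> k \<longrightarrow> m = 0) \<and>
    homologous_rel p (simplex_space k) (simplex_boundary k) y (frag_cmul m (id_simplex k))"
  using assms
proof (induction k arbitrary: p y)
  case 0
  let ?a = "\<lambda>j. if j = 0 then 1 else 0 :: real"
  have top: "topspace (simplex_space 0) = {?a}"
    by (simp add: standard_simplex_0)
  show ?case
  proof (cases "p = 0")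
    case True
    then obtain b where "y = frag_cmul b (frag_of (restrict (\<lambda>x. ?a) (standard_simplex 0)))"
      using 0 singular_chain_singleton[OF top, of 0 y] by (auto simp: singular_relcycle)
    moreover have "restrict (\<lambda>x. ?a) (standard_simplex 0) = restrict id (standard_simplex 0)"
      by (rule restrict_ext) (simp add: standard_simplex_0)
    ultimately show ?thesis
      using True by (intro exI[of _ b]) (simp add: id_simplex_def)
  next
    case False
    then have "singular_relboundary p (simplex_space 0) {} y"
      using 0 singular_boundary_eq_cycle_singleton[OF top, of p y] by (simp add: simplex_boundary_0)
    then show ?thesis
      by (intro exI[of _ 0]) (simp add: homologous_rel_def simplex_boundary_0)
  qed
next
  case (Suc k)
  let ?T = "simplex_space (Suc k)" and ?B = "simplex_boundary (Suc k)"
      and ?P = "powertop_real (UNIV :: nat set)"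
  have B: "subtopology ?T ?B = subtopology ?P ?B"
    by (rule subspace_of_simplex_space[OF simplex_boundary_subset])
  have v: "vertex0 \<in> standard_simplex (Suc k)"
    by simp
  have y: "singular_chain p ?T y" "singular_chain (p - 1) (subtopology ?P ?B) (chain_boundary p y)"
    using Suc.prems by (auto simp: singular_relcycle B)
  show ?case
  proof (cases p)
    case 0
    have "homologous_rel 0 ?T {} y (chain_map 0 (\<lambda>_. vertex0) y)"
      using y 0 v standard_simplex_star_shaped[OF _ v]
      by (intro star_shaped_homologous_const) (auto simp: chain_boundary_def)
    then obtain d where d: "singular_chain (Suc 0) ?T d" "chain_boundary (Suc 0) d = y
        - chain_map 0 (\<lambda>_. vertex0) y"
      by (auto simp: homologous_rel_def singular_boundary)
    have "vertex0 \<in> ?B"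
      using vertex0_in_horn horn_subset_boundary by blast
    then have "singular_chain 0 (subtopology ?T ?B) (chain_map 0 (\<lambda>_. vertex0) y)"
      unfolding B using y 0 by (intro singular_chain_chain_map[of 0 ?T]) auto
    then have "singular_relboundary 0 ?T ?B y"
      unfolding singular_relboundary using d
      by (intro exI[of _ d] exI[of _ "chain_map 0 (\<lambda>_. vertex0) y"]) auto
    then show ?thesis
      using 0 by (intro exI[of _ 0]) (simp add: homologous_rel_def)
  next
    case (Suc q)
    let ?L = "subtopology ?P ?B" and ?H = "horn (Suc k)"
    interpret c: cell_attachment ?L ?H k "simplical_face 0"
      by (rule boundary_cell_attachment)
    have LH: "subtopology ?L ?H = subtopology ?P ?H"
      using horn_subset_boundary by (simp add: subtopology_subtopology inf_absorb2)
    have "chain_boundary q (chain_boundary (Suc q) y) = 0"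
      using chain_boundary_boundary_alt[of q ?T y] y Suc by (cases q) (auto simp: chain_boundary_def)
    then have "singular_relcycle q ?L ?H (chain_boundary (Suc q) y)"
      using y Suc by (simp add: singular_relcycle)
    then obtain y' where y': "singular_relcycle q (simplex_space k) (simplex_boundary k) y'"
      "homologous_rel q ?L ?H (chain_boundary (Suc q) y) (chain_map q (simplical_face 0) y')"
      by (rule c.relcycle_homologous_to_cell)
    obtain m where m: "q \<noteq> k \<longrightarrow> m = 0"
      "homologous_rel q (simplex_space k) (simplex_boundary k) y' (frag_cmul m (id_simplex k))"
      using Suc.IH[OF y'(1)] by blast
    have "homologous_rel q ?L ?H (chain_map q (simplical_face 0) y') (chain_map q
        (simplical_face 0) (frag_cmul m (id_simplex k)))"
      using singular_relboundary_chain_map[OF m(2)[unfolded homologous_rel_def] c.cont] c.bd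
      by (auto simp: homologous_rel_def chain_map_diff)
    then have "homologous_rel q ?L ?H (chain_boundary (Suc q) y) (chain_map q
        (simplical_face 0) (frag_cmul m (id_simplex k)))"
      using y'(2) homologous_rel_trans by blast
    then obtain w u where w: "singular_chain (Suc q) ?L w" and u: "singular_chain q (subtopology ?P
        ?H) u"
      and wu: "chain_boundary (Suc q) w + u = chain_boundary (Suc q) y - chain_map q
          (simplical_face 0) (frag_cmul m (id_simplex k))"
      unfolding homologous_rel_def singular_relboundary LH by blast
    \<comment> \<open>If \<open>q \<noteq> k\<close>, then \<open>m = 0\<close>, so this is the zero
      chain and the mismatch of degrees does no harm.\<close>
    define I where "I = frag_cmul m (id_simplex (Suc k))"
    define r where "r = frag_cmul m (\<Sum>i\<in>{1..Suc k}. frag_cmul ((-1) ^ i) (frag_of (restrict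
        (simplical_face i) (standard_simplex k))))"
    have I: "singular_chain (Suc q) ?T I"
      using m(1) singular_chain_id_simplex[of "Suc k"] by (cases "q = k")
          (auto simp: I_def singular_chain_cmul)
    have r: "singular_chain q (subtopology ?P ?H) r"
      using m(1) other_faces_in_horn[of k] unfolding r_def by (cases "q = k")
          (auto intro: singular_chain_cmul)
    have bI: "chain_boundary (Suc q) I = chain_map q (simplical_face 0) (frag_cmul m (id_simplex k))
        + r"
      using m(1) by (cases "q = k") (auto simp: I_def r_def chain_boundary_cmul
          chain_boundary_id_simplex frag_cmul_distrib2)
    \<comment> \<open>The chain \<open>w\<close> lies in the boundary, so subtracting it is free
      relatively; it makes the boundary of \<open>y2\<close> lie in the horn.\<close>
    define y2 where "y2 = y - I - w"
    have wT: "singular_chain (Suc q) ?T w"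
      using w singular_chain_mono[OF _ simplex_boundary_subset] by blast
    then have y2: "singular_chain (Suc q) ?T y2"
      using y(1) I Suc by (simp add: y2_def singular_chain_diff)
    have by2: "chain_boundary (Suc q) y2 = u - r"
    proof -
      have "chain_boundary (Suc q) y2 = chain_boundary (Suc q) y - chain_boundary (Suc q) I
          - chain_boundary (Suc q) w"
        by (simp only: y2_def chain_boundary_diff)
      also have "chain_boundary (Suc q) y =
          chain_boundary (Suc q) w + u + chain_map q (simplical_face 0) (frag_cmul m (id_simplex k))"
        unfolding wu by simp
      finally show ?thesis
        unfolding bI by simp
    qed
    have "singular_relboundary q (subtopology ?P ?H) {} (chain_boundary (Suc q) y2)"
      using u r y2 by (intro star_shaped_boundary[OF vertex0_in_horn horn_star_shaped]) (auto simp: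
          by2 singular_chain_diff)
    then obtain u2 where u2: "singular_chain (Suc q) (subtopology ?P ?H) u2" "chain_boundary (Suc q)
        u2 = chain_boundary (Suc q) y2"
      by (auto simp: singular_boundary)
    have u2B: "singular_chain (Suc q) (subtopology ?P ?B) u2"
      using u2(1) singular_chain_mono[OF _ horn_subset_boundary] by blast
    have u2T: "singular_chain (Suc q) ?T u2"
      using u2B singular_chain_mono[OF _ simplex_boundary_subset] by blast
    \<comment> \<open>Closing \<open>y2\<close> up by a chain of the horn yields an absolute cycle
      of positive degree, and it bounds in the star-shaped simplex.\<close>
    have "singular_relboundary (Suc q) ?T {} (y2 - u2)"
      using y2 u2T u2(2) standard_simplex_star_shaped[OF _ v]
      by (intro star_shaped_cycle[OF v]) (auto simp: singular_chain_diff chain_boundary_diff)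
    then obtain d where d: "singular_chain (Suc (Suc q)) ?T d" "chain_boundary (Suc (Suc q)) d = y2
        - u2"
      by (auto simp: singular_boundary)
    have "singular_relboundary p ?T ?B (y - I)"
      unfolding singular_relboundary Suc B
      using d singular_chain_add[OF w u2B] by (intro exI[of _ d] exI[of _ "w + u2"]) (auto simp: y2_def)
    then show ?thesis
      using m(1) Suc by (intro exI[of _ m]) (auto simp: homologous_rel_def I_def)
  qed
qed

text \<open>Taking boundaries modulo the horn turns the relation into one for the facet
  \<open>0\<close>, and injectivity of the cell isomorphism lowers the dimension. On a point no
  nonzero \<open>0\<close>-chain bounds.\<close>

theorem simplex_generator_infinite_order:
  assumes "singular_relboundary k (simplex_space k) (simplex_boundary k) (frag_cmul m (id_simplex k))"
  shows "m = 0"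
  using assms
proof (induction k)
  case 0
  let ?a = "\<lambda>j. if j = 0 then 1 else 0 :: real"
  have top: "topspace (simplex_space 0) = {?a}"
    by (simp add: standard_simplex_0)
  have "frag_cmul m (id_simplex 0) = 0"
    using 0 singular_boundary_singleton[OF top, of 0] by (simp add: simplex_boundary_0)
  then show ?case
    by (simp add: id_simplex_def frag_cmul_eq_0_iff)
next
  case (Suc k)
  let ?T = "simplex_space (Suc k)" and ?B = "simplex_boundary (Suc k)"
      and ?P = "powertop_real (UNIV :: nat set)"
  let ?L = "subtopology ?P ?B" and ?H = "horn (Suc k)"
  interpret c: cell_attachment ?L ?H k "simplical_face 0"
    by (rule boundary_cell_attachment)
  have B: "subtopology ?T ?B = ?L"
    by (rule subspace_of_simplex_space[OF simplex_boundary_subset])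
  have LH: "subtopology ?L ?H = subtopology ?P ?H"
    using horn_subset_boundary by (simp add: subtopology_subtopology inf_absorb2)
  obtain d e where d: "singular_chain (Suc (Suc k)) ?T d" and e: "singular_chain (Suc k) ?L e"
    and de: "chain_boundary (Suc (Suc k)) d + e = frag_cmul m (id_simplex (Suc k))"
    using Suc.prems unfolding singular_relboundary B by blast
  define r where "r = frag_cmul m (\<Sum>i\<in>{1..Suc k}. frag_cmul ((-1) ^ i) (frag_of (restrict
      (simplical_face i) (standard_simplex k))))"
  have "chain_boundary (Suc k) e = chain_boundary (Suc k) (frag_cmul m (id_simplex (Suc k)))"
    unfolding de[symmetric] using chain_boundary_boundary_alt[OF d] by (simp add: chain_boundary_add)
  also have "\<dots> = chain_map k (simplical_face 0) (frag_cmul m (id_simplex k)) + r"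
    by (simp add: chain_boundary_cmul chain_boundary_id_simplex frag_cmul_distrib2 r_def)
  finally have "chain_boundary (Suc k) e + - r = chain_map k
      (simplical_face 0) (frag_cmul m (id_simplex k))"
    by simp
  moreover have "singular_chain k (subtopology ?L ?H) (- r)"
    unfolding LH r_def by (intro singular_chain_minus[THEN iffD2] singular_chain_cmul
        other_faces_in_horn)
  ultimately have "singular_relboundary k ?L ?H (chain_map k
      (simplical_face 0) (frag_cmul m (id_simplex k)))"
    unfolding singular_relboundary using e by blast
  then have "singular_relboundary k (simplex_space k) (simplex_boundary k) (frag_cmul m (id_simplex k))"
    by (intro c.cell_relboundary_injective singular_relcycle_cmul relcycle_id_simplex)
  then show ?case
    by (rule Suc.IH)
qed

section \<open>Cycles in cell complexes\<close>

lemma open_simplex_subset: "open_simplex k \<subseteq> standard_simplex k"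
  by (auto simp: open_simplex_def)

lemma standard_simplex_split: "standard_simplex k = open_simplex k \<union> simplex_boundary k"
  using simplex_boundary_subset by (auto simp: open_simplex_eq)

lemma boundary_point_in_face:
  assumes "x \<in> standard_simplex (Suc k)" "i \<le> Suc k" "x i = 0"
  obtains y where "y \<in> standard_simplex k" "x = simplical_face i y"
proof -
  define y where "y j = x (skip i j)" for j
  have "(\<Sum>j\<le>k. y j) = sum x (skip i ` {..k})"
    unfolding y_def by (subst sum.reindex) (auto simp: inj_on_def skip_def comp_def split: if_splits)
  also have "skip i ` {..k} = {..Suc k} - {i}"
    using assms(2) by (auto simp: skip_atMost)
  also have "sum x ({..Suc k} - {i}) = sum x {..Suc k}"
    using assms by (simp add: sum_diff1)
  finally have "y \<in> standard_simplex k"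
    using assms by (auto simp: standard_simplex_def y_def skip_def)
  moreover have "x = simplical_face i y"
    using assms(3) by (auto simp: simplical_face_def y_def skip_def fun_eq_iff)
  ultimately show ?thesis
    using that by blast
qed

text \<open>Every codimension-one face, with its vertices in increasing order, equals a cell map as
  a function. So the cells span a subcomplex of the singular chain complex.\<close>

locale ordered_cell_complex =
  fixes Y :: "'b topology" and K :: "'c set" and sdim :: "'c \<Rightarrow> nat"
    and \<psi> :: "'c \<Rightarrow> (nat \<Rightarrow> real) \<Rightarrow> 'b"
  assumes Hausdorff: "Hausdorff_space Y"
    and simplex: "\<And>c. c \<in> K \<Longrightarrow> singular_simplex (sdim c) Y (\<psi> c)"
    and injective: "\<And>c. c \<in> K \<Longrightarrow> inj_on (\<psi> c) (standard_simplex (sdim c))"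
    and disjoint: "disjoint_family_on (\<lambda>c. \<psi> c ` open_simplex (sdim c)) K"
    and covering: "(\<Union>c\<in>K. \<psi> c ` open_simplex (sdim c)) = topspace Y"
    and face: "\<And>c k i. \<lbrakk>c \<in> K; sdim c = Suc k; i \<le> Suc k\<rbrakk> \<Longrightarrow>
          \<exists>c'\<in>K. sdim c' = k \<and> singular_face (Suc k) i (\<psi> c) = \<psi> c'"
    and weak: "\<And>A. \<lbrakk>A \<subseteq> topspace Y;
          \<And>c. c \<in> K \<Longrightarrow> closedin Y (A \<inter> \<psi> c ` standard_simplex (sdim c))\<rbrakk> \<Longrightarrow> closedin Y A"
begin

definition face_closed :: "'c set \<Rightarrow> bool" where
  "face_closed F \<longleftrightarrow> F \<subseteq> K \<and> (\<forall>c\<in>F. \<forall>k i. sdim c = Suc k \<longrightarrow> i \<le> Suc k \<longrightarrow>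
     (\<exists>c'\<in>F. sdim c' = k \<and> singular_face (Suc k) i (\<psi> c) = \<psi> c'))"

definition support :: "'c set \<Rightarrow> 'b set" where
  "support F = (\<Union>c\<in>F. \<psi> c ` standard_simplex (sdim c))"

lemma cell_cont: "c \<in> K \<Longrightarrow> continuous_map (simplex_space (sdim c)) Y (\<psi> c)"
  using simplex by (simp add: singular_simplex_def)

lemma cell_subset: "c \<in> K \<Longrightarrow> \<psi> c ` standard_simplex (sdim c) \<subseteq> topspace Y"
  using continuous_map_image_subset_topspace[OF cell_cont] by simp

lemma face_closed_boundary:
  assumes "face_closed F" "c \<in> F"
  shows "\<psi> c ` simplex_boundary (sdim c) \<subseteq> support {c' \<in> F. sdim c' < sdim c}"
proof clarify
  fix x assume x: "x \<in> simplex_boundary (sdim c)"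
  then obtain k where k: "sdim c = Suc k"
    using simplex_boundary_0 by (cases "sdim c") auto
  then obtain i where i: "x \<in> standard_simplex (Suc k)" "i \<le> Suc k" "x i = 0"
    using x by (auto simp: simplex_boundary_def)
  then obtain y where y: "y \<in> standard_simplex k" "x = simplical_face i y"
    by (rule boundary_point_in_face)
  obtain c' where c': "c' \<in> F" "sdim c' = k" "singular_face (Suc k) i (\<psi> c) = \<psi> c'"
    using assms k i unfolding face_closed_def by metis
  have "\<psi> c x = \<psi> c' y"
    using y by (simp add: singular_face_def flip: c'(3))
  then show "\<psi> c x \<in> support {c' \<in> F. sdim c' < sdim c}"
    using c' y k by (auto simp: support_def)
qed

lemma support_open_cells:
  assumes "face_closed F"
  shows "support F = (\<Union>c\<in>F. \<psi> c ` open_simplex (sdim c))"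
proof
  have "\<psi> c ` standard_simplex (sdim c) \<subseteq> (\<Union>c\<in>F. \<psi> c ` open_simplex (sdim c))" if "c \<in> F" for c
    using that
  proof (induction "sdim c" arbitrary: c rule: less_induct)
    case less
    have "\<psi> c ` simplex_boundary (sdim c) \<subseteq> support {c' \<in> F. sdim c' < sdim c}"
      by (rule face_closed_boundary[OF assms less.prems])
    also have "\<dots> \<subseteq> (\<Union>c\<in>F. \<psi> c ` open_simplex (sdim c))"
    proof -
      have "\<psi> c' ` standard_simplex (sdim c') \<subseteq> (\<Union>c\<in>F. \<psi> c ` open_simplex (sdim c))"
        if "c' \<in> F" "sdim c' < sdim c" for c'
        using less.hyps that by blast
      then show ?thesis
        unfolding support_def by (intro UN_least) blast
    qed
    finally show ?case
      using less.prems unfolding standard_simplex_split by auto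
  qed
  then show "support F \<subseteq> (\<Union>c\<in>F. \<psi> c ` open_simplex (sdim c))"
    unfolding support_def by (rule UN_least)
  show "(\<Union>c\<in>F. \<psi> c ` open_simplex (sdim c)) \<subseteq> support F"
    using open_simplex_subset by (fastforce simp: support_def)
qed

lemma closedin_cell: "c \<in> K \<Longrightarrow> closedin Y (\<psi> c ` standard_simplex (sdim c))"
  by (intro compactin_imp_closedin[OF Hausdorff] image_compactin[OF _ cell_cont])
    (simp add: compactin_subtopology compactin_standard_simplex)

lemma closedin_support: "finite F \<Longrightarrow> F \<subseteq> K \<Longrightarrow> closedin Y (support F)"
  unfolding support_def by (intro closedin_Union) (auto intro: closedin_cell)

lemma support_subset: "F \<subseteq> K \<Longrightarrow> support F \<subseteq> topspace Y"
  using cell_subset by (fastforce simp: support_def)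

lemma support_mono: "F \<subseteq> G \<Longrightarrow> support F \<subseteq> support G"
  by (auto simp: support_def)

lemma face_closed_Un: "(\<And>i. i \<in> I \<Longrightarrow> face_closed (F i)) \<Longrightarrow> face_closed (\<Union>i\<in>I. F i)"
  unfolding face_closed_def by (fastforce)

lemma face_closed_remove_max:
  assumes "face_closed F" "c \<in> F" "\<And>c'. c' \<in> F \<Longrightarrow> sdim c' \<le> sdim c"
  shows "face_closed (F - {c})"
  unfolding face_closed_def
proof (intro conjI ballI allI impI)
  fix c' k i assume c': "c' \<in> F - {c}" "sdim c' = Suc k" "i \<le> Suc k"
  then obtain c'' where "c'' \<in> F" "sdim c'' = k" "singular_face (Suc k) i (\<psi> c') = \<psi> c''"
    using assms(1) unfolding face_closed_def by blast
  moreover from this have "c'' \<noteq> c"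
    using assms(3)[of c'] c' by auto
  ultimately show "\<exists>c''\<in>F - {c}. sdim c'' = k \<and> singular_face (Suc k) i (\<psi> c') = \<psi> c''"
    by blast
qed (use assms in \<open>auto simp: face_closed_def\<close>)

text \<open>A cell of greatest dimension is not a proper face of another cell, so removing it leaves
  a subcomplex; disjointness of the open cells keeps its interior away from the rest.\<close>

lemma cell_attachment_max:
  assumes F: "finite F" "face_closed F" "c \<in> F" "\<And>c'. c' \<in> F \<Longrightarrow> sdim c' \<le> sdim c"
  shows "cell_attachment (subtopology Y (support F)) (support (F - {c})) (sdim c) (\<psi> c)"
proof
  have K: "F \<subseteq> K" "c \<in> K"
    using F by (auto simp: face_closed_def)
  show "Hausdorff_space (subtopology Y (support F))"
    using Hausdorff by (rule Hausdorff_space_subtopology)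
  show "closedin (subtopology Y (support F)) (support (F - {c}))"
    using K F by (intro closedin_subset_topspace closedin_support support_mono) auto
  show "continuous_map (simplex_space (sdim c)) (subtopology Y (support F)) (\<psi> c)"
    using cell_cont[OF K(2)] F(3) by (auto simp: continuous_map_in_subtopology support_def)
  show "inj_on (\<psi> c) (standard_simplex (sdim c))"
    by (rule injective[OF K(2)])
  have "support {c' \<in> F. sdim c' < sdim c} \<subseteq> support (F - {c})"
    by (intro support_mono) auto
  then show bd: "\<psi> c ` simplex_boundary (sdim c) \<subseteq> support (F - {c})"
    using face_closed_boundary[OF F(2,3)] by blast
  have "support (F - {c}) = (\<Union>c'\<in>F - {c}. \<psi> c' ` open_simplex (sdim c'))"
    by (rule support_open_cells[OF face_closed_remove_max[OF F(2-4)]])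
  moreover have "\<psi> c ` open_simplex (sdim c) \<inter> \<psi> c' ` open_simplex (sdim c') = {}" if "c' \<in> F - {c}"
      for c'
    using disjoint_family_onD[OF disjoint, of c c'] that K by auto
  ultimately show "\<psi> c ` open_simplex (sdim c) \<inter> support (F - {c}) = {}"
    by auto
  have "topspace (subtopology Y (support F)) = support F"
    using support_subset[OF K(1)] by auto
  also have "\<dots> = support (F - {c}) \<union> \<psi> c ` standard_simplex (sdim c)"
    using F(3) by (auto simp: support_def)
  finally show "topspace (subtopology Y (support F)) = support (F - {c}) \<union> \<psi> c ` standard_simplex
      (sdim c)" .
qed

lemma finite_face_closed_superset:
  assumes "c \<in> K"
  shows "\<exists>F. finite F \<and> face_closed F \<and> c \<in> F"
  using assms
proof (induction "sdim c" arbitrary: c)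
  case 0
  then show ?case
    by (intro exI[of _ "{c}"]) (auto simp: face_closed_def)
next
  case (Suc k)
  have "\<forall>i\<in>{..Suc k}. \<exists>F. finite F \<and> face_closed F \<and>
      (\<exists>c'\<in>F. sdim c' = k \<and> singular_face (Suc k) i (\<psi> c) = \<psi> c')"
  proof
    fix i assume "i \<in> {..Suc k}"
    then obtain c' where c': "c' \<in> K" "sdim c' = k" "singular_face (Suc k) i (\<psi> c) = \<psi> c'"
      using face[OF Suc.prems Suc.hyps(2)[symmetric], of i] by auto
    then obtain F where "finite F" "face_closed F" "c' \<in> F"
      using Suc.hyps(1)[of c'] by auto
    then show "\<exists>F. finite F \<and> face_closed F \<and> (\<exists>c'\<in>F. sdim c' = k \<and> singular_face (Suc k) i (\<psi> c)
        = \<psi> c')"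
      using c' by blast
  qed
  then obtain F where F: "\<And>i. i \<le> Suc k \<Longrightarrow> finite (F i) \<and> face_closed (F i) \<and>
      (\<exists>c'\<in>F i. sdim c' = k \<and> singular_face (Suc k) i (\<psi> c) = \<psi> c')"
    by (metis atMost_iff)
  define G where "G = (\<Union>i\<in>{..Suc k}. F i)"
  have G: "finite G" "face_closed G"
    unfolding G_def using F by (auto intro!: face_closed_Un)
  have face_G: "\<exists>c'\<in>G. sdim c' = k \<and> singular_face (Suc k) i (\<psi> c) = \<psi> c'" if "i \<le> Suc k" for i
    using F[OF that] that unfolding G_def by blast
  have "face_closed (insert c G)"
    unfolding face_closed_def
  proof (intro conjI ballI allI impI)
    show "insert c G \<subseteq> K"
      using G Suc.prems by (simp add: face_closed_def)
    fix c' l i assume "c' \<in> insert c G" "sdim c' = Suc l" "i \<le> Suc l"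
    then show "\<exists>c''\<in>insert c G. sdim c'' = l \<and> singular_face (Suc l) i (\<psi> c') = \<psi> c''"
    proof (cases "c' = c")
      case True
      then show ?thesis
        using face_G[of i] Suc.hyps(2) \<open>sdim c' = Suc l\<close> \<open>i \<le> Suc l\<close> by auto
    next
      case False
      then show ?thesis
        using G(2) \<open>c' \<in> insert c G\<close> \<open>sdim c' = Suc l\<close> \<open>i \<le> Suc l\<close> unfolding face_closed_def by blast
    qed
  qed
  then show ?case
    using G by (intro exI[of _ "insert c G"]) auto
qed

text \<open>Choose a point of \<open>C\<close> in each open cell that \<open>C\<close> meets. A
  closed cell contains finitely many of them, so by the weak topology every subset of the chosen
  points is closed, and an infinite choice would contradict compactness.\<close>

lemma compact_subset_finite_subcomplex:
  assumes C: "compactin Y C"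
  shows "\<exists>F. finite F \<and> face_closed F \<and> C \<subseteq> support F"
proof -
  define M where "M = {c \<in> K. C \<inter> \<psi> c ` open_simplex (sdim c) \<noteq> {}}"
  have "\<forall>c\<in>M. \<exists>x. x \<in> C \<inter> \<psi> c ` open_simplex (sdim c)"
    by (auto simp: M_def)
  then obtain x where x: "\<And>c. c \<in> M \<Longrightarrow> x c \<in> C \<and> x c \<in> \<psi> c ` open_simplex (sdim c)"
    by (metis IntE)
  have MK: "M \<subseteq> K"
    by (auto simp: M_def)
  have same: "c = c'" if "c \<in> M" "c' \<in> K" "x c \<in> \<psi> c' ` open_simplex (sdim c')" for c c'
    using disjoint_family_onD[OF disjoint, of c c'] x[OF that(1)] that MK by auto
  have inj: "inj_on x M"
  proof (rule inj_onI)
    fix c c' assume "c \<in> M" "c' \<in> M" "x c = x c'"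
    then show "c = c'"
      using same[of c c'] x[of c'] MK by auto
  qed
  have xtop: "x ` M \<subseteq> topspace Y"
    using x compactin_subset_topspace[OF C] by auto
  have closed: "closedin Y E" if E: "E \<subseteq> x ` M" for E
  proof (rule weak)
    show "E \<subseteq> topspace Y"
      using E xtop by blast
    fix c assume "c \<in> K"
    then obtain F where F: "finite F" "face_closed F" "c \<in> F"
      using finite_face_closed_superset by blast
    have "E \<inter> \<psi> c ` standard_simplex (sdim c) \<subseteq> x ` F"
    proof
      fix y assume y: "y \<in> E \<inter> \<psi> c ` standard_simplex (sdim c)"
      then obtain c' where c': "c' \<in> M" "y = x c'"
        using E by auto
      have "y \<in> support F"
        using y F(3) by (auto simp: support_def)
      then obtain c'' where "c'' \<in> F" "y \<in> \<psi> c'' ` open_simplex (sdim c'')"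
        using support_open_cells[OF F(2)] by auto
      then have "c' = c''"
        using same[OF c'(1), of c''] c'(2) F(2) by (auto simp: face_closed_def)
      then show "y \<in> x ` F"
        using c' \<open>c'' \<in> F\<close> by blast
    qed
    then have "finite (E \<inter> \<psi> c ` standard_simplex (sdim c))"
      using F(1) finite_surj by blast
    then show "closedin Y (E \<inter> \<psi> c ` standard_simplex (sdim c))"
      using Hausdorff_imp_t1_space[OF Hausdorff] E xtop by (auto simp: t1_space_closedin_finite)
  qed
  have "finite (x ` M)"
  proof (rule ccontr)
    assume "infinite (x ` M)"
    moreover have "x ` M \<subseteq> C"
      using x by auto
    ultimately obtain y where y: "y \<in> Y derived_set_of (x ` M)"
      using compactin_imp_Bolzano_Weierstrass[OF C, of "x ` M"] by blast
    \<comment> \<open>An open neighbourhood of the limit point \<open>y\<close> that contains no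
      other chosen point.\<close>
    define U where "U = topspace Y - (x ` M - {y})"
    have "openin Y U"
      unfolding U_def using closed[of "x ` M - {y}"] by blast
    moreover have "y \<in> U"
      using y by (simp add: in_derived_set_of U_def)
    moreover have "\<forall>T. y \<in> T \<and> openin Y T \<longrightarrow> (\<exists>w. w \<noteq> y \<and> w \<in> x ` M \<and> w \<in> T)"
      using y unfolding in_derived_set_of by (rule conjunct2)
    ultimately obtain w where "w \<noteq> y" "w \<in> x ` M" "w \<in> U"
      by metis
    then show False
      by (simp add: U_def)
  qed
  then have finM: "finite M"
    by (simp add: finite_image_iff[OF inj])
  have "\<forall>c\<in>M. \<exists>F. finite F \<and> face_closed F \<and> c \<in> F"
    using finite_face_closed_superset MK by blast
  then obtain F where F: "\<And>c. c \<in> M \<Longrightarrow> finite (F c) \<and> face_closed (F c) \<and> c \<in> F c"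
    by metis
  have "C \<subseteq> support (\<Union>c\<in>M. F c)"
  proof
    fix y assume y: "y \<in> C"
    then have "y \<in> (\<Union>c\<in>K. \<psi> c ` open_simplex (sdim c))"
      using compactin_subset_topspace[OF C] covering by auto
    then obtain c where c: "c \<in> K" "y \<in> \<psi> c ` open_simplex (sdim c)"
      by (rule UN_E)
    then have "c \<in> M"
      using y by (auto simp: M_def)
    then show "y \<in> support (\<Union>c\<in>M. F c)"
      using F[of c] c(2) open_simplex_subset unfolding support_def by blast
  qed
  moreover have "finite (\<Union>c\<in>M. F c)"
    using finM F by blast
  moreover have "face_closed (\<Union>c\<in>M. F c)"
    using F by (intro face_closed_Un) blast
  ultimately show ?thesis
    by blast
qed

lemma singular_chain_finite_subcomplex:
  assumes "singular_chain p Y z"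
  shows "\<exists>F. finite F \<and> face_closed F \<and> singular_chain p (subtopology Y (support F)) z"
proof -
  have "compactin Y (\<Union>\<sigma>\<in>Poly_Mapping.keys z. \<sigma> ` standard_simplex p)"
  proof (intro compactin_Union)
    fix S assume "S \<in> (\<lambda>\<sigma>. \<sigma> ` standard_simplex p) ` Poly_Mapping.keys z"
    then obtain \<sigma> where "S = \<sigma> ` standard_simplex p" "singular_simplex p Y \<sigma>"
      using assms by (auto simp: singular_chain_def)
    then show "compactin Y S"
      using image_compactin[of "simplex_space p" "standard_simplex p" Y \<sigma>]
      by (simp add: singular_simplex_def compactin_subtopology compactin_standard_simplex)
  qed auto
  then obtain F where "finite F" "face_closed F" "(\<Union>\<sigma>\<in>Poly_Mapping.keys z. \<sigma> ` standard_simplex p)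
      \<subseteq> support F"
    using compact_subset_finite_subcomplex by blast
  then show ?thesis
    using assms unfolding singular_chain_def singular_simplex_subtopology by blast
qed

lemma frag_of_cell: "c \<in> K \<Longrightarrow> chain_map (sdim c) (\<psi> c) (id_simplex (sdim c)) = frag_of (\<psi> c)"
  using simplex by (simp add: chain_map_id_simplex singular_simplex_def extensional_restrict)

lemma simplicial_chain_in_support:
  assumes "Poly_Mapping.keys t \<subseteq> \<psi> ` {c \<in> F. sdim c = q}" "F \<subseteq> K"
  shows "singular_chain q (subtopology Y (support F)) t"
  using assms simplex by (fastforce simp: singular_chain_def singular_simplex_subtopology support_def)

text \<open>Cells of greatest dimension are peeled off one by one. The statement concerns chains
  with simplicial boundary, not only cycles, because subtracting a multiple of a cell from a cycle
  creates such a boundary.\<close>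

theorem homologous_to_simplicial_chain:
  assumes "finite F" "face_closed F" "singular_chain (Suc q) (subtopology Y (support F)) z"
    "Poly_Mapping.keys (chain_boundary (Suc q) z) \<subseteq> \<psi> ` {c \<in> F. sdim c = q}"
  shows "\<exists>s. Poly_Mapping.keys s \<subseteq> \<psi> ` {c \<in> F. sdim c = Suc q} \<and>
    singular_relboundary (Suc q) (subtopology Y (support F)) {} (z - s)"
  using assms
proof (induction F arbitrary: z rule: measure_induct_rule[of card])
  case (less F)
  show ?case
  proof (cases "F = {}")
    case True
    then have "z = 0"
      using less.prems(3) by (simp add: support_def singular_chain_empty)
    then show ?thesis
      by (intro exI[of _ 0]) simp
  next
    case False
    define t where "t = chain_boundary (Suc q) z"
    obtain c where c: "c \<in> F" "\<And>c'. c' \<in> F \<Longrightarrow> sdim c' \<le> sdim c"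
      using False less.prems(1) Max_in[of "sdim ` F"] Max_ge[of "sdim ` F"]
      by (metis (no_types, lifting) finite_imageI imageE imageI image_is_empty)
    define F' where "F' = F - {c}"
    let ?L = "subtopology Y (support F)" and ?L' = "support F'"
    interpret cell_attachment ?L ?L' "sdim c" "\<psi> c"
      unfolding F'_def by (rule cell_attachment_max[OF less.prems(1,2) c])
    have FK: "F \<subseteq> K" "c \<in> K" "F' \<subseteq> K" "F' \<subseteq> F"
      using less.prems(2) c by (auto simp: face_closed_def F'_def)
    have fcF': "face_closed F'"
      unfolding F'_def by (rule face_closed_remove_max[OF less.prems(2) c])
    have LL': "subtopology ?L ?L' = subtopology Y ?L'"
      using support_mono[OF FK(4)] by (simp add: subtopology_subtopology inf_absorb2)
    \<comment> \<open>The boundary of \<open>z\<close> does not involve \<open>c\<close>: if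
      \<open>c\<close> has dimension \<open>q\<close>, its multiple occurring there would bound
      modulo the other cells, and the generator has infinite order.\<close>
    have keys_t: "Poly_Mapping.keys t \<subseteq> \<psi> ` {c' \<in> F'. sdim c' = q}"
    proof (cases "sdim c = q")
      case True
      define m where "m = Poly_Mapping.lookup t (\<psi> c)"
      define t' where "t' = t - frag_cmul m (frag_of (\<psi> c))"
      have "Poly_Mapping.keys t' \<subseteq> Poly_Mapping.keys t - {\<psi> c}"
        by (auto simp: t'_def m_def in_keys_iff lookup_minus split: if_splits)
      also have "\<dots> \<subseteq> \<psi> ` {c' \<in> F'. sdim c' = q}"
        using less.prems(4) by (auto simp: t_def F'_def)
      finally have "singular_chain q (subtopology ?L ?L') (- t')"
        unfolding LL' by (intro singular_chain_minus[THEN iffD2] simplicial_chain_in_support FK)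
      moreover have "chain_boundary (Suc q) z + (- t') = chain_map q (\<psi> c) (frag_cmul m (id_simplex q))"
        using frag_of_cell[OF FK(2)] True by (simp add: t'_def t_def)
      ultimately have "singular_relboundary q ?L ?L' (chain_map q (\<psi> c) (frag_cmul m (id_simplex q)))"
        unfolding singular_relboundary using less.prems(3) by blast
      then have "singular_relboundary q (simplex_space q)
          (simplex_boundary q) (frag_cmul m (id_simplex q))"
        using cell_relboundary_injective[of q "frag_cmul m (id_simplex q)"] relcycle_id_simplex[of q]
            True
        by (simp add: singular_relcycle_cmul)
      then have "m = 0"
        by (rule simplex_generator_infinite_order)
      then have "\<psi> c \<notin> Poly_Mapping.keys t"
        by (simp add: m_def in_keys_iff)
      then show ?thesis
        using less.prems(4) by (auto simp: t_def F'_def)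
    next
      case False
      then show ?thesis
        using less.prems(4) by (auto simp: t_def F'_def)
    qed
    then have "singular_chain q (subtopology ?L ?L') t"
      unfolding LL' using FK(3) by (intro simplicial_chain_in_support)
    then have "singular_relcycle (Suc q) ?L ?L' z"
      using less.prems(3) by (simp add: singular_relcycle t_def)
    then obtain y where y: "singular_relcycle (Suc q) (simplex_space (sdim c))
        (simplex_boundary (sdim c)) y"
      "homologous_rel (Suc q) ?L ?L' z (chain_map (Suc q) (\<psi> c) y)"
      by (rule relcycle_homologous_to_cell)
    obtain m where m: "Suc q \<noteq> sdim c \<longrightarrow> m = 0"
      "homologous_rel (Suc q) (simplex_space (sdim c)) (simplex_boundary (sdim c)) y (frag_cmul m
          (id_simplex (sdim c)))"
      using simplex_relcycle_generated[OF y(1)] by blast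
    define g where "g = frag_cmul m (frag_of (\<psi> c))"
    have g: "chain_map (Suc q) (\<psi> c) (frag_cmul m (id_simplex (sdim c))) = g"
      using m(1) frag_of_cell[OF FK(2)] by (cases "Suc q = sdim c") (auto simp: g_def)
    have "homologous_rel (Suc q) ?L ?L' (chain_map (Suc q) (\<psi> c) y) g"
      using singular_relboundary_chain_map[OF m(2)[unfolded homologous_rel_def] cont, of ?L'] bd g
      by (auto simp: homologous_rel_def chain_map_diff)
    then have "homologous_rel (Suc q) ?L ?L' z g"
      using y(2) homologous_rel_trans by blast
    then obtain w z' where w: "singular_chain (Suc (Suc q)) ?L w"
      and z': "singular_chain (Suc q) (subtopology Y ?L') z'"
      and wz': "chain_boundary (Suc (Suc q)) w + z' = z - g"
      unfolding homologous_rel_def singular_relboundary LL' by blast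
    have "chain_boundary (Suc q) z' = chain_boundary (Suc q) (z - g - chain_boundary (Suc (Suc q)) w)"
      unfolding wz'[symmetric] by simp
    also have "\<dots> = t - chain_boundary (Suc q) g"
      using chain_boundary_boundary_alt[OF w] by (simp add: chain_boundary_diff t_def)
    finally have bz': "chain_boundary (Suc q) z' = t - chain_boundary (Suc q) g" .
    \<comment> \<open>The faces of \<open>c\<close> have smaller dimension, so they remain after
      \<open>c\<close> is removed.\<close>
    have "Poly_Mapping.keys (chain_boundary (Suc q) g) \<subseteq> \<psi> ` {c' \<in> F'. sdim c' = q}"
    proof (cases "m = 0")
      case False
      then have sd: "sdim c = Suc q"
        using m(1) by simp
      have "singular_face (Suc q) i (\<psi> c) \<in> \<psi> ` {c' \<in> F'. sdim c' = q}" if i: "i \<le> Suc q" for i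
      proof -
        obtain c' where "c' \<in> F" "sdim c' = q" "singular_face (Suc q) i (\<psi> c) = \<psi> c'"
          using less.prems(2) c(1) sd i unfolding face_closed_def by blast
        then show ?thesis
          using sd by (auto simp: F'_def)
      qed
      then have "Poly_Mapping.keys (\<Sum>i\<le>Suc q. frag_cmul ((-1) ^ i) (frag_of (singular_face (Suc q) i
          (\<psi> c)))) \<subseteq> \<psi> ` {c' \<in> F'. sdim c' = q}"
        using keys_sum[of "\<lambda>i. frag_cmul ((-1) ^ i) (frag_of (singular_face (Suc q) i (\<psi> c)))" "{..Suc
            q}"]
        by (fastforce simp del: sum.atMost_Suc dest: subsetD[OF keys_cmul])
      then show ?thesis
        using keys_cmul unfolding g_def chain_boundary_cmul chain_boundary_of by
            (auto simp del: sum.atMost_Suc)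
    qed (simp add: g_def)
    then have "Poly_Mapping.keys (chain_boundary (Suc q) z') \<subseteq> \<psi> ` {c' \<in> F'. sdim c' = q}"
      unfolding bz' using keys_t keys_diff[of t "chain_boundary (Suc q) g"] by blast
    moreover have "card F' < card F"
      using c(1) less.prems(1) unfolding F'_def by (intro psubset_card_mono) auto
    ultimately obtain s' where s': "Poly_Mapping.keys s' \<subseteq> \<psi> ` {c' \<in> F'. sdim c' = Suc q}"
      "singular_relboundary (Suc q) (subtopology Y ?L') {} (z' - s')"
      using less.IH[of F' z'] fcF' z' less.prems(1) by (auto simp: F'_def)
    have "Poly_Mapping.keys (s' + g) \<subseteq> \<psi> ` {c \<in> F. sdim c = Suc q}"
    proof (cases "m = 0")
      case True
      then show ?thesis
        using s'(1) FK(4) by (auto simp: g_def)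
    next
      case False
      then have "Poly_Mapping.keys g \<subseteq> \<psi> ` {c \<in> F. sdim c = Suc q}"
        using m(1) c(1) by (auto simp: g_def)
      then show ?thesis
        using s'(1) FK(4) Poly_Mapping.keys_add[of s' g] by blast
    qed
    moreover have "singular_relboundary (Suc q) ?L {} (z - (s' + g))"
    proof -
      have "singular_relboundary (Suc q) ?L {} (z' - s')"
        using s'(2) singular_boundary_mono[OF support_mono[OF FK(4)]] by blast
      moreover have "singular_relboundary (Suc q) ?L {} (chain_boundary (Suc (Suc q)) w)"
        using w by (auto simp: singular_boundary)
      ultimately have "singular_relboundary (Suc q) ?L {} (chain_boundary (Suc (Suc q)) w + (z' - s'))"
        by (intro singular_relboundary_add)
      moreover have "chain_boundary (Suc (Suc q)) w + (z' - s') = z - (s' + g)"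
        using wz' by (simp add: algebra_simps)
      ultimately show ?thesis
        by simp
    qed
    ultimately show ?thesis
      by blast
  qed
qed

corollary cycle_homologous_to_simplicial_cycle:
  assumes "p \<ge> 1" "singular_chain p Y z" "chain_boundary p z = 0"
  obtains s where "Poly_Mapping.keys s \<subseteq> \<psi> ` {c \<in> K. sdim c = p}" "singular_relboundary p Y {} (z - s)"
proof -
  obtain q where q: "p = Suc q"
    using assms(1) by (cases p) auto
  obtain F where F: "finite F" "face_closed F" "singular_chain p (subtopology Y (support F)) z"
    using singular_chain_finite_subcomplex[OF assms(2)] by blast
  then obtain s where s: "Poly_Mapping.keys s \<subseteq> \<psi> ` {c \<in> F. sdim c = p}"
    "singular_relboundary p (subtopology Y (support F)) {} (z - s)"
    using homologous_to_simplicial_chain[of F q z] assms(3) q by auto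
  have "singular_relboundary p (subtopology Y UNIV) {} (z - s)"
    using s(2) by (rule singular_boundary_mono[rotated]) simp
  moreover have "Poly_Mapping.keys s \<subseteq> \<psi> ` {c \<in> K. sdim c = p}"
    using s(1) F(2) unfolding face_closed_def by blast
  ultimately show ?thesis
    using that by simp
qed

end

section \<open>Ordering the vertices consistently\<close>

lemma ex_strict_total_order:
  "\<exists>lt :: 'b \<Rightarrow> 'b \<Rightarrow> bool. (\<forall>x. \<not> lt x x) \<and> (\<forall>x y z. lt x y \<longrightarrow> lt y z \<longrightarrow> lt x z) \<and>
    (\<forall>x y. x \<noteq> y \<longrightarrow> lt x y \<or> lt y x)"
proof -
  obtain r :: "'b rel" where "well_order_on UNIV r"
    using well_order_on by blast
  then have r: "trans r" "antisym r" "total_on UNIV r"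
    by (auto simp: well_order_on_def linear_order_on_def partial_order_on_def preorder_on_def)
  show ?thesis
  proof (intro exI[of _ "\<lambda>x y. (x, y) \<in> r \<and> x \<noteq> y"] conjI allI impI)
    fix x y z assume "(x, y) \<in> r \<and> x \<noteq> y" "(y, z) \<in> r \<and> y \<noteq> z"
    then show "(x, z) \<in> r" "x \<noteq> z"
      using r transD[OF r(1)] antisymD[OF r(2)] by blast+
  next
    fix x y :: 'b assume "x \<noteq> y"
    then show "((x, y) \<in> r \<and> x \<noteq> y) \<or> ((y, x) \<in> r \<and> y \<noteq> x)"
      using r(3) by (auto simp: total_on_def)
  qed auto
qed

definition sorted_enum :: "('i \<Rightarrow> 'i \<Rightarrow> bool) \<Rightarrow> nat \<Rightarrow> 'i set \<Rightarrow> (nat \<Rightarrow> 'i) \<Rightarrow> bool" where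
  "sorted_enum lt k V e \<longleftrightarrow> bij_betw e {..k} V \<and> (\<forall>i j. i < j \<longrightarrow> j \<le> k \<longrightarrow> lt (e i) (e j))"

text \<open>The order is a parameter on a carrier set because each cell carries its own order on
  vertex numbers, pulled back from the points of the complex.\<close>

locale finite_strict_order =
  fixes lt :: "'i \<Rightarrow> 'i \<Rightarrow> bool" and V :: "'i set"
  assumes finite: "finite V"
    and irrefl: "\<And>x. x \<in> V \<Longrightarrow> \<not> lt x x"
    and trans: "\<And>x y z. x \<in> V \<Longrightarrow> y \<in> V \<Longrightarrow> z \<in> V \<Longrightarrow> lt x y \<Longrightarrow> lt y z \<Longrightarrow> lt x z"
    and total: "\<And>x y. x \<in> V \<Longrightarrow> y \<in> V \<Longrightarrow> x \<noteq> y \<Longrightarrow> lt x y \<or> lt y x"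
begin

definition rank :: "'i \<Rightarrow> nat" where
  "rank x = card {y \<in> V. lt y x}"

lemma rank_mono:
  assumes "x \<in> V" "y \<in> V" "lt x y"
  shows "rank x < rank y"
proof -
  have "{z \<in> V. lt z x} \<subseteq> {z \<in> V. lt z y}"
    using trans[OF _ assms(1,2) _ assms(3)] by blast
  moreover have "x \<in> {z \<in> V. lt z y}" "x \<notin> {z \<in> V. lt z x}"
    using assms irrefl by auto
  ultimately have "{z \<in> V. lt z x} \<subset> {z \<in> V. lt z y}"
    by blast
  then show ?thesis
    unfolding rank_def using finite by (intro psubset_card_mono) auto
qed

lemma rank_inj: "inj_on rank V"
proof (rule inj_onI)
  fix x y assume "x \<in> V" "y \<in> V" "rank x = rank y"
  then show "x = y"
    using total[of x y] rank_mono[of x y] rank_mono[of y x] by auto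
qed

lemma ex_sorted_enum:
  assumes "card V = Suc k"
  shows "\<exists>e. sorted_enum lt k V e"
proof -
  have "rank ` V \<subseteq> {..k}"
  proof clarify
    fix x assume "x \<in> V"
    then have "{y \<in> V. lt y x} \<subset> V"
      using irrefl by auto
    then have "rank x < card V"
      unfolding rank_def by (intro psubset_card_mono finite)
    then show "rank x \<le> k"
      using assms by simp
  qed
  moreover have "card (rank ` V) = card {..k}"
    using rank_inj assms by (simp add: card_image)
  ultimately have "rank ` V = {..k}"
    by (intro card_subset_eq) auto
  then have b: "bij_betw rank V {..k}"
    using rank_inj by (simp add: bij_betw_def)
  define e where "e = inv_into V rank"
  have e: "bij_betw e {..k} V"
    unfolding e_def by (rule bij_betw_inv_into[OF b])
  have re: "rank (e i) = i" if "i \<le> k" for i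
    unfolding e_def using bij_betw_inv_into_right[OF b] that by simp
  have "lt (e i) (e j)" if "i < j" "j \<le> k" for i j
  proof -
    have V: "e i \<in> V" "e j \<in> V"
      using bij_betwE[OF e] that by auto
    moreover have rank: "rank (e i) = i" "rank (e j) = j"
      using re that by auto
    then have "e i \<noteq> e j"
      using that(1) by auto
    moreover have "\<not> lt (e j) (e i)"
      using rank_mono[OF V(2,1)] rank that(1) by auto
    ultimately show ?thesis
      using total by blast
  qed
  then show ?thesis
    using e by (auto simp: sorted_enum_def)
qed

text \<open>The predecessors of \<open>e i\<close> are exactly the earlier values of
  \<open>e\<close>. Positions are thus intrinsic, which makes sorted enumerations unique.\<close>

lemma rank_sorted_enum:
  assumes "sorted_enum lt k V e" "i \<le> k"
  shows "rank (e i) = i"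
proof -
  have e: "bij_betw e {..k} V" "\<And>i j. i < j \<Longrightarrow> j \<le> k \<Longrightarrow> lt (e i) (e j)"
    using assms(1) by (auto simp: sorted_enum_def)
  have mem: "e j \<in> V" if "j \<le> k" for j
    using bij_betwE[OF e(1)] that by auto
  have "{y \<in> V. lt y (e i)} = e ` {..<i}"
  proof
    show "{y \<in> V. lt y (e i)} \<subseteq> e ` {..<i}"
    proof clarify
      fix y assume y: "y \<in> V" "lt y (e i)"
      then obtain j where j: "j \<le> k" "y = e j"
        using e(1) by (auto simp: bij_betw_def)
      have "j < i"
      proof (rule ccontr)
        assume "\<not> j < i"
        then consider "j = i" | "i < j"
          by linarith
        then show False
        proof cases
          case 1
          then show ?thesis
            using y j irrefl by auto
        next
          case 2
          then have "lt (e i) y"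
            using e(2) j by simp
          then have "lt y y"
            using trans[OF y(1) mem[OF assms(2)] y(1) y(2)] by blast
          then show ?thesis
            using irrefl y(1) by blast
        qed
      qed
      then show "y \<in> e ` {..<i}"
        using j by blast
    qed
    show "e ` {..<i} \<subseteq> {y \<in> V. lt y (e i)}"
      using e(2) mem assms(2) by auto
  qed
  moreover have "inj_on e {..<i}"
    using bij_betw_imp_inj_on[OF e(1)] assms(2) by (auto intro: inj_on_subset)
  ultimately show ?thesis
    by (simp add: rank_def card_image)
qed

lemma sorted_enum_unique:
  assumes "sorted_enum lt k V e" "sorted_enum lt k V e'" "i \<le> k"
  shows "e i = e' i"
proof -
  have "e i \<in> V" "e' i \<in> V"
    using assms by (auto simp: sorted_enum_def bij_betw_def)
  then show ?thesis
    using rank_inj rank_sorted_enum[OF assms(1,3)] rank_sorted_enum[OF assms(2,3)] by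
        (simp add: inj_on_def)
qed

end

abbreviation vertex :: "nat \<Rightarrow> nat \<Rightarrow> real" where
  "vertex i \<equiv> \<lambda>j. if j = i then 1 else 0"

lemma vertex_map_vertex:
  assumes "a \<le> k"
  shows "vertex_map k \<pi> (vertex a) = vertex (\<pi> a)"
proof
  fix j
  have "vertex_map k \<pi> (vertex a) j = (\<Sum>i\<in>{i. i \<le> k \<and> \<pi> i = j}. if i = a then 1 else 0)"
    by (simp add: vertex_map_def)
  also have "\<dots> = vertex (\<pi> a) j"
    using assms by (subst sum.delta) auto
  finally show "vertex_map k \<pi> (vertex a) j = vertex (\<pi> a) j" .
qed

lemma vertex_map_permutation:
  assumes \<pi>: "bij_betw \<pi> {..k} {..k}"
  shows "inj_on (vertex_map k \<pi>) (standard_simplex k)"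
    and "vertex_map k \<pi> ` standard_simplex k = standard_simplex k"
    and "vertex_map k \<pi> ` open_simplex k = open_simplex k"
proof -
  have inj: "inj_on \<pi> {..k}" and le: "\<And>i. i \<le> k \<Longrightarrow> \<pi> i \<le> k"
    using \<pi> by (auto simp: bij_betw_def)
  show "inj_on (vertex_map k \<pi>) (standard_simplex k)"
  proof (intro inj_onI ext)
    fix x y j assume xy: "x \<in> standard_simplex k" "y \<in> standard_simplex k" "vertex_map k \<pi> x
        = vertex_map k \<pi> y"
    show "x j = y j"
    proof (cases "j \<le> k")
      case True
      then show ?thesis
        using vertex_map_inj[OF inj, of j x] vertex_map_inj[OF inj, of j y] xy(3) by simp
    qed (use xy in \<open>auto simp: standard_simplex_def\<close>)
  qed
  have into: "vertex_map k \<pi> x \<in> standard_simplex k" if "x \<in> standard_simplex k" for x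
    using vertex_map_in_standard_simplex[OF that] le by blast
  define \<rho> where "\<rho> = inv_into {..k} \<pi>"
  have \<rho>: "\<rho> i \<le> k" "\<pi> (\<rho> i) = i" if "i \<le> k" for i
    using that \<pi> bij_betwE[OF bij_betw_inv_into[OF \<pi>]] bij_betw_inv_into_right[OF \<pi>] by
        (auto simp: \<rho>_def)
  have right: "vertex_map k \<pi> (vertex_map k \<rho> y) = y" if "y \<in> standard_simplex k" for y
  proof -
    have "vertex_map k \<pi> (vertex_map k \<rho> y) = vertex_map k (\<pi> \<circ> \<rho>) y"
      by (rule vertex_map_vertex_map) (rule \<rho>(1))
    also have "vertex_map k (\<pi> \<circ> \<rho>) = vertex_map k id"
      by (rule vertex_map_cong) (simp add: \<rho>)
    finally show ?thesis
      using vertex_map_id[OF that] by simp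
  qed
  have into': "vertex_map k \<rho> y \<in> standard_simplex k" if "y \<in> standard_simplex k" for y
    using vertex_map_in_standard_simplex[OF that] \<rho>(1) by blast
  show im: "vertex_map k \<pi> ` standard_simplex k = standard_simplex k"
  proof
    show "standard_simplex k \<subseteq> vertex_map k \<pi> ` standard_simplex k"
      using right into' by (metis image_eqI subsetI)
  qed (use into in auto)
  have pos: "(\<forall>i\<le>k. 0 < vertex_map k \<pi> x i) \<longleftrightarrow> (\<forall>i\<le>k. 0 < x i)" for x
    using vertex_map_inj[OF inj, of _ x] \<rho> le by metis
  have "y \<in> vertex_map k \<pi> ` open_simplex k" if y: "y \<in> open_simplex k" for y
  proof -
    obtain x where "x \<in> standard_simplex k" "y = vertex_map k \<pi> x"
      using y im by (auto simp: open_simplex_def)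
    then show ?thesis
      using y pos[of x] by (auto simp: open_simplex_def)
  qed
  moreover have "vertex_map k \<pi> x \<in> open_simplex k" if "x \<in> open_simplex k" for x
    using that into[of x] pos[of x] unfolding open_simplex_def by blast
  ultimately show "vertex_map k \<pi> ` open_simplex k = open_simplex k"
    by blast
qed

text \<open>A global order on the points of \<open>Y\<close> orders the vertices of every simplex, compatibly with
  faces. This uses that the vertices of a simplex are distinct.\<close>

lemma simplicial_cell_complex_ordering:
  fixes Y :: "'b topology" and K :: "'c set"
  assumes "simplicial_cell_complex Y K sdim \<phi>"
  shows "\<exists>\<psi>. ordered_cell_complex Y K sdim \<psi>"
proof -
  interpret s: simplicial_cell_complex Y K sdim \<phi>
    by (rule assms)
  obtain lt :: "'b \<Rightarrow> 'b \<Rightarrow> bool" where "(\<forall>x. \<not> lt x x) \<and> (\<forall>x y z. lt x y \<longrightarrow> lt y z \<longrightarrow> lt x z) \<and>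
    (\<forall>x y. x \<noteq> y \<longrightarrow> lt x y \<or> lt y x)"
    using ex_strict_total_order by (rule exE)
  then have lt: "\<And>x. \<not> lt x x" "\<And>x y z. lt x y \<Longrightarrow> lt y z \<Longrightarrow> lt x z"
    "\<And>x y. x \<noteq> y \<Longrightarrow> lt x y \<or> lt y x"
    by blast+
  define ltv where "ltv c i j \<longleftrightarrow> lt (\<phi> c (vertex i)) (\<phi> c (vertex j))" for c i j
  have order: "finite_strict_order (ltv c) V" if "c \<in> K" "V \<subseteq> {..sdim c}" for c V
  proof
    show "finite V"
      using that(2) by (rule finite_subset) simp
    fix i j assume ij: "i \<in> V" "j \<in> V" "i \<noteq> j"
    have "vertex i \<noteq> (vertex j :: nat \<Rightarrow> real)"
    proof
      assume "vertex i = (vertex j :: nat \<Rightarrow> real)"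
      from fun_cong[OF this, of i] show False
        using ij(3) by simp
    qed
    moreover have "vertex i \<in> standard_simplex (sdim c)" "vertex j \<in> standard_simplex (sdim c)"
      using ij that(2) by auto
    ultimately have "\<phi> c (vertex i) \<noteq> \<phi> c (vertex j)"
      using inj_onD[OF s.injective[OF that(1)], of "vertex i" "vertex j"] by blast
    then show "ltv c i j \<or> ltv c j i"
      using lt(3) by (simp add: ltv_def)
  qed (use lt in \<open>auto simp: ltv_def\<close>)
  have "\<forall>c\<in>K. \<exists>\<pi>. sorted_enum (ltv c) (sdim c) {..sdim c} \<pi>"
    using order by (intro ballI finite_strict_order.ex_sorted_enum) auto
  then obtain \<pi> where \<pi>: "\<And>c. c \<in> K \<Longrightarrow> sorted_enum (ltv c) (sdim c) {..sdim c} (\<pi> c)"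
    by metis
  have bij: "bij_betw (\<pi> c) {..sdim c} {..sdim c}" if "c \<in> K" for c
    using \<pi>[OF that] by (simp add: sorted_enum_def)
  have le: "\<pi> c i \<le> sdim c" if "c \<in> K" "i \<le> sdim c" for c i
    using bij_betwE[OF bij[OF that(1)]] that(2) by auto
  define \<psi> where "\<psi> c = subsimplex (sdim c) (\<pi> c) (restrict (\<phi> c) (standard_simplex (sdim c)))" for c
  have vm: "vertex_map (sdim c) (\<pi> c) x \<in> standard_simplex (sdim c)"
      if "c \<in> K" "x \<in> standard_simplex (sdim c)" for c x
    using vertex_map_permutation(2)[OF bij[OF that(1)]] that(2) by blast
  have \<psi>_eq: "\<psi> c x = \<phi> c (vertex_map (sdim c) (\<pi> c) x)" if "c \<in> K" "x \<in> standard_simplex (sdim c)"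
      for c x
    using that vm by (simp add: \<psi>_def subsimplex_def)
  have \<psi>_image: "\<psi> c ` S = \<phi> c ` vertex_map (sdim c) (\<pi> c) ` S"
      if "c \<in> K" "S \<subseteq> standard_simplex (sdim c)" for c S
    unfolding image_image using \<psi>_eq[OF that(1)] that(2) by (intro image_cong) auto
  have cell: "\<psi> c ` standard_simplex (sdim c) = \<phi> c ` standard_simplex (sdim c)" if "c \<in> K" for c
    using \<psi>_image[OF that order_refl] vertex_map_permutation(2)[OF bij[OF that]] by simp
  have open_cell: "\<psi> c ` open_simplex (sdim c) = \<phi> c ` open_simplex (sdim c)" if "c \<in> K" for c
    using \<psi>_image[OF that open_simplex_subset] vertex_map_permutation(3)[OF bij[OF that]] by simp
  have "ordered_cell_complex Y K sdim \<psi>"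
  proof
    show "Hausdorff_space Y"
      by (rule s.Hausdorff)
    show "singular_simplex (sdim c) Y (\<psi> c)" if "c \<in> K" for c
      unfolding \<psi>_def using s.continuous[OF that] le[OF that]
      by (intro singular_simplex_subsimplex[where p = "sdim c"])
        (auto simp: singular_simplex_def intro: continuous_map_eq)
    show "inj_on (\<psi> c) (standard_simplex (sdim c))" if c: "c \<in> K" for c
    proof -
      have "inj_on (\<phi> c \<circ> vertex_map (sdim c) (\<pi> c)) (standard_simplex (sdim c))"
        using vertex_map_permutation(1,2)[OF bij[OF c]] s.injective[OF c] by (intro comp_inj_on) auto
      then show ?thesis
        using \<psi>_eq[OF c] by (simp add: inj_on_def)
    qed
    show "disjoint_family_on (\<lambda>c. \<psi> c ` open_simplex (sdim c)) K"
      using s.open_cells_disjoint open_cell by (simp add: disjoint_family_on_def)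
    show "(\<Union>c\<in>K. \<psi> c ` open_simplex (sdim c)) = topspace Y"
      using s.open_cells_cover open_cell by simp
    show "closedin Y A" if "A \<subseteq> topspace Y" "\<And>c. c \<in> K \<Longrightarrow> closedin Y (A \<inter> \<psi> c ` standard_simplex (sdim
        c))" for A
      using that s.weak_topology[of A] cell by simp
    fix c k i assume c: "c \<in> K" "sdim c = Suc k" "i \<le> Suc k"
    \<comment> \<open>Enumerates the vertices of the face opposite to the \<open>i\<close>-th vertex
      of \<open>c\<close>, in increasing order.\<close>
    define e where "e = \<pi> c \<circ> skip i"
    have skip_le: "skip i j \<le> Suc k" if "j \<le> k" for j
      using that by (simp add: skip_def)
    have inj_skip: "inj_on (skip i) A" for A
      by (auto simp: inj_on_def skip_def split: if_splits)
    define V where "V = e ` {..k}"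
    have V: "V \<subseteq> {..sdim c}"
      using le[OF c(1)] c(2) skip_le by (auto simp: V_def e_def)
    have "inj_on e {..k}"
      unfolding e_def using skip_le c(2)
      by (intro comp_inj_on inj_skip inj_on_subset[OF bij_betw_imp_inj_on[OF bij[OF c(1)]]]) auto
    then have bij_e: "bij_betw e {..k} V"
      by (simp add: V_def bij_betw_def)
    have sorted_e: "sorted_enum (ltv c) k V e"
      unfolding sorted_enum_def
    proof (intro conjI bij_e allI impI)
      fix a b :: nat assume "a < b" "b \<le> k"
      then have "skip i a < skip i b" "skip i b \<le> Suc k"
        by (auto simp: skip_def)
      then show "ltv c (e a) (e b)"
        using \<pi>[OF c(1)] c(2) by (auto simp: sorted_enum_def e_def)
    qed
    obtain c' \<pi>' where c': "c' \<in> K" "bij_betw \<pi>' {..sdim c'} V"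
      "\<And>x. x \<in> standard_simplex (sdim c') \<Longrightarrow> \<phi> c (vertex_map (sdim c') \<pi>' x) = \<phi> c' x"
      using s.faces[OF c(1) V] by (auto simp: V_def)
    have dim: "sdim c' = k"
      using bij_betw_same_card[OF c'(2)] bij_betw_same_card[OF bij_e] by simp
    \<comment> \<open>The characteristic maps agree at vertices, so both cells compare the same
      points.\<close>
    have ltv': "ltv c' a b \<longleftrightarrow> ltv c (\<pi>' a) (\<pi>' b)" if "a \<le> k" "b \<le> k" for a b
      using c'(3)[of "vertex a"] c'(3)[of "vertex b"] that dim by (simp add: ltv_def vertex_map_vertex)
    have "sorted_enum (ltv c) k V (\<pi>' \<circ> \<pi> c')"
      unfolding sorted_enum_def
    proof (intro conjI allI impI)
      show "bij_betw (\<pi>' \<circ> \<pi> c') {..k} V"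
        using bij_betw_trans[OF bij[OF c'(1)] c'(2)] dim by simp
      fix a b :: nat assume ab: "a < b" "b \<le> k"
      then have "ltv c' (\<pi> c' a) (\<pi> c' b)"
        using \<pi>[OF c'(1)] dim by (simp add: sorted_enum_def)
      then show "ltv c ((\<pi>' \<circ> \<pi> c') a) ((\<pi>' \<circ> \<pi> c') b)"
        using ltv' le[OF c'(1)] ab dim by simp
    qed
    \<comment> \<open>Both maps are sorted enumerations of \<open>V\<close>, so uniqueness
      identifies the ordered face of \<open>c\<close> with the cell \<open>c'\<close>.\<close>
    then have same: "(\<pi>' \<circ> \<pi> c') j = e j" if "j \<le> k" for j
      using finite_strict_order.sorted_enum_unique[OF order[OF c(1) V] _ sorted_e that] by blast
    have "singular_face (Suc k) i (\<psi> c) = subsimplex k e (restrict (\<phi> c) (standard_simplex (sdim c)))"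
      unfolding \<psi>_def c(2) singular_face_eq e_def by (rule subsimplex_subsimplex[OF skip_le])
    also have "\<dots> = subsimplex k (\<pi>' \<circ> \<pi> c') (restrict (\<phi> c) (standard_simplex (sdim c)))"
      using same by (intro subsimplex_cong) simp
    also have "\<dots> = \<psi> c'"
    proof -
      have "vertex_map k (\<pi>' \<circ> \<pi> c') x = vertex_map k \<pi>' (vertex_map k (\<pi> c') x)" for x
        by (rule vertex_map_vertex_map[symmetric]) (use le[OF c'(1)] dim in auto)
      moreover have "vertex_map k \<pi>' y \<in> standard_simplex (sdim c)" if "y \<in> standard_simplex k" for y
        using vertex_map_in_standard_simplex[OF that, of \<pi>' "sdim c"] bij_betwE[OF c'(2)] V dim by auto
      ultimately show ?thesis
        using vm[OF c'(1)] c'(3) dim by (auto simp: subsimplex_def \<psi>_def intro!: restrict_ext)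
    qed
    finally show "\<exists>c'\<in>K. sdim c' = k \<and> singular_face (Suc k) i (\<psi> c) = \<psi> c'"
      using c'(1) dim by blast
  qed
  then show ?thesis
    by blast
qed

text \<open>The detecting cycle is carried to \<open>Y\<close>, replaced there by a simplicial cycle
  and carried back. Homologous cycles have the same value under a cocycle, so the result still
  detects the product.\<close>

lemma tensor_rank_det_le_card_simplices:
  fixes f :: "nat \<Rightarrow> ('a, real) cochain" and Y :: "'b topology" and K :: "'c set"
  assumes d: "odd d" and n: "n \<ge> 1" and f: "\<And>i. i < n \<Longrightarrow> f i \<in> singular_cocycles d X"
    and nonzero: "cup_cochain d X f n \<notin> singular_coboundaries (n * d) X"
    and complex: "simplicial_cell_complex Y K sdim \<phi>" and homeo: "Y homeomorphic_space X"
    and fin: "finite {c \<in> K. sdim c = n * d}"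
  shows "tensor_rank n n (det_tensor n :: _ \<Rightarrow> real) \<le> card {c \<in> K. sdim c = n * d}"
proof -
  define p where "p = n * d"
  have p: "p \<ge> 1"
    using d n by (auto simp: p_def elim: oddE)
  let ?F = "cup_cochain d X f n"
  have F: "?F \<in> singular_cocycles p X"
    unfolding p_def by (rule cup_cochain_cocycle[OF f])
  obtain z where z: "singular_chain p X z" "chain_boundary p z = 0" "chain_eval ?F z \<noteq> 0"
    using non_coboundary_detected_by_cycle[OF F _ p] nonzero unfolding p_def by blast
  obtain \<psi> where "ordered_cell_complex Y K sdim \<psi>"
    using simplicial_cell_complex_ordering[OF complex] by blast
  then interpret ordered_cell_complex Y K sdim \<psi> .
  obtain g h where gh: "homeomorphic_maps Y X g h"
    using homeo by (auto simp: homeomorphic_space_def)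
  then have cont: "continuous_map Y X g" "continuous_map X Y h" and id: "\<And>x. x \<in> topspace X \<Longrightarrow> g (h x)
      = x"
    by (auto simp: homeomorphic_maps_def)
  have "singular_chain p Y (chain_map p h z)"
    by (rule singular_chain_chain_map[OF z(1) cont(2)])
  moreover have "chain_boundary p (chain_map p h z) = 0"
    using z by (simp add: chain_boundary_chain_map)
  ultimately obtain s where s: "Poly_Mapping.keys s \<subseteq> \<psi> ` {c \<in> K. sdim c = p}"
    "singular_relboundary p Y {} (chain_map p h z - s)"
    using cycle_homologous_to_simplicial_cycle[OF p] by blast
  define s' where "s' = chain_map p g s"
  have "chain_map p g (chain_map p h z) = z"
    using chain_map_compose[of p g h] chain_map_id_gen[OF z(1), of "g \<circ> h"] id by (metis comp_apply)
  then have "singular_relboundary p X {} (z - s')"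
    using singular_relboundary_chain_map[OF s(2) cont(1), of "{}"] by (simp add: chain_map_diff s'_def)
  then obtain w where w: "singular_chain (Suc p) X w" "chain_boundary (Suc p) w = z - s'"
    by (auto simp: singular_boundary)
  then have s'_eq: "s' = z - chain_boundary (Suc p) w"
    by simp
  have "singular_chain p X s'"
    unfolding s'_eq using z(1) singular_chain_boundary_alt[OF w(1)] by (rule singular_chain_diff)
  moreover have "chain_boundary p s' = 0"
    using z(2) chain_boundary_boundary_alt[OF w(1)] by (simp add: s'_eq chain_boundary_diff)
  moreover have "chain_eval ?F s' = chain_eval ?F z"
  proof -
    have "chain_eval ?F (chain_boundary (Suc p) w) = 0"
      using chain_eval_coboundary[OF w(1), of ?F] F by (simp add: singular_cocycles_def chain_eval_def)
    then show ?thesis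
      by (simp add: s'_eq chain_eval_diff)
  qed
  ultimately have "tensor_rank n n (det_tensor n :: _ \<Rightarrow> real) \<le> card (Poly_Mapping.keys s')"
    using z(3) unfolding p_def by (intro tensor_rank_det_le_card_keys[OF d n f]) auto
  \<comment> \<open>Pushing forward to \<open>X\<close> can merge simplices but creates none, so the
    cells of dimension \<open>p\<close> still bound their number.\<close>
  also have "Poly_Mapping.keys s' \<subseteq> simplex_map p g ` \<psi> ` {c \<in> K. sdim c = p}"
    using s(1) keys_frag_extend[of "frag_of \<circ> simplex_map p g" s] by
        (fastforce simp: s'_def chain_map_def)
  then have "card (Poly_Mapping.keys s') \<le> card (simplex_map p g ` \<psi> ` {c \<in> K. sdim c = p})"
    using fin by (intro card_mono) (auto simp: p_def)
  also have "\<dots> \<le> card {c \<in> K. sdim c = p}"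
    using fin unfolding image_image p_def by (rule card_image_le)
  finally show ?thesis
    by (simp add: p_def)
qed

text \<open>As \<open>card\<close> is \<open>0\<close> on infinite sets, the bound is stated for
  finitely many simplices; infinitely many exceed every finite number.\<close>

theorem theorem2:
  fixes X :: "'a topology" and d n :: nat
    and \<alpha> :: "nat \<Rightarrow> ('a, real) cochain set"
    and Y :: "'b topology" and K :: "'c set"
    and sdim :: "'c \<Rightarrow> nat" and \<phi> :: "'c \<Rightarrow> (nat \<Rightarrow> real) \<Rightarrow> 'b"
  assumes "odd d" and "n \<ge> 1"
    and "\<And>i. i < n \<Longrightarrow> \<alpha> i \<in> carrier (cohomology_group d X)"
    and "cup_prod d X \<alpha> n \<noteq> \<one>\<^bsub>cohomology_group (n * d) X\<^esub>"
    and "simplicial_cell_complex Y K sdim \<phi>"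
    and "Y homeomorphic_space X"
  shows "(finite {c \<in> K. sdim c = n * d} \<longrightarrow>
            tensor_rank n n (det_tensor n :: _ \<Rightarrow> real) \<le> card {c \<in> K. sdim c = n * d})
       \<and> real (tensor_rank n n (det_tensor n :: _ \<Rightarrow> real)) \<ge> real n ^ (n - 1) / fact (n - 1)"
proof -
  have "\<forall>i\<in>{..<n}. \<exists>f. f \<in> singular_cocycles d X \<and> \<alpha> i = cohomology_class d X f"
    using assms(3) by (auto simp: carrier_cohomology_group)
  then obtain f where "\<forall>i\<in>{..<n}. f i \<in> singular_cocycles d X \<and> \<alpha> i = cohomology_class d X (f i)"
    by metis
  then have f: "\<And>i. i < n \<Longrightarrow> f i \<in> singular_cocycles d X" "\<And>i. i < n \<Longrightarrow> \<alpha> i = cohomology_class d X (f i)"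
    by auto
  have nonzero: "cup_cochain d X f n \<notin> singular_coboundaries (n * d) X"
  proof
    assume "cup_cochain d X f n \<in> singular_coboundaries (n * d) X"
    then have "cohomology_class (n * d) X (cup_cochain d X f n) = cohomology_class (n * d) X (\<lambda>_. 0)"
      by (intro cohomology_class_eqI) simp
    then show False
      using assms(4) cup_prod_eq_class[OF f] by (simp add: one_cohomology_group)
  qed
  have "tensor_rank n n (det_tensor n :: _ \<Rightarrow> real) \<le> card {c \<in> K. sdim c = n * d}"
    if "finite {c \<in> K. sdim c = n * d}"
    by (rule tensor_rank_det_le_card_simplices) (use f(1) in blast | fact assms nonzero that)+
  then show ?thesis
    using det_tensor_rank_lower_bound[OF assms(2)] by blast
qed

end
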